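(* Let $d\in\{-1,-2,-3,-7,-11,-19,-43,-67,-163\}$ and let $P(Y_1,Y_2)=(Y_1+\lambda Y_2)(Y_1+\overline{\lambda}Y_2)$ be the norm form of the imaginary quadratic field $\mathbb{Q}(\sqrt{d})$, where $\lambda=\sqrt{d}$ if $d\not\equiv 1\ (\mathrm{mod}\ 4)$ and $\lambda=\frac{1+\sqrt{d}}{2}$ if $d\equiv 1\ (\mathrm{mod}\ 4)$. Define $$C_P(N)=\#\big\{(n_1,n_2)\in\mathbb{N}^2: P(n_1,n_2)\le N\big\}.$$ Let $(X,\mu,T)$ be a uniquely ergodic system. Then for every $x\in X$ and every $f\in C(X)$, $$\lim_{N\to\infty}\frac{1}{C_P(N)}\sum_{\substack{(n_1,n_2)\in\mathbb{N}^2\\ P(n_1,n_2)\le N}} f\big(T^{\Omega(P(n_1,n_2))}x\big)=\int_X f\,d\mu .$$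
   Context: $\mathbb{N}$ denotes the positive integers. For $n\in\mathbb{N}$, $\Omega(n)$ is the total number of prime factors of $n$ counted with multiplicity. A uniquely ergodic system $(X,\mu,T)$ consists of a compact metric space $X$ and a continuous map $T:X\to X$ admitting exactly one $T$-invariant Borel probability measure, namely $\mu$. $C(X)$ is the space of continuous functions on $X$. *)

theory Defs
  imports
    "HOL-Probability.Probability"
    "HOL-Computational_Algebra.Primes"
begin

definition big_Omega :: "nat \<Rightarrow> nat" where
  "big_Omega n = size (prime_factorization n)"

(* For d < 0, csqrt (of_int d) = i * sqrt |d|. On int, mod 4 takes values in {0..3},
   also for negative d. *)
definition quad_lambda :: "int \<Rightarrow> complex" where
  "quad_lambda d =
     (if d mod 4 = 1 then (1 + csqrt (of_int d)) / 2 else csqrt (of_int d))"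

definition norm_form :: "int \<Rightarrow> complex \<Rightarrow> complex \<Rightarrow> complex" where
  "norm_form d y1 y2 = (y1 + quad_lambda d * y2) * (y1 + cnj (quad_lambda d) * y2)"

(* The value of the norm form at a pair of naturals, read as a natural number; for d < 0
   no information is lost, see of_nat_norm_form_nat below. *)
definition norm_form_nat :: "int \<Rightarrow> nat \<Rightarrow> nat \<Rightarrow> nat" where
  "norm_form_nat d n1 n2 = nat \<lfloor>Re (norm_form d (of_nat n1) (of_nat n2))\<rfloor>"

definition norm_form_pairs :: "int \<Rightarrow> nat \<Rightarrow> (nat \<times> nat) set" where
  "norm_form_pairs d N = {(n1, n2). 0 < n1 \<and> 0 < n2 \<and> norm_form_nat d n1 n2 \<le> N}"

definition norm_form_count :: "int \<Rightarrow> nat \<Rightarrow> nat" where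
  "norm_form_count d N = card (norm_form_pairs d N)"

definition invariant_prob_measure :: "'a::metric_space set \<Rightarrow> ('a \<Rightarrow> 'a) \<Rightarrow> 'a measure \<Rightarrow> bool" where
  "invariant_prob_measure X T \<nu> \<longleftrightarrow>
     prob_space \<nu> \<and> sets \<nu> = sets (restrict_space borel X) \<and> distr \<nu> \<nu> T = \<nu>"

(* The compact metric space is a compact subset X of a metric space; values of T outside X
   are irrelevant. *)
definition uniquely_ergodic_system :: "'a::metric_space set \<Rightarrow> 'a measure \<Rightarrow> ('a \<Rightarrow> 'a) \<Rightarrow> bool" where
  "uniquely_ergodic_system X \<mu> T \<longleftrightarrow>
     compact X \<and> T ` X \<subseteq> X \<and> continuous_on X T \<and>
     invariant_prob_measure X T \<mu> \<and> (\<forall>\<nu>. invariant_prob_measure X T \<nu> \<longrightarrow> \<nu> = \<mu>)"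

lemma norm_form_of_nat:
  assumes "d < 0"
  shows "norm_form d (of_nat m) (of_nat n) =
    of_int (if d mod 4 = 1 then int m ^ 2 + int m * int n + (1 - d) div 4 * int n ^ 2
            else int m ^ 2 - d * int n ^ 2)"
proof -
  have c: "csqrt (of_int d) = \<i> * of_real (sqrt (- real_of_int d))"
    using csqrt_of_real_nonpos[of "real_of_int d"] assms by simp
  have s: "sqrt (- real_of_int d) * sqrt (- real_of_int d) = - real_of_int d"
    using assms by simp
  show ?thesis
  proof (cases "d mod 4 = 1")
    case True
    then have "4 * ((1 - d) div 4) = 1 - d" by presburger
    then have k: "4 * real_of_int ((1 - d) div 4) = 1 - real_of_int d"
      by linarith
    define r where "r = sqrt (- real_of_int d)"
    define e where "e = real_of_int ((1 - d) div 4)"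
    have re: "r * r = 4 * e - 1" using s k by (simp add: r_def e_def)
    have "(real m + real n / 2) * (real m + real n / 2) + (r * real n / 2) * (r * real n / 2)
        = real m ^ 2 + real m * real n + (1 + r * r) / 4 * real n ^ 2"
      by (simp add: field_simps power2_eq_square)
    also have "(1 + r * r) / 4 = e" using re by simp
    finally have "(real m + real n / 2) * (real m + real n / 2) + (r * real n / 2) * (r * real n / 2)
        = real m ^ 2 + real m * real n + e * real n ^ 2" .
    then have "complex_of_real ((real m + real n / 2) * (real m + real n / 2)
          + (r * real n / 2) * (r * real n / 2))
        = complex_of_real (real m ^ 2 + real m * real n + e * real n ^ 2)"
      by simp
    moreover have "norm_form d (of_nat m) (of_nat n) =
        complex_of_real ((real m + real n / 2) * (real m + real n / 2)
          + (r * real n / 2) * (r * real n / 2))"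
      using True unfolding norm_form_def quad_lambda_def c r_def[symmetric]
      by (simp add: complex_eq_iff field_simps)
    ultimately show ?thesis using True by (simp add: e_def)
  next
    case False
    have "norm_form d (of_nat m) (of_nat n) =
        complex_of_real (real m ^ 2 + (sqrt (- real_of_int d) * sqrt (- real_of_int d)) * real n ^ 2)"
      using False unfolding norm_form_def quad_lambda_def c
      by (simp add: complex_eq_iff field_simps power2_eq_square del: real_sqrt_mult_self)
    then show ?thesis using False unfolding s by simp
  qed
qed

lemma norm_form_int_ge:
  assumes "d < 0"
  shows "int m ^ 2 + int n ^ 2 \<le>
    (if d mod 4 = 1 then int m ^ 2 + int m * int n + (1 - d) div 4 * int n ^ 2
     else int m ^ 2 - d * int n ^ 2)"
proof (cases "d mod 4 = 1")
  case True
  then have "1 \<le> (1 - d) div 4" using assms by presburger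
  then have "1 * int n ^ 2 \<le> (1 - d) div 4 * int n ^ 2"
    by (intro mult_right_mono) auto
  then show ?thesis using True by (simp add: add_increasing)
next
  case False
  have "1 * int n ^ 2 \<le> (- d) * int n ^ 2"
    using assms by (intro mult_right_mono) auto
  then show ?thesis using False by simp
qed

lemma of_nat_norm_form_nat:
  assumes "d < 0"
  shows "of_nat (norm_form_nat d m n) = norm_form d (of_nat m) (of_nat n)"
proof -
  define k where "k = (if d mod 4 = 1 then int m ^ 2 + int m * int n + (1 - d) div 4 * int n ^ 2
     else int m ^ 2 - d * int n ^ 2)"
  have e: "norm_form d (of_nat m) (of_nat n) = of_int k"
    unfolding k_def by (rule norm_form_of_nat[OF assms])
  have "0 \<le> int m ^ 2 + int n ^ 2" by simp
  also have "\<dots> \<le> k" unfolding k_def by (rule norm_form_int_ge[OF assms])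
  finally show ?thesis unfolding norm_form_nat_def e by simp
qed

lemma finite_norm_form_pairs:
  assumes "d < 0"
  shows "finite (norm_form_pairs d N)"
proof (rule finite_subset)
  show "norm_form_pairs d N \<subseteq> {..N} \<times> {..N}"
  proof clarify
    fix m n assume "(m, n) \<in> norm_form_pairs d N"
    then have le: "norm_form_nat d m n \<le> N" by (simp add: norm_form_pairs_def)
    have "complex_of_int (int (norm_form_nat d m n)) = norm_form d (of_nat m) (of_nat n)"
      using of_nat_norm_form_nat[OF assms, of m n] by simp
    then have "int (norm_form_nat d m n) =
        (if d mod 4 = 1 then int m ^ 2 + int m * int n + (1 - d) div 4 * int n ^ 2
         else int m ^ 2 - d * int n ^ 2)"
      unfolding norm_form_of_nat[OF assms] of_int_eq_iff .
    then have "int m ^ 2 + int n ^ 2 \<le> int (norm_form_nat d m n)"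
      using norm_form_int_ge[OF assms, of m n] by argo
    then have "int (m ^ 2 + n ^ 2) \<le> int N"
      using le by simp
    then have "m ^ 2 + n ^ 2 \<le> N"
      unfolding of_nat_le_iff .
    moreover have "m \<le> m ^ 2" "n \<le> n ^ 2" by (simp_all add: power2_eq_square)
    ultimately show "m \<in> {..N} \<and> n \<in> {..N}" by simp
  qed
qed simp

end

theory Submission
  imports Defs
begin

text \<open>
Write \<open>O\<close> for the ring of integers of the field; the norm form is \<open>P(x, y) = N(x + y \<lambda>)\<close>, so
the theorem is about \<open>\<Omega>(N \<alpha>)\<close> for \<open>\<alpha>\<close> running over the lattice points of the angular sector
spanned by 1 and \<open>\<lambda>\<close>. It follows from two facts.

The first is ergodic: in a uniquely ergodic system the averages \<open>(1/M) \<Sum>k<M. f (T^k y)\<close> converge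
uniformly in \<open>y\<close>. If they did not, an ultrafilter limit of bad averages would be an invariant mean
on \<open>C(X)\<close>, hence by Riesz an invariant measure, other than \<open>\<mu>\<close>
(\<open>uniform_ergodic_averages\<close>).

The second is arithmetic: for every bounded \<open>a : \<nat> \<rightarrow> \<real>\<close> the averages over the sector of
\<open>a(\<Omega>(N \<alpha>) + 1) - a(\<Omega>(N \<alpha>))\<close> tend to 0 (\<open>pairs_shift_average\<close>). Iterating it replaces
\<open>a(\<Omega>)\<close> by \<open>(1/M) \<Sum>k<M. a(\<Omega> + k)\<close>, which for \<open>a(n) = f(T^n x)\<close> is close to \<open>\<integral> f d\<mu>\<close> at
every lattice point.

For the arithmetic fact, test the lattice against Lipschitz bumps \<open>\<phi>\<close> and pass to ultrafilter
limits \<open>L j \<phi> = lim X^(-2) \<Sum>\<alpha>. \<phi>(\<alpha>/X) a(\<Omega>(N \<alpha>) + j)\<close> as \<open>X \<rightarrow> \<infinity>\<close>. Moving \<open>\<phi>\<close> by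
the multiplicative group turns \<open>L j\<close> into a uniformly continuous function \<open>G j\<close> on
\<open>\<complex> - {0}\<close>. The dual of the Turan-Kubilius inequality (\<open>turan_kubilius_dual\<close>), which rests only
on the equidistribution of \<open>\<pi> O\<close> in \<open>O\<close>, says that \<open>\<Sum>\<pi>. (G j z - G (j+1) (z \<pi>))^2 / N \<pi>\<close>
is finite, the sum being over prime elements of prime norm. So, outside a set of primes with finite
\<open>\<Sum> 1 / N \<pi>\<close>, the value \<open>G j z\<close> is nearly \<open>G (j+1) (z \<pi>)\<close>. If two such primes \<open>\<pi>, \<rho>\<close> have
quotient close to \<open>s\<close>, then \<open>G j\<close> does not change under multiplication by \<open>s\<close>. The \<open>s\<close> with
this invariance form a closed subgroup of \<open>\<complex> - {0}\<close>, and it is everything: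

\<^item> It contains the unit circle. Otherwise its part on the circle is finite, and, comparing each \<open>\<pi>\<close>
  with its conjugate, \<open>(\<pi> / cnj \<pi>)^k\<close> would have real part above 1/2 for almost all \<open>\<pi>\<close> and some fixed
  \<open>k > 0\<close>. Then \<open>\<Sum> Re (\<pi> / cnj \<pi>)^k N(\<pi>)^(-s)\<close> would be unbounded as \<open>s\<close> decreases to 1, whereas the
  corresponding Hecke L-series is bounded there (\<open>split_angles_spread\<close>). The argument stays at real \<open>s > 1\<close> and
  rests on an upper bound for the L-series.

\<^item> It contains the positive reals. Otherwise the norms of almost all \<open>\<pi>\<close> would be confined, in each
  multiplicative window of fixed length, to a very short subinterval. Bounding the primes
  between \<open>n\<close> and \<open>n + h\<close> by the binomial coefficient \<open>n + h choose h\<close>, which they all divide, shows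
  that this leaves too few primes (\<open>split_norms_spread\<close>).

So \<open>G j\<close> is constant and equal to \<open>G (j+1)\<close>, which is \<open>L j = L (j+1)\<close> (\<open>L_shift_invariant\<close>). It
remains to approximate the indicator of the sector by Lipschitz bumps.

The rings enter through unique factorisation: a rational prime either stays prime
in \<open>O\<close> or is the norm of an element (\<open>root_imp_norm\<close>), and this is where the nine
discriminants are singled out.
\<close>

section \<open>Invariant means and uniform convergence of ergodic averages\<close>

text \<open>
This is an ultrafilter in the form in which it is used: a finer filter along which every bounded
real function converges. Bounded functions on the index set are coordinates with values in compact
intervals, so by Tychonoff the evaluation map has a cluster point, and the filter of indices that
come close to it does what is required. The extra coordinate \<open>B\<close> truncates, so that functions that
are bounded only eventually are covered as well.
\<close>

lemma ultrafilter_refinement: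
  fixes F :: "'i filter"
  assumes "F \<noteq> bot"
  obtains G where "G \<le> F" "G \<noteq> bot"
    "\<And>h :: 'i \<Rightarrow> real. (\<exists>B. \<forall>\<^sub>F x in F. \<bar>h x\<bar> \<le> B) \<Longrightarrow> \<exists>l. (h \<longlongrightarrow> l) G"
proof -
  define \<Phi> :: "'i \<Rightarrow> ('i \<Rightarrow> real) \<times> real \<Rightarrow> real"
    where "\<Phi> x = (\<lambda>(h, B). max (- B) (min B (h x)))" for x
  define K where "K = PiE UNIV (\<lambda>(h :: 'i \<Rightarrow> real, B :: real). {- \<bar>B\<bar>..\<bar>B\<bar>})"
  have "compactin (product_topology (\<lambda>i. euclidean) UNIV) K"
    unfolding K_def compactin_PiE by (auto simp: split_beta)
  hence cK: "compact K"
    by (simp add: euclidean_product_topology)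
  have inK: "\<Phi> x \<in> K" for x
    by (auto simp: K_def \<Phi>_def split: prod.splits)
  have "filtermap \<Phi> F \<noteq> bot" "\<forall>\<^sub>F y in filtermap \<Phi> F. y \<in> K"
    using assms inK by (auto simp: filtermap_bot_iff eventually_filtermap)
  then obtain y where y: "inf (nhds y) (filtermap \<Phi> F) \<noteq> bot"
    using cK unfolding compact_filter by blast
  define G where "G = inf F (filtercomap \<Phi> (nhds y))"
  have "G \<noteq> bot"
  proof
    assume "G = bot"
    then obtain P Q where PQ: "eventually P F" "eventually Q (filtercomap \<Phi> (nhds y))"
      "\<And>x. P x \<Longrightarrow> Q x \<Longrightarrow> False"
      unfolding G_def trivial_limit_def eventually_inf by blast
    then obtain R where R: "eventually R (nhds y)" "\<And>x. R (\<Phi> x) \<Longrightarrow> Q x"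
      unfolding eventually_filtercomap by blast
    have "eventually (\<lambda>z. \<not> R z) (filtermap \<Phi> F)"
      unfolding eventually_filtermap using PQ(1) by eventually_elim (use PQ R in blast)
    hence "eventually (\<lambda>_. False) (inf (nhds y) (filtermap \<Phi> F))"
      unfolding eventually_inf using R(1) by blast
    thus False using y by (simp add: trivial_limit_def)
  qed
  have "(\<Phi> \<longlongrightarrow> y) G"
    unfolding filterlim_def G_def
    by (rule order_trans[OF filtermap_mono[OF inf_le2] filtermap_filtercomap])
  hence lim: "((\<lambda>x. \<Phi> x i) \<longlongrightarrow> y i) G" for i
    using continuous_on_tendsto_compose[OF continuous_on_product_coordinates, of \<Phi> y G i] by simp
  have GF: "G \<le> F" by (simp add: G_def)
  show ?thesis
  proof (rule that[OF GF \<open>G \<noteq> bot\<close>])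
    fix h :: "'i \<Rightarrow> real" assume "\<exists>B. \<forall>\<^sub>F x in F. \<bar>h x\<bar> \<le> B"
    then obtain B where "\<forall>\<^sub>F x in F. \<bar>h x\<bar> \<le> B" by blast
    hence "\<forall>\<^sub>F x in G. \<bar>h x\<bar> \<le> B" using GF by (rule filter_leD[rotated])
    hence "\<forall>\<^sub>F x in G. \<Phi> x (h, B) = h x"
      by eventually_elim (auto simp: \<Phi>_def)
    hence "(h \<longlongrightarrow> y (h, B)) G"
      using lim[of "(h, B)"] by (simp add: tendsto_cong)
    thus "\<exists>l. (h \<longlongrightarrow> l) G" by blast
  qed
qed

text \<open>
A normalised positive linear functional on the continuous functions on a compact set. The Riesz
representation theorem for it is proved by Daniell's method: the outer measure of a set is the
least total mean of a countable family of nonnegative continuous functions whose sum is at least 1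
on the set. Countable subadditivity is then immediate, and compactness enters through \<open>L_le_outer\<close>.
\<close>

locale mean_functional =
  fixes X :: "'a::metric_space set" and L :: "('a \<Rightarrow> real) \<Rightarrow> real"
  assumes compact: "compact X"
    and L_add: "continuous_on X f \<Longrightarrow> continuous_on X g \<Longrightarrow> L (\<lambda>x. f x + g x) = L f + L g"
    and L_cmult: "continuous_on X f \<Longrightarrow> L (\<lambda>x. c * f x) = c * L f"
    and L_nonneg: "continuous_on X f \<Longrightarrow> (\<And>x. x \<in> X \<Longrightarrow> 0 \<le> f x) \<Longrightarrow> 0 \<le> L f"
    and L_one: "L (\<lambda>x. 1) = 1"
begin

lemma L_diff:
  assumes "continuous_on X f" "continuous_on X g"
  shows "L (\<lambda>x. f x - g x) = L f - L g"
proof -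
  have "L (\<lambda>x. f x + (-1) * g x) = L f + L (\<lambda>x. (-1) * g x)"
    by (rule L_add) (intro continuous_intros assms)+
  thus ?thesis using L_cmult[OF assms(2), of "-1"] by simp
qed

lemma L_mono:
  assumes "continuous_on X f" "continuous_on X g" "\<And>x. x \<in> X \<Longrightarrow> f x \<le> g x"
  shows "L f \<le> L g"
  using L_nonneg[of "\<lambda>x. g x - f x"] L_diff[OF assms(2,1)] assms(3)
  by (auto intro!: continuous_intros assms)

lemma L_const: "L (\<lambda>x. c) = c"
  using L_cmult[of "\<lambda>x. 1" c] L_one by simp

lemma L_zero: "L (\<lambda>x. 0) = 0"
  using L_const[of 0] by simp

lemma L_sum:
  assumes "finite I" "\<And>i. i \<in> I \<Longrightarrow> continuous_on X (f i)"
  shows "L (\<lambda>x. \<Sum>i\<in>I. f i x) = (\<Sum>i\<in>I. L (f i))"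
  using assms by (induction I rule: finite_induct) (auto simp: L_zero L_add continuous_on_sum)

definition covers :: "'a set \<Rightarrow> (nat \<Rightarrow> 'a \<Rightarrow> real) set" where
  "covers A = {f. (\<forall>n. continuous_on X (f n) \<and> (\<forall>x\<in>X. 0 \<le> f n x))
                \<and> (\<forall>x\<in>A \<inter> X. 1 \<le> (\<Sum>n. ennreal (f n x)))}"

definition outer :: "'a set \<Rightarrow> ennreal" where
  "outer A = (INF f\<in>covers A. \<Sum>n. ennreal (L (f n)))"

lemma coversD:
  assumes "f \<in> covers A"
  shows "continuous_on X (f n)" "x \<in> X \<Longrightarrow> 0 \<le> f n x" "0 \<le> L (f n)"
    "x \<in> A \<Longrightarrow> x \<in> X \<Longrightarrow> 1 \<le> (\<Sum>n. ennreal (f n x))"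
  using assms by (auto simp: covers_def intro!: L_nonneg)

lemma outer_le: "f \<in> covers A \<Longrightarrow> outer A \<le> (\<Sum>n. ennreal (L (f n)))"
  unfolding outer_def by (rule INF_lower)

lemma outer_le_double:
  assumes "\<And>m n. continuous_on X (f m n)" "\<And>m n x. x \<in> X \<Longrightarrow> 0 \<le> f m n x"
    and "\<And>x. x \<in> A \<Longrightarrow> x \<in> X \<Longrightarrow> 1 \<le> (\<Sum>m. \<Sum>n. ennreal (f m n x))"
  shows "outer A \<le> (\<Sum>m. \<Sum>n. ennreal (L (f m n)))"
proof -
  define g where "g i = (case prod_decode i of (m, n) \<Rightarrow> f m n)" for i
  have 1: "(\<Sum>i. ennreal (g i x)) = (\<Sum>m. \<Sum>n. ennreal (f m n x))" for x
    unfolding g_def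
    using suminf_ennreal_2dimen[of "\<lambda>m. \<Sum>n. ennreal (f m n x)" "\<lambda>(m, n). ennreal (f m n x)"]
    by (simp add: split_beta)
  have 2: "(\<Sum>i. ennreal (L (g i))) = (\<Sum>m. \<Sum>n. ennreal (L (f m n)))"
    unfolding g_def
    using suminf_ennreal_2dimen[of "\<lambda>m. \<Sum>n. ennreal (L (f m n))" "\<lambda>(m, n). ennreal (L (f m n))"]
    by (simp add: split_beta)
  have "g \<in> covers A"
    unfolding covers_def using assms 1 by (auto simp: g_def split_beta)
  thus ?thesis using outer_le[of g A] 2 by simp
qed

lemma outer_mono: "A \<subseteq> B \<Longrightarrow> outer A \<le> outer B"
  unfolding outer_def by (rule INF_superset_mono) (auto simp: covers_def)

text \<open>
A continuous function below the indicator of \<open>A\<close> is dominated by every cover of \<open>A\<close> up to an error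
\<open>e\<close>: finitely many members of the cover are enough, since the open sets on which a partial sum
exceeds \<open>g - e\<close> increase to \<open>X\<close>.
\<close>

lemma L_le_outer:
  assumes g: "continuous_on X g" and "\<And>x. x \<in> X \<Longrightarrow> x \<in> A \<Longrightarrow> g x \<le> 1"
    and "\<And>x. x \<in> X \<Longrightarrow> x \<notin> A \<Longrightarrow> g x \<le> 0"
  shows "ennreal (L g) \<le> outer A"
  unfolding outer_def
proof (rule INF_greatest)
  fix f assume f: "f \<in> covers A"
  note D = coversD[OF f]
  show "ennreal (L g) \<le> (\<Sum>n. ennreal (L (f n)))"
  proof (rule ennreal_le_epsilon)
    fix e :: real assume e: "0 < e"
    have c: "continuous_on X (\<lambda>x. (\<Sum>n<N. f n x) - g x)" for N
      by (intro continuous_intros D g)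
    have "\<exists>U. open U \<and> U \<inter> X = {x\<in>X. (\<Sum>n<N. f n x) - g x > -e}" for N
    proof -
      have "openin (top_of_set X) (X \<inter> (\<lambda>x. (\<Sum>n<N. f n x) - g x) -` {-e<..})"
        using continuous_openin_preimage_gen[OF c[of N], of "{-e<..}"] by simp
      then obtain U where "open U" "X \<inter> (\<lambda>x. (\<Sum>n<N. f n x) - g x) -` {-e<..} = U \<inter> X"
        unfolding openin_open by blast
      thus ?thesis by (intro exI[of _ U]) auto
    qed
    then obtain U where U: "\<And>N. open (U N)" 
        "\<And>N. U N \<inter> X = {x\<in>X. (\<Sum>n<N. f n x) - g x > -e}"
      by metis
    (* Off A the empty sum is enough, since there g is nonpositive. *)
    have "X \<subseteq> (\<Union>N\<in>UNIV. U N)"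
    proof
      fix x assume x: "x \<in> X"
      have "\<exists>N. (\<Sum>n<N. f n x) - g x > -e"
      proof (cases "x \<in> A")
        case False
        thus ?thesis using assms(3)[OF x] e by (intro exI[of _ 0]) auto
      next
        case True
        have "ennreal (1 - e) < (\<Sum>n. ennreal (f n x))"
          by (rule less_le_trans[OF _ D(4)[OF True x]]) (use e in \<open>simp add: ennreal_less_one_iff\<close>)
        also have "\<dots> = (SUP N. \<Sum>n<N. ennreal (f n x))"
          by (rule suminf_eq_SUP)
        finally obtain N where "ennreal (1 - e) < (\<Sum>n<N. ennreal (f n x))"
          unfolding less_SUP_iff by blast
        also have "(\<Sum>n<N. ennreal (f n x)) = ennreal (\<Sum>n<N. f n x)"
          using D(2)[OF x] by (intro sum_ennreal)
        finally have "1 - e < (\<Sum>n<N. f n x)"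
          by (meson ennreal_leI not_le)
        thus ?thesis using assms(2)[OF x True] by (intro exI[of _ N]) auto
      qed
      thus "x \<in> (\<Union>N\<in>UNIV. U N)" using U x by blast
    qed
    then obtain I where I: "finite I" "X \<subseteq> (\<Union>N\<in>I. U N)"
      using compactE_image[OF compact, of UNIV U] U(1) by metis
    define N where "N = Max (insert 0 I)"
    have le: "g x - e \<le> (\<Sum>n<N. f n x)" if x: "x \<in> X" for x
    proof -
      obtain M where M: "M \<in> I" "x \<in> U M" using I x by blast
      have "(\<Sum>n<M. f n x) \<le> (\<Sum>n<N. f n x)"
      proof (rule sum_mono2)
        have "M \<le> N" unfolding N_def using M I by (intro Max_ge) auto
        thus "{..<M} \<subseteq> {..<N}" by auto
      qed (use D(2)[OF x] in auto)
      moreover have "x \<in> {x\<in>X. (\<Sum>n<M. f n x) - g x > -e}"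
        unfolding U(2)[of M, symmetric] using M x by blast
      ultimately show ?thesis by simp
    qed
    have "L g - e = L (\<lambda>x. g x - e)"
      by (subst L_diff[OF g]) (auto simp: L_const)
    also have "\<dots> \<le> L (\<lambda>x. \<Sum>n<N. f n x)"
      by (rule L_mono) (auto intro!: continuous_intros g D le)
    also have "\<dots> = (\<Sum>n<N. L (f n))"
      by (rule L_sum) (auto intro: D)
    finally have "L g \<le> (\<Sum>n<N. L (f n)) + e" by simp
    hence "ennreal (L g) \<le> ennreal ((\<Sum>n<N. L (f n)) + e)" by (rule ennreal_leI)
    also have "\<dots> = (\<Sum>n<N. ennreal (L (f n))) + ennreal e"
      using D e by (subst ennreal_plus) (auto intro!: sum_nonneg)
    also have "(\<Sum>n<N. ennreal (L (f n))) \<le> (\<Sum>n. ennreal (L (f n)))"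
      by (rule sum_le_suminf) auto
    finally show "ennreal (L g) \<le> (\<Sum>n. ennreal (L (f n))) + ennreal e"
      by (simp add: add_mono)
  qed
qed

lemma outer_UNIV: "outer UNIV = 1"
proof (rule antisym)
  have "(\<Sum>n. ennreal (if n = 0 then 1 else 0)) = (\<Sum>n\<in>{0::nat}. ennreal (if n = 0 then 1 else 0))"
    by (rule suminf_finite) auto
  hence s: "(\<Sum>n. ennreal (if n = (0::nat) then 1 else 0)) = 1" by simp
  hence "(\<lambda>n x. if n = 0 then 1 else 0) \<in> covers UNIV"
    by (auto simp: covers_def)
  from outer_le[OF this] have "outer UNIV \<le> (\<Sum>n. ennreal (L (\<lambda>x. if n = (0::nat) then 1 else 0)))" .
  also have "(\<lambda>n. ennreal (L (\<lambda>x. if n = (0::nat) then 1 else 0))) = (\<lambda>n. ennreal (if n = 0 then 1 else 0))"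
    by (auto simp: L_const)
  finally show "outer UNIV \<le> 1" using s by simp
  show "1 \<le> outer UNIV"
    using L_le_outer[of "\<lambda>x. 1" UNIV] by (simp add: L_one)
qed

lemma ennreal_sum_halves: "(\<Sum>n. ennreal (e * (1/2) ^ Suc n)) = ennreal e" if "e > 0"
proof -
  have "(\<lambda>n. e * (1/2) ^ Suc n) sums (e * 1)"
    by (intro sums_mult power_half_series)
  thus ?thesis
    using that by (intro suminf_ennreal_eq) (auto intro: sums_mult)
qed

lemma cover_approx:
  assumes "outer A < top" "e > 0"
  obtains f where "f \<in> covers A" "(\<Sum>n. ennreal (L (f n))) \<le> outer A + ennreal e"
proof -
  have "outer A + 0 < outer A + ennreal e"
    using assms by (subst ennreal_add_left_cancel_less) auto
  hence "outer A < outer A + ennreal e" by simp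
  hence "\<exists>f\<in>covers A. (\<Sum>n. ennreal (L (f n))) < outer A + ennreal e"
    by (subst (asm) outer_def) (simp add: INF_less_iff)
  thus ?thesis using that less_imp_le by blast
qed

lemma outer_finite: "outer A < top"
  using outer_mono[of A UNIV] outer_UNIV by (auto simp: le_less_trans)

lemma outer_empty: "outer {} = 0"
proof -
  have "(\<lambda>n x. 0) \<in> covers {}" by (auto simp: covers_def)
  from outer_le[OF this] show ?thesis by (simp add: L_zero)
qed

lemma outer_countably_subadditive: "outer (\<Union>i. A i) \<le> (\<Sum>i. outer (A i))" for A :: "nat \<Rightarrow> 'a set"
proof (rule ennreal_le_epsilon)
  fix e :: real assume e: "0 < e"
  have p: "0 < e * (1/2) ^ Suc i" for i :: nat using e by simp
  have "\<forall>i. \<exists>f\<in>covers (A i). (\<Sum>n. ennreal (L (f n))) \<le> outer (A i) + ennreal (e * (1/2) ^ Suc i)"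
    by (intro allI, rule cover_approx[OF outer_finite p]) blast
  then obtain f where f: "\<And>i. f i \<in> covers (A i)"
     "\<And>i. (\<Sum>n. ennreal (L (f i n))) \<le> outer (A i) + ennreal (e * (1/2) ^ Suc i)"
    by metis
  have "outer (\<Union>i. A i) \<le> (\<Sum>i. \<Sum>n. ennreal (L (f i n)))"
  proof (rule outer_le_double)
    fix x assume "x \<in> (\<Union>i. A i)" "x \<in> X"
    then obtain i where i: "x \<in> A i" by blast
    have "1 \<le> (\<Sum>n. ennreal (f i n x))" using coversD(4)[OF f(1) i \<open>x \<in> X\<close>] .
    also have "\<dots> \<le> (\<Sum>i. \<Sum>n. ennreal (f i n x))"
      using sum_le_suminf[of "\<lambda>i. \<Sum>n. ennreal (f i n x)" "{i}"] by auto
    finally show "1 \<le> (\<Sum>i. \<Sum>n. ennreal (f i n x))" .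
  qed (use coversD[OF f(1)] in auto)
  also have "\<dots> \<le> (\<Sum>i. outer (A i) + ennreal (e * (1/2) ^ Suc i))"
    by (intro suminf_le f) auto
  also have "\<dots> = (\<Sum>i. outer (A i)) + (\<Sum>i. ennreal (e * (1/2) ^ Suc i))"
    by (subst suminf_add) auto
  also have "(\<Sum>i. ennreal (e * (1/2) ^ Suc i)) = ennreal e"
    by (rule ennreal_sum_halves[OF e])
  finally show "outer (\<Union>i. A i) \<le> (\<Sum>i. outer (A i)) + ennreal e" .
qed

lemma outer_subadditive: "outer (A \<union> B) \<le> outer A + outer B"
proof -
  define C where "C i = (if i = 0 then A else if i = Suc 0 then B else {})" for i :: nat
  have "(\<Union>i. C i) = A \<union> B" by (auto simp: C_def split: if_splits)
  moreover have "(\<Sum>i. outer (C i)) = (\<Sum>i\<in>{0,1}. outer (C i))"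
    by (rule suminf_finite) (auto simp: C_def outer_empty)
  ultimately show ?thesis
    using outer_countably_subadditive[of C] by (simp add: C_def)
qed


text \<open>
The Caratheodory criterion for cozero sets, which include all open sets. The functions
\<open>w k = min 1 (k h)\<close> increase to the indicator of \<open>l\<close>. Each member \<open>f n\<close> of a cover of \<open>A\<close> is cut into
the telescoping slices \<open>f n (w (k+1) - w k)\<close>, which together cover \<open>l \<inter> A\<close>, and into a single remainder
\<open>f n (1 - w K)\<close>, which covers the rest because \<open>w\<close> vanishes off \<open>l\<close>. When \<open>K\<close> is large, depending on
\<open>n\<close>, the two parts cost little more than \<open>f n\<close>.
\<close>

lemma outer_split_cozero:
  fixes h :: "'a \<Rightarrow> real"
  assumes h: "continuous_on X h" "\<And>x. x \<in> X \<Longrightarrow> 0 \<le> h x"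
  defines "l \<equiv> {x. 0 < h x}"
  shows "outer (l \<inter> A) + outer ((UNIV - l) \<inter> A) = outer A"
proof (rule antisym)
  have "A = (l \<inter> A) \<union> ((UNIV - l) \<inter> A)" by blast
  thus "outer A \<le> outer (l \<inter> A) + outer ((UNIV - l) \<inter> A)"
    using outer_subadditive by metis
next
  define w where "w k x = min 1 (real k * h x)" for k x
  have w: "continuous_on X (w k)" "x \<in> X \<Longrightarrow> 0 \<le> w k x" "w k x \<le> 1" for k x
    unfolding w_def using h by (auto intro!: continuous_intros)
  have w0: "w 0 x = 0" for x by (simp add: w_def)
  have w_mono: "w k x \<le> w (Suc k) x" if "x \<in> X" for k x
    using h(2)[OF that] unfolding w_def by (intro min.mono mult_right_mono) auto
  have w_ev: "\<exists>k. w k x = 1" if "x \<in> l" for x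
  proof -
    have hx: "h x > 0" using that by (simp add: l_def)
    obtain k :: nat where "1 / h x \<le> real k" using real_arch_simple by blast
    hence "1 \<le> real k * h x" using hx by (simp add: field_simps)
    thus ?thesis by (intro exI[of _ k]) (simp add: w_def)
  qed
  show "outer (l \<inter> A) + outer ((UNIV - l) \<inter> A) \<le> outer A"
  proof (rule ennreal_le_epsilon)
    fix e :: real assume e: "0 < e"
    hence e2: "e / 2 > 0" by simp
    obtain f where f: "f \<in> covers A" "(\<Sum>n. ennreal (L (f n))) \<le> outer A + ennreal (e/2)"
      using cover_approx[OF outer_finite e2] by blast
    note D = coversD[OF f(1)]
    define d where "d n k x = f n x * (w (Suc k) x - w k x)" for n k x
    have d: "continuous_on X (d n k)" "x \<in> X \<Longrightarrow> 0 \<le> d n k x" for n k x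
      unfolding d_def using D(2)[of x n] w_mono[of x k] by (auto intro!: continuous_intros D w)
    have fw: "continuous_on X (\<lambda>x. f n x * w k x)" for n k
      by (intro continuous_intros D w)
    have dsum: "(\<Sum>k<K. d n k x) = f n x * w K x" for n K x
      unfolding d_def sum_distrib_left[symmetric]
      using sum_lessThan_telescope[of "\<lambda>k. w k x" K] w0 by simp
    have Ldsum: "(\<Sum>k<K. L (d n k)) = L (\<lambda>x. f n x * w K x)" for n K
      by (subst L_sum[symmetric]) (auto simp: dsum intro: d)
    have Ld0: "0 \<le> L (d n k)" for n k using d by (intro L_nonneg)
    have Ldle: "L (\<lambda>x. f n x * w K x) \<le> L (f n)" for n K
      using D w by (intro L_mono fw D) (auto intro: mult_left_le)
    have summ: "summable (\<lambda>k. L (d n k))" for n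
    proof (rule bounded_imp_summable)
      show "(\<Sum>k\<le>K. L (d n k)) \<le> L (f n)" for K
        unfolding lessThan_Suc_atMost[symmetric] Ldsum by (rule Ldle)
    qed (rule Ld0)
    define s where "s n = (\<Sum>k. L (d n k))" for n
    have s: "(\<Sum>k. ennreal (L (d n k))) = ennreal (s n)" for n
      unfolding s_def by (intro suminf_ennreal2 summ Ld0)
    have s0: "0 \<le> s n" for n unfolding s_def by (intro suminf_nonneg summ Ld0)
    have one: "outer (l \<inter> A) \<le> (\<Sum>n. ennreal (s n))"
      unfolding s[symmetric]
    proof (rule outer_le_double)
      fix x assume x: "x \<in> l \<inter> A" "x \<in> X"
      obtain K where K: "w K x = 1" using w_ev x by blast
      have "ennreal (f n x) \<le> (\<Sum>k. ennreal (d n k x))" for n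
      proof -
        have "ennreal (f n x) = (\<Sum>k<K. ennreal (d n k x))"
          using d(2)[OF x(2)] by (subst sum_ennreal) (auto simp: dsum K)
        also have "\<dots> \<le> (\<Sum>k. ennreal (d n k x))" by (rule sum_le_suminf) auto
        finally show ?thesis .
      qed
      hence "(\<Sum>n. ennreal (f n x)) \<le> (\<Sum>n. \<Sum>k. ennreal (d n k x))"
        by (intro suminf_le) auto
      thus "1 \<le> (\<Sum>n. \<Sum>k. ennreal (d n k x))"
        using D(4)[of x] x by (meson IntD2 order_trans)
    qed (auto intro: d)
    have "\<exists>K. s n - L (\<lambda>x. f n x * w K x) \<le> e / 2 * (1/2) ^ Suc n" for n
    proof -
      have "(\<lambda>K. \<Sum>k<K. L (d n k)) \<longlonglongrightarrow> s n"
        unfolding s_def by (rule summable_LIMSEQ[OF summ])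
      moreover have "s n - e / 2 * (1/2) ^ Suc n < s n" using e by simp
      ultimately have "\<forall>\<^sub>F K in sequentially. s n - e / 2 * (1/2) ^ Suc n < (\<Sum>k<K. L (d n k))"
        by (rule order_tendstoD(1))
      then obtain K where "s n - e / 2 * (1/2) ^ Suc n < (\<Sum>k<K. L (d n k))"
        using eventually_happens by (metis sequentially_bot)
      thus ?thesis unfolding Ldsum by (intro exI[of _ K]) linarith
    qed
    then obtain K where K: "\<And>n. s n - L (\<lambda>x. f n x * w (K n) x) \<le> e / 2 * (1/2) ^ Suc n" by metis
    define g where "g n x = f n x * (1 - w (K n) x)" for n x
    have g: "continuous_on X (g n)" "x \<in> X \<Longrightarrow> 0 \<le> g n x" for n x
      unfolding g_def using D(2)[of x n] w(3)[of "K n" x] by (auto intro!: continuous_intros D w)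
    have Lg: "L (g n) = L (f n) - L (\<lambda>x. f n x * w (K n) x)" for n
      using L_diff[OF D(1) fw, of n n "K n"] unfolding g_def by (simp add: right_diff_distrib)
    have "g \<in> covers ((UNIV - l) \<inter> A)"
    proof -
      have "g n x = f n x" if "x \<in> (UNIV - l) \<inter> X" for n x
      proof -
        have "h x = 0" using that h(2)[of x] by (auto simp: l_def)
        thus ?thesis by (simp add: g_def w_def)
      qed
      thus ?thesis unfolding covers_def using g D(4) by simp
    qed
    hence two: "outer ((UNIV - l) \<inter> A) \<le> (\<Sum>n. ennreal (L (g n)))" by (rule outer_le)
    have "outer (l \<inter> A) + outer ((UNIV - l) \<inter> A) \<le> (\<Sum>n. ennreal (s n)) + (\<Sum>n. ennreal (L (g n)))"
      using one two by (rule add_mono)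
    also have "\<dots> = (\<Sum>n. ennreal (s n) + ennreal (L (g n)))"
      by (rule suminf_add) auto
    also have "\<dots> \<le> (\<Sum>n. ennreal (L (f n)) + ennreal (e/2 * (1/2) ^ Suc n))"
    proof (rule suminf_le)
      fix n
      have "ennreal (s n) + ennreal (L (g n)) = ennreal (s n + L (g n))"
        using s0 g by (subst ennreal_plus) (auto intro!: L_nonneg)
      also have "\<dots> \<le> ennreal (L (f n) + e/2 * (1/2) ^ Suc n)"
        using K[of n] Lg[of n] by (intro ennreal_leI) linarith
      also have "\<dots> = ennreal (L (f n)) + ennreal (e/2 * (1/2) ^ Suc n)"
        using D(3)[of n] e by (subst ennreal_plus) auto
      finally show "ennreal (s n) + ennreal (L (g n)) \<le> ennreal (L (f n)) + ennreal (e/2 * (1/2) ^ Suc n)" .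
    qed auto
    also have "\<dots> = (\<Sum>n. ennreal (L (f n))) + (\<Sum>n. ennreal (e/2 * (1/2) ^ Suc n))"
      by (subst suminf_add) auto
    also have "(\<Sum>n. ennreal (e/2 * (1/2) ^ Suc n)) = ennreal (e/2)"
      using e2 by (rule ennreal_sum_halves)
    also have "(\<Sum>n. ennreal (L (f n))) + ennreal (e/2) \<le> outer A + ennreal (e/2) + ennreal (e/2)"
      using f(2) by (rule add_right_mono)
    also have "\<dots> = outer A + ennreal e"
      using e by (simp add: add.assoc ennreal_plus[symmetric] del: ennreal_plus)
    finally show "outer (l \<inter> A) + outer ((UNIV - l) \<inter> A) \<le> outer A + ennreal e" .
  qed
qed

text \<open>
The outer measure lives on the whole type and gives no mass to the complement of \<open>X\<close>, so
restricting it to \<open>X\<close> loses nothing.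
\<close>

definition riesz_measure :: "'a measure" where
  "riesz_measure = restrict_space (measure_of UNIV (sets borel) outer) X"

lemma emeasure_outer: 
  assumes "A \<in> sets borel"
  shows "emeasure (measure_of UNIV (sets borel) outer) A = outer A"
proof -
  let ?S = "lambda_system UNIV (Pow UNIV) outer"
  have "outer_measure_space (Pow UNIV) outer"
    unfolding outer_measure_space_def positive_def increasing_def countably_subadditive_def
    using outer_empty outer_mono outer_countably_subadditive by auto
  hence ms: "measure_space UNIV ?S outer"
    using sigma_algebra.caratheodory_lemma[OF sigma_algebra_Pow] by blast
  have op: "V \<in> ?S" if "open V" for V :: "'a set"
  proof (cases "V = UNIV")
    case True
    thus ?thesis using ms by (simp add: lambda_system_def outer_empty)
  next
    case False
    have V: "V = {x. 0 < infdist x (- V)}"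
      using that False infdist_pos_not_in_closed[of "- V"] by (auto simp: closed_Compl) (metis ComplI infdist_zero order_less_irrefl)
    have "outer (V \<inter> A) + outer ((UNIV - V) \<inter> A) = outer A" for A
      using outer_split_cozero[OF continuous_on_infdist[OF continuous_on_id] infdist_nonneg, of "- V" A,
          folded V] .
    thus ?thesis by (simp add: lambda_system_def)
  qed
  have "sigma_algebra UNIV ?S" using ms by (simp add: measure_space_def)
  hence "sigma_sets UNIV {V. open V} \<subseteq> ?S"
    using op by (intro sigma_algebra.sigma_sets_subset) auto
  moreover have "sets (borel :: 'a measure) = sigma_sets UNIV {V. open V}" by (simp add: borel_def)
  ultimately have sub: "sets borel \<subseteq> ?S" by (simp only:)
  have "measure_space UNIV (sets borel) outer"
    unfolding measure_space_def
  proof (intro conjI)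
    show "sigma_algebra UNIV (sets (borel :: 'a measure))"
      using sets.sigma_algebra_axioms[of "borel :: 'a measure"] by simp
    show "positive (sets borel) outer" by (simp add: positive_def outer_empty)
    show "countably_additive (sets borel) outer"
      unfolding countably_additive_def
    proof (intro allI impI)
      fix A :: "nat \<Rightarrow> 'a set"
      assume A: "range A \<subseteq> sets borel" "disjoint_family A" "\<Union> (range A) \<in> sets borel"
      have "countably_additive ?S outer" using ms by (simp add: measure_space_def)
      moreover have "range A \<subseteq> ?S" "\<Union> (range A) \<in> ?S" using A sub by blast+
      ultimately show "(\<Sum>i. outer (A i)) = outer (\<Union> (range A))"
        using A(2) unfolding countably_additive_def by blast
    qed
  qed
  thus ?thesis
    using assms by (intro emeasure_measure_of_sigma) (auto simp: measure_space_def)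
qed

lemma sets_riesz: "sets riesz_measure = sets (restrict_space borel X)"
proof -
  have "sets (measure_of UNIV (sets (borel :: 'a measure)) outer) = sets borel"
    using sets.sigma_sets_eq[of "borel :: 'a measure"] by (simp add: sets_measure_of_conv)
  thus ?thesis unfolding riesz_measure_def by (rule sets_restrict_space_cong)
qed

lemma X_borel: "X \<in> sets borel"
  using compact by (intro borel_closed compact_imp_closed)

lemma emeasure_riesz:
  assumes "A \<in> sets borel" "A \<subseteq> X"
  shows "emeasure riesz_measure A = outer A"
proof -
  have "sets (measure_of UNIV (sets (borel :: 'a measure)) outer) = sets borel"
    using sets.sigma_sets_eq[of "borel :: 'a measure"] by (simp add: sets_measure_of_conv)
  thus ?thesis unfolding riesz_measure_def using assms X_borel
    by (subst emeasure_restrict_space) (auto simp: emeasure_outer space_measure_of_conv)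
qed

lemma outer_Int_X: "outer (A \<inter> X) = outer A"
proof -
  have "covers (A \<inter> X) = covers A" unfolding covers_def by auto
  thus ?thesis by (simp add: outer_def)
qed

lemma space_riesz: "space riesz_measure = X"
  using sets_eq_imp_space_eq[OF sets_riesz] by (simp add: space_restrict_space)

lemma prob_space_riesz: "prob_space riesz_measure"
  by (rule prob_spaceI) (use emeasure_riesz[OF X_borel] outer_Int_X[of UNIV] outer_UNIV in \<open>simp add: space_riesz\<close>)

lemma continuous_measurable: "continuous_on X f \<Longrightarrow> f \<in> borel_measurable riesz_measure"
  for f :: "'a \<Rightarrow> real"
  using borel_measurable_continuous_on_restrict[of X f] 
  by (simp add: measurable_cong_sets[OF sets_riesz refl])

lemma continuous_integrable: 
  assumes "continuous_on X f"
  shows "integrable riesz_measure (f :: 'a \<Rightarrow> real)"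
proof -
  interpret prob_space riesz_measure by (rule prob_space_riesz)
  have "bounded (f ` X)" using compact assms by (intro compact_imp_bounded compact_continuous_image)
  then obtain B where "\<And>x. x \<in> X \<Longrightarrow> norm (f x) \<le> B" unfolding bounded_iff by blast
  thus ?thesis using continuous_measurable[OF assms]
    by (intro integrable_const_bound[of _ B]) (auto simp: space_riesz)
qed

text \<open>
Layer cake: \<open>f\<close> is the sum of the \<open>n\<close> slices \<open>g k\<close> of height \<open>1/n\<close>, and \<open>n * g k\<close> lies below the
indicator of \<open>{x. c k < f x}\<close>.
\<close>

lemma L_le_integral:
  assumes f: "continuous_on X f" and f01: "\<And>x. x \<in> X \<Longrightarrow> 0 \<le> f x \<and> f x \<le> 1"
  shows "L f \<le> (\<integral>x. f x \<partial>riesz_measure)"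
proof (rule field_le_epsilon)
  interpret prob_space riesz_measure by (rule prob_space_riesz)
  fix e :: real assume "e > 0"
  then obtain n :: nat where n: "n > 0" "1 / real n < e"
    using nat_approx_posE by (metis of_nat_0_less_iff of_nat_Suc zero_less_Suc)
  define c where "c k = real k / real n" for k
  define g where "g k x = max 0 (min (1 / real n) (f x - c k))" for k x
  define A where "A k = {x\<in>X. c k < f x}" for k
  have g: "continuous_on X (g k)" for k unfolding g_def by (intro continuous_intros f)
  have c_Suc: "c (Suc k) = c k + 1 / n" for k by (simp add: c_def add_divide_distrib)
  have gsum: "(\<Sum>k<m. g k x) = min (c m) (f x)" if "x \<in> X" for m x
  proof (induction m)
    case (Suc m)
    have "1 / real n > 0" using n by simp
    thus ?case using Suc unfolding sum.lessThan_Suc g_def c_Suc by linarith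
  qed (use f01[OF that] in \<open>simp add: c_def\<close>)
  have cn: "c n = 1" using n by (simp add: c_def)
  have Asets: "A k \<in> sets riesz_measure" for k
    using borel_measurable_less[OF borel_measurable_const continuous_measurable[OF f], of "c k"]
    by (simp add: A_def space_riesz)
  have Aborel: "A k \<in> sets borel" for k
    using Asets[of k] X_borel unfolding sets_riesz by (auto simp: sets_restrict_space)
  have Lg: "L (g k) \<le> (1 / n) * prob (A k)" for k
  proof -
    have "ennreal (L (\<lambda>x. real n * g k x)) \<le> outer (A k)"
    proof (rule L_le_outer)
      show "real n * g k x \<le> 1" for x
        using n by (auto simp: g_def field_simps min_def max_def)
      show "real n * g k x \<le> 0" if "x \<in> X" "x \<notin> A k" for x
        using that n by (auto simp: g_def A_def mult_le_0_iff)
    qed (intro continuous_intros g)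
    also have "\<dots> = ennreal (prob (A k))"
      using emeasure_riesz[OF Aborel] by (simp add: A_def emeasure_eq_measure)
    finally have "L (\<lambda>x. real n * g k x) \<le> prob (A k)" by (simp add: ennreal_le_iff)
    thus ?thesis using n by (simp add: L_cmult[OF g] field_simps)
  qed
  have ind: "(\<Sum>k<m. (1 / n) * indicator (A k) x) \<le> min (c m) (f x + 1 / n)" if "x \<in> X" for m x
  proof (induction m)
    case (Suc m)
    have "1 / real n > 0" using n by simp
    thus ?case using Suc \<open>x \<in> X\<close> unfolding sum.lessThan_Suc c_Suc A_def indicator_def 
      by (cases "c m < f x") (simp_all add: min_def split: if_splits)
  qed (use f01[OF that] in \<open>simp add: c_def\<close>)
  have "L f = L (\<lambda>x. \<Sum>k<n. g k x)"
    using gsum cn f01 by (intro antisym L_mono f continuous_intros g) (auto simp: min_def)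
  also have "\<dots> = (\<Sum>k<n. L (g k))" by (rule L_sum) (auto intro: g)
  also have "\<dots> \<le> (\<Sum>k<n. (1 / n) * prob (A k))" by (intro sum_mono Lg)
  also have "\<dots> = (\<Sum>k<n. \<integral>x. (1 / n) * indicator (A k) x \<partial>riesz_measure)"
    using Asets by (intro sum.cong refl) (simp add: measure_def)
  also have "\<dots> = (\<integral>x. (\<Sum>k<n. (1 / n) * indicator (A k) x) \<partial>riesz_measure)"
    using Asets by (intro Bochner_Integration.integral_sum[symmetric]) (auto simp: emeasure_eq_measure)
  also have "\<dots> \<le> (\<integral>x. f x + 1 / n \<partial>riesz_measure)"
  proof (intro integral_mono Bochner_Integration.integrable_sum)
    show "(\<Sum>k<n. (1 / n) * indicator (A k) x) \<le> f x + 1 / n" if "x \<in> space riesz_measure" for x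
      using ind[of x n] that by (simp add: space_riesz)
  qed (use Asets in \<open>auto simp: emeasure_eq_measure intro!: continuous_integrable[OF f]\<close>)
  also have "\<dots> = (\<integral>x. f x \<partial>riesz_measure) + 1 / n"
    using continuous_integrable[OF f] by (simp add: prob_space)
  finally show "L f \<le> (\<integral>x. f x \<partial>riesz_measure) + e" using n by linarith
qed

text \<open>
The inequality above, applied to \<open>f\<close> and to \<open>1 - f\<close>, is an equality when \<open>f\<close> takes values in the unit
interval; an affine change of \<open>f\<close> reduces the general case to this one.
\<close>

theorem L_eq_integral:
  assumes f: "continuous_on X f"
  shows "L f = (\<integral>x. f x \<partial>riesz_measure)"
proof -
  interpret prob_space riesz_measure by (rule prob_space_riesz)
  have unit: "L g = (\<integral>x. g x \<partial>riesz_measure)" 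
    if g: "continuous_on X g" "\<And>x. x \<in> X \<Longrightarrow> 0 \<le> g x \<and> g x \<le> 1" for g
  proof (rule antisym)
    show "L g \<le> (\<integral>x. g x \<partial>riesz_measure)" using g by (rule L_le_integral)
    have "L (\<lambda>x. 1 - g x) \<le> (\<integral>x. 1 - g x \<partial>riesz_measure)"
      using g by (intro L_le_integral continuous_intros) auto
    thus "(\<integral>x. g x \<partial>riesz_measure) \<le> L g"
      using L_diff[OF continuous_on_const g(1), of 1] continuous_integrable[OF g(1)] 
      by (simp add: L_one prob_space)
  qed
  have "bounded (f ` X)" using compact f by (intro compact_imp_bounded compact_continuous_image)
  then obtain B where B: "B > 0" "\<And>x. x \<in> X \<Longrightarrow> \<bar>f x\<bar> \<le> B" unfolding bounded_pos by auto
  define g where "g x = 1 / 2 + (1 / (2 * B)) * f x" for x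
  have "L g = (\<integral>x. g x \<partial>riesz_measure)"
  proof (rule unit)
    fix x assume "x \<in> X"
    hence "\<bar>(1 / (2 * B)) * f x\<bar> \<le> 1 / 2" using B by (simp add: abs_mult field_simps)
    thus "0 \<le> g x \<and> g x \<le> 1" unfolding g_def by linarith
  qed (unfold g_def, intro continuous_intros f)
  moreover have "L g = 1 / 2 + (1 / (2 * B)) * L f"
    unfolding g_def using L_add[OF continuous_on_const, of "\<lambda>x. (1 / (2 * B)) * f x" "1 / 2"]
      L_cmult[OF f, of "1 / (2 * B)"] f by (simp only: L_const continuous_on_mult continuous_on_const)
  moreover have "(\<integral>x. g x \<partial>riesz_measure) = 1 / 2 + (1 / (2 * B)) * (\<integral>x. f x \<partial>riesz_measure)"
    unfolding g_def using continuous_integrable[OF f] by (simp add: prob_space)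
  ultimately show ?thesis using B by (simp add: field_simps)
qed

end

text \<open>
The indicator of an open set \<open>V\<close> is the limit of the continuous functions
\<open>min 1 (k * infdist x (-V))\<close>. For \<open>V = UNIV\<close> this formula fails, since \<open>infdist x {} = 0\<close>, and that
case is treated apart.
\<close>

lemma measure_eqI_continuous:
  fixes X :: "'a::metric_space set"
  assumes X: "X \<in> sets borel"
    and \<mu>: "prob_space \<mu>" "sets \<mu> = sets (restrict_space borel X)"
    and \<nu>: "prob_space \<nu>" "sets \<nu> = sets (restrict_space borel X)"
    and eq: "\<And>g :: 'a \<Rightarrow> real. continuous_on X g \<Longrightarrow> (\<integral>x. g x \<partial>\<mu>) = (\<integral>x. g x \<partial>\<nu>)"
  shows "\<mu> = \<nu>"
proof -
  interpret \<mu>: prob_space \<mu> by fact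
  interpret \<nu>: prob_space \<nu> by fact
  define E where "E = (\<inter>) X ` {V. open V}"
  have sets: "sets (restrict_space borel X) = sigma_sets X E"
    unfolding E_def sets_restrict_space borel_def
    using X by (subst sigma_sets_Int[symmetric]) (auto simp: borel_def)
  have meas: "f \<in> borel_measurable M" if "continuous_on X f" "sets M = sets (restrict_space borel X)"
    for f :: "'a \<Rightarrow> real" and M
    using borel_measurable_continuous_on_restrict[OF that(1)]
    unfolding measurable_cong_sets[OF that(2) refl] .
  have space: "space M = X" if "sets M = sets (restrict_space borel X)" for M
    using sets_eq_imp_space_eq[OF that] by (simp add: space_restrict_space)
  have lim: "(\<lambda>k. \<integral>x. min 1 (real k * infdist x (- V)) \<partial>M) \<longlonglongrightarrow> measure M (X \<inter> V)"
    if "prob_space M" "sets M = sets (restrict_space borel X)" "open V" "V \<noteq> UNIV" for M V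
  proof -
    interpret prob_space M by fact
    have XV: "X \<inter> V \<in> sets M"
      using that(2,3) by (auto simp: sets_restrict_space)
    have b: "norm (min 1 (real k * infdist x (- V))) \<le> 1" for k x
    proof -
      have "0 \<le> real k * infdist x (- V)" by (simp add: infdist_nonneg)
      thus ?thesis by (simp add: min_def)
    qed
    have "(\<lambda>k. \<integral>x. min 1 (real k * infdist x (- V)) \<partial>M) \<longlonglongrightarrow> (\<integral>x. indicator (X \<inter> V) x \<partial>M)"
    proof (rule integral_dominated_convergence[where w = "\<lambda>_. 1"])
      show "AE x in M. (\<lambda>k. min 1 (real k * infdist x (- V))) \<longlonglongrightarrow> indicator (X \<inter> V) x"
      proof (rule AE_I2)
        fix x assume "x \<in> space M"
        hence x: "x \<in> X" using space[OF that(2)] by simp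
        show "(\<lambda>k. min 1 (real k * infdist x (- V))) \<longlonglongrightarrow> indicator (X \<inter> V) x"
        proof (cases "x \<in> V")
          case False
          thus ?thesis using x by simp
        next
          case True
          hence pos: "infdist x (- V) > 0"
            using that(3,4) infdist_pos_not_in_closed[of "- V" x] by (simp add: closed_Compl) blast
          have "\<forall>\<^sub>F k in sequentially. real k \<ge> 1 / infdist x (- V)"
            by (meson eventually_sequentiallyI nat_ceiling_le_eq)
          hence "\<forall>\<^sub>F k in sequentially. min 1 (real k * infdist x (- V)) = indicator (X \<inter> V) x"
            by eventually_elim (use pos x True in \<open>simp add: field_simps\<close>)
          thus ?thesis by (rule tendsto_eventually)
        qed
      qed
    qed (use XV b in \<open>auto intro!: meas[OF _ that(2)] continuous_intros AE_I2\<close>)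
    thus ?thesis using XV by simp
  qed
  show ?thesis
  proof (rule measure_eqI_generator_eq[of E X _ _ "\<lambda>_. X"])
    show "Int_stable E" unfolding E_def Int_stable_def
    proof (intro ballI)
      fix a b assume "a \<in> (\<inter>) X ` {V. open V}" "b \<in> (\<inter>) X ` {V. open V}"
      then obtain U V where "open U" "open V" "a = X \<inter> U" "b = X \<inter> V" by blast
      thus "a \<inter> b \<in> (\<inter>) X ` {V. open V}" by (intro image_eqI[of _ _ "U \<inter> V"]) auto
    qed
    show "E \<subseteq> Pow X" by (auto simp: E_def)
    show "sets \<mu> = sigma_sets X E" "sets \<nu> = sigma_sets X E" using \<mu> \<nu> sets by auto
    show "range (\<lambda>_. X) \<subseteq> E" by (auto simp: E_def intro!: image_eqI[of _ _ UNIV])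
    show "emeasure \<mu> Y = emeasure \<nu> Y" if Y: "Y \<in> E" for Y
    proof -
      obtain V where V: "open V" "Y = X \<inter> V" using Y unfolding E_def by blast
      show ?thesis
      proof (cases "V = UNIV")
        case True
        thus ?thesis using V \<mu>.emeasure_space_1 \<nu>.emeasure_space_1 space \<mu>(2) \<nu>(2) by simp
      next
        case False
        have "continuous_on X (\<lambda>x. min 1 (real k * infdist x (- V)))" for k
          by (intro continuous_intros)
        hence "measure \<mu> Y = measure \<nu> Y"
          using lim[OF \<mu> V(1) False] lim[OF \<nu> V(1) False] eq V(2) LIMSEQ_unique by simp
        thus ?thesis by (simp add: \<mu>.emeasure_eq_measure \<nu>.emeasure_eq_measure)
      qed
    qed
  qed auto
qed

text \<open>
If uniformity failed, choose for each \<open>M\<close> a point \<open>y M\<close> whose average of length \<open>M\<close> is off by more than \<open>e\<close>.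
The limit of the averages starting at \<open>y M\<close> along an ultrafilter is an invariant mean that
disagrees with \<open>\<mu>\<close> on \<open>f\<close>.
\<close>

theorem uniform_ergodic_averages:
  fixes f :: "'a::metric_space \<Rightarrow> real"
  assumes sys: "uniquely_ergodic_system X \<mu> T" and f: "continuous_on X f" and e: "0 < e"
  obtains M :: nat where "M > 0"
    "\<And>y. y \<in> X \<Longrightarrow> \<bar>(\<Sum>m<M. f ((T ^^ m) y)) / real M - (\<integral>x. f x \<partial>\<mu>)\<bar> \<le> e"
proof (rule ccontr)
  assume notthesis: "\<not> thesis"
  have X: "compact X" and TX: "T ` X \<subseteq> X" and T: "continuous_on X T"
    and uniq: "\<And>\<nu>. invariant_prob_measure X T \<nu> \<Longrightarrow> \<nu> = \<mu>"
    using sys unfolding uniquely_ergodic_system_def by auto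
  have "\<forall>M>0. \<exists>y\<in>X. \<bar>(\<Sum>m<M. f ((T ^^ m) y)) / real M - (\<integral>x. f x \<partial>\<mu>)\<bar> > e"
    using notthesis that by (meson not_le)
  then obtain y where y: "\<And>M. M > 0 \<Longrightarrow> y M \<in> X"
    "\<And>M. M > 0 \<Longrightarrow> \<bar>(\<Sum>m<M. f ((T ^^ m) (y M))) / real M - (\<integral>x. f x \<partial>\<mu>)\<bar> > e"
    by metis
  have orbit: "(T ^^ m) (y M) \<in> X" if "M > 0" for m M
    using y(1)[OF that] TX by (induction m) auto
  have pos_ev: "\<forall>\<^sub>F M::nat in sequentially. M > 0" by (rule eventually_gt_at_top)
  define A where "A g M = (\<Sum>m<M. g ((T ^^ m) (y M))) / real M" for g :: "'a \<Rightarrow> real" and M :: nat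
  obtain G where G: "G \<le> sequentially" "G \<noteq> bot"
    "\<And>h :: nat \<Rightarrow> real. (\<exists>B. \<forall>\<^sub>F x in sequentially. \<bar>h x\<bar> \<le> B) \<Longrightarrow> \<exists>l. (h \<longlongrightarrow> l) G"
    using ultrafilter_refinement[of sequentially] by auto
  have bnd: "\<exists>B. \<forall>x\<in>X. \<bar>g x\<bar> \<le> B" if "continuous_on X g" for g :: "'a \<Rightarrow> real"
    using compact_imp_bounded[OF compact_continuous_image[OF that X]] unfolding bounded_iff by auto
  define L where "L g = Lim G (A g)" for g
  have L: "(A g \<longlongrightarrow> L g) G" if g: "continuous_on X g" for g
  proof -
    obtain B where B: "\<And>x. x \<in> X \<Longrightarrow> \<bar>g x\<bar> \<le> B" using bnd[OF g] by blast
    have "\<forall>\<^sub>F M in sequentially. \<bar>A g M\<bar> \<le> B"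
      using pos_ev
    proof eventually_elim
      case (elim M)
      have "\<bar>\<Sum>m<M. g ((T ^^ m) (y M))\<bar> \<le> (\<Sum>m<M. \<bar>g ((T ^^ m) (y M))\<bar>)" by (rule sum_abs)
      also have "\<dots> \<le> (\<Sum>m<M. B)" by (intro sum_mono B orbit elim)
      finally show ?case using elim by (simp add: A_def field_simps)
    qed
    then obtain l where l: "(A g \<longlongrightarrow> l) G" using G(3)[of "A g"] by blast
    thus ?thesis unfolding L_def using tendsto_Lim[OF G(2) l] by simp
  qed
  have Leq: "L g = l" if "continuous_on X g" "(A g \<longlongrightarrow> l) G" for g l
    using L[OF that(1)] that(2) tendsto_unique[OF G(2)] by blast
  interpret mean_functional X L
  proof
    show "L (\<lambda>x. g x + h x) = L g + L h" if "continuous_on X g" "continuous_on X h" for g h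
    proof (rule Leq)
      have "A (\<lambda>x. g x + h x) = (\<lambda>M. A g M + A h M)"
        by (auto simp: A_def sum.distrib add_divide_distrib)
      thus "(A (\<lambda>x. g x + h x) \<longlongrightarrow> L g + L h) G"
        using tendsto_add[OF L[OF that(1)] L[OF that(2)]] by simp
    qed (intro continuous_intros that)
    show "L (\<lambda>x. c * g x) = c * L g" if "continuous_on X g" for c g
    proof (rule Leq)
      have "A (\<lambda>x. c * g x) = (\<lambda>M. c * A g M)"
        by (auto simp: A_def sum_distrib_left)
      thus "(A (\<lambda>x. c * g x) \<longlongrightarrow> c * L g) G"
        using tendsto_mult_left[OF L[OF that]] by simp
    qed (intro continuous_intros that)
    show "0 \<le> L g" if "continuous_on X g" "\<And>x. x \<in> X \<Longrightarrow> 0 \<le> g x" for g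
    proof (rule tendsto_lowerbound[OF L[OF that(1)] _ G(2)])
      have "\<forall>\<^sub>F M in sequentially. 0 \<le> A g M" using pos_ev
        by eventually_elim (auto simp: A_def intro!: divide_nonneg_nonneg sum_nonneg that orbit)
      thus "\<forall>\<^sub>F M in G. 0 \<le> A g M" using G(1) by (rule filter_leD[rotated])
    qed
    show "L (\<lambda>x. 1) = 1"
    proof (rule Leq)
      have "\<forall>\<^sub>F M in sequentially. A (\<lambda>x. 1) M = 1" using pos_ev
        by eventually_elim (simp add: A_def)
      hence "\<forall>\<^sub>F M in G. A (\<lambda>x. 1) M = 1" using G(1) by (rule filter_leD[rotated])
      thus "(A (\<lambda>x. 1) \<longlongrightarrow> 1) G" by (rule tendsto_eventually)
    qed simp
  qed (rule X)
  have L_inv: "L (\<lambda>x. g (T x)) = L g" if g: "continuous_on X g" for g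
  proof (rule Leq)
    show cont: "continuous_on X (\<lambda>x. g (T x))"
      by (rule continuous_on_compose2[OF g T TX])
    obtain B where B: "\<And>x. x \<in> X \<Longrightarrow> \<bar>g x\<bar> \<le> B" using bnd[OF g] by blast
    have "\<forall>\<^sub>F M in sequentially. norm (A (\<lambda>x. g (T x)) M - A g M) \<le> (2 * B) / real M"
      using pos_ev
    proof eventually_elim
      case (elim M)
      have "(\<Sum>m<M. g (T ((T ^^ m) (y M)))) - (\<Sum>m<M. g ((T ^^ m) (y M))) = g ((T ^^ M) (y M)) - g (y M)"
        using sum_lessThan_telescope[of "\<lambda>m. g ((T ^^ m) (y M))" M] by (simp add: sum_subtractf)
      moreover have "\<bar>g ((T ^^ M) (y M)) - g (y M)\<bar> \<le> 2 * B"
        using B[OF orbit[OF elim, of M]] B[OF y(1)[OF elim]] by linarith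
      ultimately show ?case unfolding A_def diff_divide_distrib[symmetric]
        by (simp add: divide_right_mono)
    qed
    moreover have "(\<lambda>M. (2 * B) / real M) \<longlonglongrightarrow> 0"
      using tendsto_divide_0[OF tendsto_const filterlim_at_top_imp_at_infinity[OF filterlim_real_sequentially]] .
    ultimately have "(\<lambda>M. A (\<lambda>x. g (T x)) M - A g M) \<longlonglongrightarrow> 0"
      by (rule Lim_null_comparison)
    hence "((\<lambda>M. A (\<lambda>x. g (T x)) M - A g M) \<longlongrightarrow> 0) G" using G(1) by (rule tendsto_mono[rotated])
    from tendsto_add[OF this L[OF g]] show "(A (\<lambda>x. g (T x)) \<longlongrightarrow> L g) G" by simp
  qed
  interpret prob_space riesz_measure by (rule prob_space_riesz)
  have Tmeas: "T \<in> measurable riesz_measure riesz_measure"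
  proof -
    have "T \<in> measurable (restrict_space borel X) (restrict_space borel X)"
      using borel_measurable_continuous_on_restrict[OF T] TX
      by (intro measurable_restrict_space2) (auto simp: space_restrict_space)
    thus ?thesis using measurable_cong_sets[OF sets_riesz sets_riesz] by simp
  qed
  have "distr riesz_measure riesz_measure T = riesz_measure"
  proof (rule measure_eqI_continuous[OF X_borel])
    show "prob_space (distr riesz_measure riesz_measure T)" by (rule prob_space_distr[OF Tmeas])
    show "prob_space riesz_measure" by (rule prob_space_riesz)
    fix g :: "'a \<Rightarrow> real" assume g: "continuous_on X g"
    have "(\<integral>x. g x \<partial>distr riesz_measure riesz_measure T) = (\<integral>x. g (T x) \<partial>riesz_measure)"
      by (rule integral_distr[OF Tmeas continuous_measurable[OF g]])
    also have "\<dots> = (\<integral>x. g x \<partial>riesz_measure)"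
      using L_inv[OF g] L_eq_integral[OF g] L_eq_integral[OF continuous_on_compose2[OF g T TX]] by simp
    finally show "(\<integral>x. g x \<partial>distr riesz_measure riesz_measure T) = (\<integral>x. g x \<partial>riesz_measure)" .
  qed (auto simp: sets_riesz)
  hence "riesz_measure = \<mu>"
    by (intro uniq) (simp add: invariant_prob_measure_def prob_space_riesz sets_riesz)
  hence "L f = (\<integral>x. f x \<partial>\<mu>)" using L_eq_integral[OF f] by simp
  hence "((\<lambda>M. \<bar>A f M - (\<integral>x. f x \<partial>\<mu>)\<bar>) \<longlongrightarrow> 0) G"
    using tendsto_rabs[OF tendsto_diff[OF L[OF f] tendsto_const[of "\<integral>x. f x \<partial>\<mu>"]]] by simp
  hence "\<forall>\<^sub>F M in G. \<bar>A f M - (\<integral>x. f x \<partial>\<mu>)\<bar> < e" using e by (rule order_tendstoD(2))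
  moreover have "\<forall>\<^sub>F M in G. M > 0" using pos_ev G(1) by (rule filter_leD[rotated])
  ultimately have "\<forall>\<^sub>F M in G. False"
  proof eventually_elim
    case (elim M)
    thus ?case using y(2)[of M] by (simp add: A_def)
  qed
  thus False using G(2) by (simp add: trivial_limit_def)
qed

section \<open>Prime elements of the nine imaginary quadratic rings\<close>

text \<open>
The ring of integers is \<open>\<int>[\<lambda>]\<close> with \<open>\<lambda>\<close> a root of \<open>x^2 - t x + m\<close>: \<open>t = 0, m = -d\<close> if \<open>d\<close> is not 1
modulo 4, and \<open>t = 1, m = (1 - d) / 4\<close> otherwise. The listed pairs are those of the nine fields.
\<close>

locale heegner_order =
  fixes t m :: int
  assumes tm: "(t, m) \<in> {(0,1), (0,2), (1,1), (1,2), (1,3), (1,5), (1,11), (1,17), (1,41)}"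
begin

lemma t_cases: "t = 0 \<or> t = 1" and m_pos: "m \<ge> 1" and disc_pos: "4 * m - t\<^sup>2 > 0"
  using tm by auto

definition lam :: complex where
  "lam = Complex (of_int t / 2) (sqrt (of_int (4 * m - t\<^sup>2)) / 2)"

text \<open>
Ring elements are complex numbers throughout, because the argument mixes divisibility with size and
angle.
\<close>

definition el :: "int \<Rightarrow> int \<Rightarrow> complex" where
  "el a b = of_int a + of_int b * lam"

definition OK :: "complex set" where
  "OK = {el a b | a b. True}"

definition q :: "int \<Rightarrow> int \<Rightarrow> int" where
  "q a b = a\<^sup>2 + t * a * b + m * b\<^sup>2"

definition nrm :: "complex \<Rightarrow> nat" where
  "nrm z = nat \<lfloor>(cmod z)\<^sup>2\<rfloor>"

definition dv :: "complex \<Rightarrow> complex \<Rightarrow> bool" where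
  "dv \<alpha> \<beta> \<longleftrightarrow> (\<exists>\<gamma>\<in>OK. \<beta> = \<alpha> * \<gamma>)"

lemma Re_el: "Re (el a b) = of_int a + of_int b * of_int t / 2"
  and Im_el: "Im (el a b) = of_int b * (sqrt (of_int (4 * m - t\<^sup>2)) / 2)"
  by (simp_all add: el_def lam_def)

lemma sqrt_disc: "sqrt (of_int (4 * m - t\<^sup>2)) > 0"
  using disc_pos by (simp only: real_sqrt_gt_0_iff of_int_0_less_iff)

lemma el_inj: "el a b = el c d \<longleftrightarrow> a = c \<and> b = d"
  using sqrt_disc by (auto simp: complex_eq_iff Re_el Im_el)

lemma cmod_el: "(cmod (el a b))\<^sup>2 = of_int (q a b)"
proof -
  have s: "(sqrt (of_int (4 * m - t\<^sup>2)))\<^sup>2 = real_of_int (4 * m - t\<^sup>2)"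
    using disc_pos by (intro real_sqrt_pow2) linarith
  have "(cmod (el a b))\<^sup>2 = (of_int a + of_int b * of_int t / 2)\<^sup>2 + (of_int b)\<^sup>2 * real_of_int (4 * m - t\<^sup>2) / 4"
    unfolding cmod_power2 Re_el Im_el power_mult_distrib power_divide s by simp
  also have "\<dots> = of_int (q a b)"
    by (simp add: q_def power2_eq_square field_simps)
  finally show ?thesis .
qed

lemma lam_square: "lam * lam = of_int t * lam - of_int m"
proof -
  have s: "sqrt (of_int (4 * m - t\<^sup>2)) * sqrt (of_int (4 * m - t\<^sup>2)) = real_of_int (4 * m - t\<^sup>2)"
    using disc_pos by (intro real_sqrt_mult_self[THEN trans]) linarith
  show ?thesis
    unfolding complex_eq_iff times_complex.simps lam_def complex.sel minus_complex.simps
    using s by (auto simp: field_simps power2_eq_square)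
qed

lemma cnj_lam: "cnj lam = of_int t - lam"
  by (simp add: complex_eq_iff lam_def)

lemma el_add: "el a b + el c d = el (a + c) (b + d)"
  and el_diff: "el a b - el c d = el (a - c) (b - d)"
  and el_cnj: "cnj (el a b) = el (a + t * b) (- b)"
  by (simp_all add: el_def algebra_simps cnj_lam)

lemma el_mult: "el a b * el c d = el (a * c - m * b * d) (a * d + b * c + t * b * d)"
proof -
  have "el a b * el c d = of_int (a * c) + of_int (a * d + b * c) * lam + of_int (b * d) * (lam * lam)"
    by (simp add: el_def algebra_simps)
  thus ?thesis unfolding lam_square by (simp add: el_def algebra_simps)
qed

lemma of_int_eq_el: "of_int a = el a 0"
  by (simp add: el_def)

lemma OK_el [simp]: "el a b \<in> OK"
  by (auto simp: OK_def)

lemma OK_cases: "\<alpha> \<in> OK \<Longrightarrow> (\<And>a b. \<alpha> = el a b \<Longrightarrow> P) \<Longrightarrow> P"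
  by (auto simp: OK_def)

lemma OK_add [intro]: "\<alpha> \<in> OK \<Longrightarrow> \<beta> \<in> OK \<Longrightarrow> \<alpha> + \<beta> \<in> OK"
  and OK_diff [intro]: "\<alpha> \<in> OK \<Longrightarrow> \<beta> \<in> OK \<Longrightarrow> \<alpha> - \<beta> \<in> OK"
  and OK_mult [intro]: "\<alpha> \<in> OK \<Longrightarrow> \<beta> \<in> OK \<Longrightarrow> \<alpha> * \<beta> \<in> OK"
  and OK_cnj [intro]: "\<alpha> \<in> OK \<Longrightarrow> cnj \<alpha> \<in> OK"
  by (auto elim!: OK_cases simp: el_add el_diff el_mult el_cnj)

lemma OK_of_int [simp]: "of_int a \<in> OK" by (simp add: of_int_eq_el)
lemma OK_of_nat [simp]: "of_nat a \<in> OK" using OK_of_int[of "int a"] by simp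
lemma OK_0 [simp]: "0 \<in> OK" and OK_1 [simp]: "1 \<in> OK"
  using OK_of_int[of 0] OK_of_int[of 1] by simp_all

lemma real_nrm: "\<alpha> \<in> OK \<Longrightarrow> real (nrm \<alpha>) = (cmod \<alpha>)\<^sup>2"
proof (elim OK_cases)
  fix a b assume "\<alpha> = el a b"
  moreover have "q a b \<ge> 0" using cmod_el[of a b] by (metis of_int_0_le_iff zero_le_power2)
  ultimately show ?thesis by (simp add: nrm_def cmod_el)
qed

lemma nrm_el: "int (nrm (el a b)) = q a b"
proof -
  have "real_of_int (int (nrm (el a b))) = real_of_int (q a b)"
    using real_nrm[of "el a b"] cmod_el[of a b] by simp
  thus ?thesis by (simp only: of_int_eq_iff)
qed

lemma nrm_mult: "\<alpha> \<in> OK \<Longrightarrow> \<beta> \<in> OK \<Longrightarrow> nrm (\<alpha> * \<beta>) = nrm \<alpha> * nrm \<beta>"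
proof -
  assume "\<alpha> \<in> OK" "\<beta> \<in> OK"
  hence "real (nrm (\<alpha> * \<beta>)) = real (nrm \<alpha> * nrm \<beta>)"
    by (simp add: real_nrm OK_mult norm_mult power_mult_distrib)
  thus ?thesis by (simp only: of_nat_eq_iff)
qed

lemma nrm_cnj [simp]: "nrm (cnj \<alpha>) = nrm \<alpha>" by (simp add: nrm_def)

lemma nrm_of_nat: "nrm (of_nat n) = n\<^sup>2"
proof -
  have "real (nrm (of_nat n)) = real (n\<^sup>2)" using real_nrm[of "of_nat n"] by simp
  thus ?thesis by (simp only: of_nat_eq_iff)
qed

lemma nrm_0 [simp]: "nrm 0 = 0" and nrm_1 [simp]: "nrm 1 = 1"
  by (simp_all add: nrm_def)

lemma nrm_eq_0_iff: "\<alpha> \<in> OK \<Longrightarrow> nrm \<alpha> = 0 \<longleftrightarrow> \<alpha> = 0"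
  using real_nrm[of \<alpha>] by auto

lemma mult_cnj_nrm: "\<alpha> \<in> OK \<Longrightarrow> \<alpha> * cnj \<alpha> = of_nat (nrm \<alpha>)"
  using real_nrm[of \<alpha>] by (metis complex_norm_square of_real_of_nat_eq of_real_power)

lemma dv_trans: "dv \<alpha> \<beta> \<Longrightarrow> dv \<beta> \<gamma> \<Longrightarrow> dv \<alpha> \<gamma>"
  unfolding dv_def by (auto simp: mult.assoc intro!: bexI[of _ "_ * _"])

lemma dv_refl [simp]: "dv \<alpha> \<alpha>" unfolding dv_def by (auto intro!: bexI[of _ 1])

lemma dv_add: "dv \<alpha> \<beta> \<Longrightarrow> dv \<alpha> \<gamma> \<Longrightarrow> dv \<alpha> (\<beta> + \<gamma>)"
  and dv_diff: "dv \<alpha> \<beta> \<Longrightarrow> dv \<alpha> \<gamma> \<Longrightarrow> dv \<alpha> (\<beta> - \<gamma>)"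
  unfolding dv_def
  by (auto simp: ring_distribs[symmetric])

lemma dv_mult: "dv \<alpha> \<beta> \<Longrightarrow> \<gamma> \<in> OK \<Longrightarrow> dv \<alpha> (\<beta> * \<gamma>)"
  unfolding dv_def by (auto simp: mult.assoc intro!: bexI[of _ "_ * _"])

lemma dv_triv: "\<gamma> \<in> OK \<Longrightarrow> dv \<alpha> (\<alpha> * \<gamma>)"
  unfolding dv_def by blast

lemma dv_cnj: "dv \<alpha> \<beta> \<Longrightarrow> dv (cnj \<alpha>) (cnj \<beta>)"
  unfolding dv_def by (auto intro!: bexI[of _ "cnj _"])

lemma dv_nrm: "dv \<alpha> \<beta> \<Longrightarrow> \<alpha> \<in> OK \<Longrightarrow> nrm \<alpha> dvd nrm \<beta>"
  unfolding dv_def by (auto simp: nrm_mult)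

lemma dv_antisym_nrm: "dv \<alpha> \<beta> \<Longrightarrow> dv \<beta> \<alpha> \<Longrightarrow> \<alpha> \<in> OK \<Longrightarrow> \<beta> \<in> OK \<Longrightarrow> nrm \<alpha> = nrm \<beta>"
  by (intro dvd_antisym dv_nrm)

context
  fixes \<pi> p assumes pi: "\<pi> \<in> OK" "nrm \<pi> = p" "prime p"
begin

lemma dv_of_int_iff: "dv \<pi> (of_int r) \<longleftrightarrow> int p dvd r"
proof
  assume "dv \<pi> (of_int r)"
  hence "p dvd nrm (of_int r)" using dv_nrm pi by blast
  hence "int p dvd int (nrm (el r 0))" by (simp add: of_int_eq_el)
  hence "int p dvd r * r" by (simp add: nrm_el q_def power2_eq_square)
  thus "int p dvd r" using pi(3) by (simp add: prime_dvd_mult_iff)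
next
  assume "int p dvd r"
  then obtain k where k: "r = int p * k" by blast
  have "of_int r = \<pi> * (cnj \<pi> * of_int k)"
    using mult_cnj_nrm[OF pi(1)] pi(2) by (simp add: k mult.assoc[symmetric])
  thus "dv \<pi> (of_int r)" using pi(1) by (auto intro!: dv_triv)
qed

text \<open>
Since \<open>\<pi> = a + b \<lambda>\<close> has norm \<open>p\<close> and \<open>p\<close> does not divide \<open>b\<close> (otherwise \<open>p^2\<close> would divide the norm),
the relation \<open>b \<lambda> \<equiv> -a\<close> can be solved for \<open>\<lambda>\<close> modulo \<open>\<pi>\<close>. Thus the residue ring of \<open>\<pi>\<close> is the field
with \<open>p\<close> elements.
\<close>

lemma lam_residue: "\<exists>c. dv \<pi> (lam - of_int c)"
proof -
  obtain a b where ab: "\<pi> = el a b" using pi(1) by (auto elim: OK_cases)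
  have qab: "q a b = int p" using nrm_el[of a b] pi(2) ab by simp
  have "\<not> int p dvd b"
  proof
    assume b: "int p dvd b"
    then obtain k where k: "b = int p * k" by blast
    have "a\<^sup>2 = int p * (1 - t * a * k - m * k * b)"
      using qab by (simp add: q_def k power2_eq_square algebra_simps)
    hence "int p dvd a * a" by (simp add: power2_eq_square)
    hence "int p dvd a" using pi(3) by (simp add: prime_dvd_mult_iff)
    then obtain l where l: "a = int p * l" by blast
    have "int p = int p * (int p * (l\<^sup>2 + t * l * k + m * k\<^sup>2))"
      using qab by (simp add: q_def k l power2_eq_square algebra_simps)
    hence "1 = int p * (l\<^sup>2 + t * l * k + m * k\<^sup>2)" using pi(3) prime_gt_0_nat[of p] by simp
    hence "int p dvd 1" by (metis dvd_triv_left)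
    thus False using pi(3) not_prime_1 by (metis int_dvd_int_iff nat_dvd_1_iff_1 of_nat_1)
  qed
  hence "coprime b (int p)"
    using pi(3) by (metis coprime_commute prime_imp_coprime prime_nat_int_transfer)
  then obtain u v where uv: "u * b + v * int p = 1" using bezout_int by (metis coprime_iff_gcd_eq_1)
  have p: "dv \<pi> (of_int (int p * v))" unfolding dv_of_int_iff by simp
  have "lam - of_int (- (a * u)) = \<pi> * of_int u + of_int (int p * v) * lam"
  proof -
    have "lam = of_int (u * b + v * int p) * lam" by (simp add: uv)
    thus ?thesis by (simp add: ab el_def algebra_simps)
  qed
  moreover have "dv \<pi> (\<pi> * of_int u + of_int (int p * v) * lam)"
    using OK_el[of 0 1] by (intro dv_add dv_mult[OF p] dv_triv) (auto simp: el_def)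
  ultimately show ?thesis by metis
qed

lemma residue: 
  assumes "\<alpha> \<in> OK"
  obtains r :: int where "dv \<pi> (\<alpha> - of_int r)"
proof -
  obtain c where c: "dv \<pi> (lam - of_int c)" using lam_residue by blast
  obtain a b where ab: "\<alpha> = el a b" using assms by (auto elim: OK_cases)
  have "dv \<pi> ((lam - of_int c) * of_int b)" using c by (rule dv_mult) simp
  also have "(lam - of_int c) * of_int b = \<alpha> - of_int (a + b * c)"
    by (simp add: ab el_def algebra_simps)
  finally show ?thesis using that by blast
qed

lemma residue_unique:
  assumes "\<alpha> \<in> OK"
  shows "\<exists>!r. r < p \<and> dv \<pi> (\<alpha> - of_nat r)"
proof -
  have p0: "p > 0" using pi(3) prime_gt_0_nat by blast
  obtain r :: int where r: "dv \<pi> (\<alpha> - of_int r)" using residue assms by blast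
  show ?thesis
  proof (rule ex1I)
    have "dv \<pi> (of_int (r - r mod int p))" unfolding dv_of_int_iff by (simp add: minus_mod_eq_mult_div)
    from dv_add[OF r this] show "nat (r mod int p) < p \<and> dv \<pi> (\<alpha> - of_nat (nat (r mod int p)))"
      using p0 by (simp add: nat_less_iff)
  next
    fix s assume s: "s < p \<and> dv \<pi> (\<alpha> - of_nat s)"
    have "dv \<pi> (of_int (r - int s))" using dv_diff[OF conjunct2[OF s] r] by simp
    hence "int p dvd r - int s" unfolding dv_of_int_iff .
    hence "r mod int p = int s" using s by (metis mod_eq_dvd_iff mod_pos_pos_trivial of_nat_0_le_iff of_nat_less_iff)
    thus "s = nat (r mod int p)" by simp
  qed
qed

lemma prime_norm_prime_elem:
  assumes "\<alpha> \<in> OK" "\<beta> \<in> OK" "dv \<pi> (\<alpha> * \<beta>)"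
  shows "dv \<pi> \<alpha> \<or> dv \<pi> \<beta>"
proof -
  obtain r :: int where r: "dv \<pi> (\<alpha> - of_int r)" using residue assms by blast
  obtain s :: int where s: "dv \<pi> (\<beta> - of_int s)" using residue assms by blast
  have "dv \<pi> ((\<alpha> - of_int r) * \<beta> + (\<beta> - of_int s) * of_int r)"
    using assms by (intro dv_add dv_mult r s) auto
  from dv_diff[OF assms(3) this] have "dv \<pi> (of_int (r * s))" by (simp add: algebra_simps)
  hence "int p dvd r * s" unfolding dv_of_int_iff .
  hence "int p dvd r \<or> int p dvd s" using pi(3) by (simp add: prime_dvd_mult_iff)
  thus ?thesis using dv_add[OF r, of "of_int r"] dv_add[OF s, of "of_int s"] dv_of_int_iff by auto
qed

end

text \<open>
The polynomial is that of \<open>-\<lambda>\<close>, so that its value at \<open>x\<close> is the norm of \<open>x + \<lambda>\<close>.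
\<close>

definition has_root :: "nat \<Rightarrow> bool" where
  "has_root p \<longleftrightarrow> (\<exists>x::int. int p dvd x\<^sup>2 + t * x + m)"

text \<open>
If \<open>p\<close> does not divide \<open>b\<close>, then \<open>a / b\<close> modulo \<open>p\<close> is a root.
\<close>

lemma inert_dvd:
  assumes p: "prime p" "\<not> has_root p" and d: "int p dvd q a b"
  shows "int p dvd a \<and> int p dvd b"
proof -
  have "int p dvd b"
  proof (rule ccontr)
    assume "\<not> int p dvd b"
    hence "coprime b (int p)"
      using p(1) by (metis coprime_commute prime_imp_coprime prime_nat_int_transfer)
    then obtain u v where uv: "u * b + v * int p = 1" using bezout_int by (metis coprime_iff_gcd_eq_1)
    have ub: "u * b = 1 - v * int p" using uv by linarith
    have "u\<^sup>2 * q a b = (u * a)\<^sup>2 + t * (u * a) * (u * b) + m * (u * b)\<^sup>2"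
      by (simp add: q_def power2_eq_square algebra_simps)
    also have "\<dots> = ((u * a)\<^sup>2 + t * (u * a) + m) + int p * (- t * u * a * v - 2 * m * v + m * v\<^sup>2 * int p)"
      unfolding ub by (simp add: power2_eq_square algebra_simps)
    finally have "(u * a)\<^sup>2 + t * (u * a) + m = u\<^sup>2 * q a b - int p * (- t * u * a * v - 2 * m * v + m * v\<^sup>2 * int p)"
      by linarith
    also have "int p dvd \<dots>" using d by (intro dvd_diff dvd_mult[OF d] dvd_triv_left)
    finally show False using p(2) unfolding has_root_def by blast
  qed
  then obtain k where k: "b = int p * k" by blast
  have "a * a = q a b - int p * (t * a * k + m * k * b)"
    by (simp add: q_def k power2_eq_square algebra_simps)
  also have "int p dvd \<dots>" using d by auto
  finally have "int p dvd a" using p(1) by (simp add: prime_dvd_mult_iff)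
  thus ?thesis using \<open>int p dvd b\<close> by blast
qed

lemma dv_of_nat_iff_nrm:
  assumes p: "prime p" "\<not> has_root p" and \<alpha>: "\<alpha> \<in> OK"
  shows "dv (of_nat p) \<alpha> \<longleftrightarrow> p dvd nrm \<alpha>"
proof
  assume "dv (of_nat p) \<alpha>"
  hence "p\<^sup>2 dvd nrm \<alpha>" using dv_nrm[of "of_nat p" \<alpha>] by (simp add: nrm_of_nat)
  thus "p dvd nrm \<alpha>" by (meson dvd_power dvd_trans zero_less_numeral)
next
  obtain a b where ab: "\<alpha> = el a b" using \<alpha> by (auto elim: OK_cases)
  assume "p dvd nrm \<alpha>"
  hence "int p dvd q a b" using nrm_el[of a b] ab by (metis int_dvd_int_iff)
  then obtain k l where "a = int p * k" "b = int p * l" using inert_dvd[OF p] by blast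
  hence "\<alpha> = of_nat p * el k l" by (simp add: ab el_def algebra_simps)
  thus "dv (of_nat p) \<alpha>" by (auto intro: dv_triv)
qed

text \<open>
Divide an element of norm \<open>n k\<close> by elements whose norms are the prime factors of \<open>k\<close>, one at a time. Such
a prime element divides either the given element or its conjugate.
\<close>

lemma norm_descent:
  assumes "\<And>p. prime p \<Longrightarrow> p dvd k \<Longrightarrow> \<exists>\<rho>\<in>OK. nrm \<rho> = p"
    and "\<alpha> \<in> OK" "nrm \<alpha> = n * k" "k > 0"
  shows "\<exists>\<beta>\<in>OK. nrm \<beta> = n"
  using assms
proof (induction k arbitrary: \<alpha> rule: less_induct)
  case (less k)
  show ?case
  proof (cases "k = 1")
    case True
    thus ?thesis using less.prems(2,3) by (intro bexI[of _ \<alpha>]) auto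
  next
    case False
    then obtain p where p: "prime p" "p dvd k" using prime_factor_nat by blast
    then obtain \<rho> where \<rho>: "\<rho> \<in> OK" "nrm \<rho> = p" using less.prems(1) by blast
    obtain l where l: "k = p * l" using p by blast
    have lk: "l < k" "l > 0" using l less.prems(4) prime_gt_1_nat[OF p(1)] by (auto simp: mult_less_cancel_right2)
    have "dv \<rho> (of_int (int (nrm \<alpha>)))"
      unfolding dv_of_int_iff[OF \<rho> p(1)] by (simp add: less.prems(3) l)
    hence "dv \<rho> (\<alpha> * cnj \<alpha>)" using mult_cnj_nrm[OF less.prems(2)] by simp
    hence "dv \<rho> \<alpha> \<or> dv \<rho> (cnj \<alpha>)" 
      using prime_norm_prime_elem[OF \<rho> p(1)] less.prems(2) by blast
    then obtain \<alpha>' where a: "\<alpha>' \<in> OK" "nrm \<alpha>' = nrm \<alpha>" "dv \<rho> \<alpha>'"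
      using less.prems(2) nrm_cnj by blast
    then obtain \<gamma> where g: "\<gamma> \<in> OK" "\<alpha>' = \<rho> * \<gamma>" unfolding dv_def by blast
    have "p * nrm \<gamma> = n * (p * l)" using a g \<rho> less.prems(3) by (simp add: nrm_mult l)
    hence "nrm \<gamma> = n * l" using prime_gt_0_nat[OF p(1)] by simp
    moreover have "\<exists>\<rho>\<in>OK. nrm \<rho> = r" if "prime r" "r dvd l" for r
      using less.prems(1)[OF that(1)] that(2) l by (meson dvd_trans dvd_triv_right)
    ultimately show ?thesis using less.IH[OF lk(1) _ g(1) _ lk(2)] by blast
  qed
qed

text \<open>
This is the class number one condition in the manner of Rabinowitsch, with \<open>4 m - t^2\<close> the absolute value of the
discriminant. It forces \<open>p < 8\<close>, and the few cases are checked directly.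
\<close>

lemma no_small_root:
  assumes p: "prime p" "3 * (int p)\<^sup>2 \<le> 4 * m - t\<^sup>2"
  shows "\<not> has_root p"
proof
  assume "has_root p"
  then obtain x :: int where x: "int p dvd x\<^sup>2 + t * x + m" unfolding has_root_def by blast
  have "p < 8"
  proof (rule ccontr)
    assume "\<not> p < 8"
    hence "8 * 8 \<le> int p * int p" by (intro mult_mono) auto
    thus False using p(2) tm by (auto simp: power2_eq_square)
  qed
  hence "p \<in> {0,1,2,3,4,5,6,7}" by auto
  moreover have "p \<noteq> 0" "p \<noteq> 1" "p \<noteq> 4" "p \<noteq> 6"
    using p(1) prime_product[of 2 2] prime_product[of 2 3] by auto
  ultimately have pc: "p \<in> {2,3,5,7}" by auto
  define y where "y = x mod int p"
  have "int p dvd x - y" unfolding y_def by (simp only: minus_mod_eq_mult_div dvd_triv_left)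
  hence "int p dvd (x - y) * (x + y + t)" by simp
  hence "int p dvd (x\<^sup>2 + t * x + m) - (x - y) * (x + y + t)" using x by simp
  also have "(x\<^sup>2 + t * x + m) - (x - y) * (x + y + t) = y\<^sup>2 + t * y + m"
    by (simp add: power2_eq_square algebra_simps)
  finally have y: "int p dvd y\<^sup>2 + t * y + m" .
  have yb: "0 \<le> y" "y < int p" using pc unfolding y_def by auto
  have c: "t = 1 \<and> (m = 5 \<and> p = 2 \<or> m = 11 \<and> p \<in> {2,3} \<or> m = 17 \<and> p \<in> {2,3}
      \<or> m = 41 \<and> p \<in> {2,3,5,7})"
    using tm pc p(2) by auto
  consider "p = 2" "y = 0 \<or> y = 1" | "p = 3" "y = 0 \<or> y = 1 \<or> y = 2"
    | "p = 5" "y = 0 \<or> y = 1 \<or> y = 2 \<or> y = 3 \<or> y = 4"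
    | "p = 7" "y = 0 \<or> y = 1 \<or> y = 2 \<or> y = 3 \<or> y = 4 \<or> y = 5 \<or> y = 6"
    using pc yb by fastforce
  thus False
  proof cases
    case 1 thus ?thesis using c y by auto
  next
    case 2 thus ?thesis using c y by auto
  next
    case 3 thus ?thesis using c y by auto
  next
    case 4 thus ?thesis using c y by auto
  qed
qed

text \<open>
Induction on \<open>p\<close>. Since \<open>p\<close> lies above the bound in \<open>no_small_root\<close>, the root \<open>x\<close> with
\<open>\<bar>2 x + t\<bar> \<le> p\<close> gives \<open>N(x + \<lambda>) = p k\<close> with \<open>0 < k < p\<close>. The prime factors of \<open>k\<close> have the same root \<open>x\<close>, so they are norms by
induction, and descent removes them.
\<close>

lemma root_imp_norm:
  "prime p \<Longrightarrow> has_root p \<Longrightarrow> \<exists>\<pi>\<in>OK. nrm \<pi> = p"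
proof (induction p rule: less_induct)
  case (less p)
  have p0: "int p > 0" using less.prems(1) prime_gt_0_nat by simp
  obtain x0 :: int where x0: "int p dvd x0\<^sup>2 + t * x0 + m" using less.prems unfolding has_root_def by blast
  (* The representative of x0 modulo p for which |2 x + t| is smallest; then
     4 N(x + lambda) = (2 x + t)^2 - D <= p^2 - D with D = t^2 - 4 m. *)
  define x where "x = (x0 + (int p + t) div 2) mod int p - (int p + t) div 2"
  have "int p dvd x0 - x"
  proof -
    have "x0 - x = (x0 + (int p + t) div 2) - (x0 + (int p + t) div 2) mod int p"
      by (simp add: x_def)
    thus ?thesis by (simp only: minus_mod_eq_mult_div dvd_triv_left)
  qed
  hence "int p dvd (x0 - x) * (x0 + x + t)" by simp
  hence "int p dvd (x0\<^sup>2 + t * x0 + m) - (x0 - x) * (x0 + x + t)" using x0 by simp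
  also have "(x0\<^sup>2 + t * x0 + m) - (x0 - x) * (x0 + x + t) = q x 1"
    by (simp add: q_def power2_eq_square algebra_simps)
  finally obtain k where k: "q x 1 = int p * k" by blast
  have four: "4 * q x 1 = (2 * x + t)\<^sup>2 + (4 * m - t\<^sup>2)"
    by (simp add: q_def power2_eq_square algebra_simps)
  have aux: "\<bar>2 * (r - S) + t\<bar> \<le> P"
    if "0 \<le> r" "r < P" "2 * S \<le> P + t" "P + t \<le> 2 * S + 1" for r S P :: int
    using that by presburger
  have xb: "\<bar>2 * x + t\<bar> \<le> int p"
  proof -
    have "0 \<le> (x0 + (int p + t) div 2) mod int p" "(x0 + (int p + t) div 2) mod int p < int p"
      using p0 by simp_all
    moreover have "2 * ((int p + t) div 2) \<le> int p + t" "int p + t \<le> 2 * ((int p + t) div 2) + 1"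
      by linarith+
    ultimately show ?thesis unfolding x_def
      by (rule aux)
  qed
  have xb2: "(2 * x + t)\<^sup>2 \<le> (int p)\<^sup>2" using abs_le_square_iff[of "2 * x + t" "int p"] xb p0 by simp
  have kpos: "k > 0"
  proof -
    have "4 * q x 1 > 0" unfolding four using disc_pos by (simp add: add_nonneg_pos)
    hence "0 < int p * k" using k by linarith
    thus ?thesis using p0 by (rule zero_less_mult_pos)
  qed
  have "4 * m - t\<^sup>2 < 3 * (int p)\<^sup>2" using no_small_root[of p] less.prems by (meson not_le)
  hence "4 * (int p * k) < 4 * (int p * int p)" using four xb2 k by (simp add: power2_eq_square)
  hence kp: "k < int p" using p0 by simp
  have "int (nrm (el x 1)) = int (p * nat k)" using nrm_el[of x 1] k kpos by simp
  hence "nrm (el x 1) = p * nat k" unfolding of_nat_eq_iff .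
  moreover have "\<exists>\<rho>\<in>OK. nrm \<rho> = r" if r: "prime r" "r dvd nat k" for r
  proof (rule less.IH)
    have "r \<le> nat k" using r kpos by (intro dvd_imp_le) auto
    also have "nat k < p" using kp kpos by (simp add: nat_less_iff)
    finally show "r < p" .
    have "int r dvd int (nat k)" unfolding int_dvd_int_iff by (rule r(2))
    hence "int r dvd k" using kpos by simp
    hence "int r dvd q x 1" unfolding k by simp
    thus "has_root r" unfolding has_root_def q_def by (intro exI[of _ x]) simp
  qed fact
  ultimately show ?case using norm_descent[of "nat k" "el x 1" p] kpos by auto
qed


definition assoc :: "complex \<Rightarrow> complex \<Rightarrow> bool" where
  "assoc \<alpha> \<beta> \<longleftrightarrow> dv \<alpha> \<beta> \<and> dv \<beta> \<alpha>"

text \<open>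
Euler products need one prime from each class of associates.
\<close>

definition canon :: "complex \<Rightarrow> complex" where
  "canon \<alpha> = (SOME \<beta>. \<beta> \<in> OK \<and> assoc \<alpha> \<beta>)"

text \<open>
Representatives of the primes whose norm is a rational prime, split or ramified. The other
primes, \<open>inert_primes\<close>, have norm \<open>p^2\<close> and contribute a bounded amount to sums of \<open>1 / N \<pi>\<close>.
\<close>

definition deg1_primes :: "complex set" where
  "deg1_primes = canon ` {\<pi> \<in> OK. prime (nrm \<pi>)}"

definition inert_primes :: "complex set" where
  "inert_primes = of_nat ` {p. prime p \<and> \<not> has_root p}"

definition prime_reps :: "complex set" where
  "prime_reps = deg1_primes \<union> inert_primes"

lemma assoc_sym: "assoc \<alpha> \<beta> \<Longrightarrow> assoc \<beta> \<alpha>" by (simp add: assoc_def)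
lemma assoc_trans: "assoc \<alpha> \<beta> \<Longrightarrow> assoc \<beta> \<gamma> \<Longrightarrow> assoc \<alpha> \<gamma>" by (auto simp: assoc_def intro: dv_trans)

lemma canon:
  assumes "\<alpha> \<in> OK"
  shows "canon \<alpha> \<in> OK" "assoc \<alpha> (canon \<alpha>)" "nrm (canon \<alpha>) = nrm \<alpha>"
proof -
  have "\<exists>\<beta>. \<beta> \<in> OK \<and> assoc \<alpha> \<beta>" using assms by (auto simp: assoc_def)
  hence "canon \<alpha> \<in> OK \<and> assoc \<alpha> (canon \<alpha>)" unfolding canon_def by (rule someI_ex)
  thus "canon \<alpha> \<in> OK" "assoc \<alpha> (canon \<alpha>)" "nrm (canon \<alpha>) = nrm \<alpha>"
    using assms dv_antisym_nrm[of \<alpha> "canon \<alpha>"] unfolding assoc_def by auto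
qed

lemma canon_eq: "assoc \<alpha> \<beta> \<Longrightarrow> canon \<alpha> = canon \<beta>"
proof -
  assume "assoc \<alpha> \<beta>"
  hence "assoc \<alpha> \<gamma> \<longleftrightarrow> assoc \<beta> \<gamma>" for \<gamma> using assoc_sym assoc_trans by blast
  thus ?thesis by (simp add: canon_def)
qed

lemma deg1_primesD:
  assumes "\<pi> \<in> deg1_primes"
  shows "\<pi> \<in> OK" "prime (nrm \<pi>)" "canon \<pi> = \<pi>"
  using assms canon canon_eq[OF canon(2)] unfolding deg1_primes_def by auto

lemma canon_in_deg1_primes: "\<pi> \<in> OK \<Longrightarrow> prime (nrm \<pi>) \<Longrightarrow> canon \<pi> \<in> deg1_primes"
  unfolding deg1_primes_def by blast

lemma inert_primesD:
  assumes "\<pi> \<in> inert_primes"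
  obtains p where "\<pi> = of_nat p" "prime p" "\<not> has_root p"
  using assms unfolding inert_primes_def by blast

lemma prime_reps_OK: "\<pi> \<in> prime_reps \<Longrightarrow> \<pi> \<in> OK"
  by (auto simp: prime_reps_def dest: deg1_primesD elim: inert_primesD)

lemma prime_reps_nrm: "\<pi> \<in> prime_reps \<Longrightarrow> nrm \<pi> \<ge> 2"
  unfolding prime_reps_def
proof (elim UnE)
  assume "\<pi> \<in> inert_primes"
  then obtain p where p: "\<pi> = of_nat p" "prime p" by (elim inert_primesD)
  have "2 * 1 \<le> p * p" using prime_ge_2_nat[OF p(2)] by (intro mult_mono) auto
  thus ?thesis unfolding p(1) nrm_of_nat by (simp add: power2_eq_square)
qed (auto dest: deg1_primesD prime_ge_2_nat)

lemma prime_reps_nonzero: "\<pi> \<in> prime_reps \<Longrightarrow> \<pi> \<noteq> 0"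
  using prime_reps_nrm[of 0] by auto

lemma prime_reps_prime:
  assumes "\<pi> \<in> prime_reps" "\<alpha> \<in> OK" "\<beta> \<in> OK" "dv \<pi> (\<alpha> * \<beta>)"
  shows "dv \<pi> \<alpha> \<or> dv \<pi> \<beta>"
proof (cases "\<pi> \<in> deg1_primes")
  case True
  thus ?thesis using prime_norm_prime_elem[OF _ refl, of \<pi>] deg1_primesD assms by blast
next
  case False
  then obtain p where p: "\<pi> = of_nat p" "prime p" "\<not> has_root p" using assms by (auto simp: prime_reps_def elim: inert_primesD)
  have "p dvd nrm \<alpha> * nrm \<beta>"
    using assms dv_of_nat_iff_nrm[OF p(2,3), of "\<alpha> * \<beta>"] by (auto simp: p(1) nrm_mult)
  hence "p dvd nrm \<alpha> \<or> p dvd nrm \<beta>" using p(2) by (simp add: prime_dvd_mult_iff)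
  thus ?thesis using dv_of_nat_iff_nrm[OF p(2,3)] assms p(1) by blast
qed

lemma prime_reps_dv_eq:
  assumes "\<pi> \<in> prime_reps" "\<rho> \<in> prime_reps" "dv \<pi> \<rho>"
  shows "\<pi> = \<rho>"
proof -
  obtain \<gamma> where g: "\<gamma> \<in> OK" "\<rho> = \<pi> * \<gamma>" using assms(3) unfolding dv_def by blast
  have "dv \<rho> (\<pi> * \<gamma>)" using g by simp
  moreover have "\<not> dv \<rho> \<gamma>"
  proof
    assume "dv \<rho> \<gamma>"
    hence "nrm \<pi> * nrm \<gamma> dvd nrm \<gamma>" using dv_nrm[of \<rho> \<gamma>] g assms prime_reps_OK by (auto simp: nrm_mult)
    moreover have "nrm \<gamma> > 0" using prime_reps_nonzero[OF assms(2)] g nrm_eq_0_iff[of \<gamma>] by auto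
    ultimately have "nrm \<pi> * nrm \<gamma> \<le> nrm \<gamma>" "nrm \<gamma> > 0" by (auto intro: dvd_imp_le)
    moreover have "2 * nrm \<gamma> \<le> nrm \<pi> * nrm \<gamma>" using prime_reps_nrm[OF assms(1)] by (rule mult_right_mono) simp
    ultimately show False by linarith
  qed
  ultimately have "dv \<rho> \<pi>" using prime_reps_prime[of \<rho> \<pi> \<gamma>] assms g prime_reps_OK by blast
  hence as: "assoc \<pi> \<rho>" using assms by (simp add: assoc_def)
  hence n: "nrm \<pi> = nrm \<rho>" unfolding assoc_def using assms prime_reps_OK dv_antisym_nrm by blast
  have sq: "\<not> prime (p\<^sup>2)" for p :: nat by (simp add: prime_power_iff)
  show ?thesis
  proof (cases "\<pi> \<in> deg1_primes")
    case True
    hence "\<rho> \<in> deg1_primes" using assms n deg1_primesD(2)[OF True] sq by (auto simp: prime_reps_def nrm_of_nat elim!: inert_primesD)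
    thus ?thesis using canon_eq[OF as] deg1_primesD(3) True by simp
  next
    case False
    then obtain p where p: "\<pi> = of_nat p" "prime p" using assms by (auto simp: prime_reps_def elim: inert_primesD)
    hence "\<rho> \<notin> deg1_primes" using n sq deg1_primesD(2) by (metis nrm_of_nat)
    then obtain r where "\<rho> = of_nat r" "prime r" using assms by (auto simp: prime_reps_def elim: inert_primesD)
    thus ?thesis using n p by (simp add: nrm_of_nat)
  qed
qed

lemma exists_prime_divisor:
  assumes "\<alpha> \<in> OK" "nrm \<alpha> \<noteq> 1"
  shows "\<exists>\<pi>\<in>prime_reps. dv \<pi> \<alpha>"
proof -
  obtain p where p: "prime p" "p dvd nrm \<alpha>" using prime_factor_nat assms by blast
  show ?thesis
  proof (cases "has_root p")
    case False
    hence "of_nat p \<in> prime_reps" using p by (auto simp: prime_reps_def inert_primes_def)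
    thus ?thesis using dv_of_nat_iff_nrm[OF p(1) False assms(1)] p by blast
  next
    case True
    obtain \<rho> where \<rho>: "\<rho> \<in> OK" "nrm \<rho> = p" using root_imp_norm[OF p(1) True] by blast
    have "dv \<rho> (of_int (int (nrm \<alpha>)))"
      unfolding dv_of_int_iff[OF \<rho> p(1)] using p(2) by simp
    hence "dv \<rho> (\<alpha> * cnj \<alpha>)" using mult_cnj_nrm[OF assms(1)] by simp
    hence "dv \<rho> \<alpha> \<or> dv \<rho> (cnj \<alpha>)" 
      using prime_norm_prime_elem[OF \<rho> p(1)] assms(1) by blast
    hence "dv \<rho> \<alpha> \<or> dv (cnj \<rho>) \<alpha>" using dv_cnj[of \<rho> "cnj \<alpha>"] by auto
    then obtain \<rho>' where r: "\<rho>' \<in> OK" "nrm \<rho>' = p" "dv \<rho>' \<alpha>"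
      using \<rho> nrm_cnj by blast
    have "dv (canon \<rho>') \<alpha>" using canon[OF r(1)] r(3) dv_trans unfolding assoc_def by blast
    thus ?thesis using canon_in_deg1_primes[of \<rho>'] r p(1) by (auto simp: prime_reps_def)
  qed
qed

text \<open>
An element of norm \<open>p\<close> divides \<open>p = \<pi> * cnj \<pi>\<close>.
\<close>

lemma card_deg1_primes_norm:
  shows "finite {\<pi>\<in>deg1_primes. nrm \<pi> = p}" "card {\<pi>\<in>deg1_primes. nrm \<pi> = p} \<le> 2"
proof -
  have "\<exists>\<pi>. {\<pi>\<in>deg1_primes. nrm \<pi> = p} \<subseteq> {\<pi>, canon (cnj \<pi>)}"
  proof (cases "{\<pi>\<in>deg1_primes. nrm \<pi> = p} = {}")
    case False
    then obtain \<pi> where p: "\<pi> \<in> deg1_primes" "nrm \<pi> = p" by blast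
    have "\<rho> \<in> {\<pi>, canon (cnj \<pi>)}" if r: "\<rho> \<in> deg1_primes" "nrm \<rho> = p" for \<rho>
    proof -
      have c: "canon (cnj \<pi>) \<in> prime_reps"
        using canon_in_deg1_primes[of "cnj \<pi>"] deg1_primesD[OF p(1)] by (auto simp: prime_reps_def)
      have "\<rho> * cnj \<rho> = \<pi> * cnj \<pi>" using mult_cnj_nrm deg1_primesD p r by metis
      hence "dv \<rho> (\<pi> * cnj \<pi>)" using deg1_primesD(1)[OF r(1)] by (metis dv_triv OK_cnj)
      hence "dv \<rho> \<pi> \<or> dv \<rho> (cnj \<pi>)" using prime_reps_prime[of \<rho> \<pi> "cnj \<pi>"] r(1) deg1_primesD p(1) by (auto simp: prime_reps_def)
      hence "dv \<rho> \<pi> \<or> dv \<rho> (canon (cnj \<pi>))" 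
        using canon(2)[of "cnj \<pi>"] deg1_primesD(1)[OF p(1)] dv_trans unfolding assoc_def by blast
      thus ?thesis using prime_reps_dv_eq[of \<rho>] c p(1) r(1) by (auto simp: prime_reps_def)
    qed
    thus ?thesis by blast
  qed auto
  then obtain \<pi> where sub: "{\<pi>\<in>deg1_primes. nrm \<pi> = p} \<subseteq> {\<pi>, canon (cnj \<pi>)}" by blast
  show "finite {\<pi>\<in>deg1_primes. nrm \<pi> = p}" using sub by (rule finite_subset) auto
  show "card {\<pi>\<in>deg1_primes. nrm \<pi> = p} \<le> 2"
    using card_mono[OF _ sub] card_insert_le_m1[of 2 "{canon (cnj \<pi>)}" \<pi>] by auto
qed

lemma big_Omega_mult_prime:
  assumes "\<pi> \<in> deg1_primes" "\<beta> \<in> OK" "\<beta> \<noteq> 0"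
  shows "big_Omega (nrm (\<pi> * \<beta>)) = Suc (big_Omega (nrm \<beta>))"
  using assms deg1_primesD[OF assms(1)] nrm_eq_0_iff[OF assms(2)]
  by (simp add: nrm_mult big_Omega_def prime_factorization_mult prime_factorization_prime prime_gt_0_nat)

text \<open>
A unit has absolute value 1 and integral trace \<open>\<tau>\<close>, so \<open>\<bar>\<tau>\<bar> \<le> 2\<close>, and \<open>u^2 = \<tau> u - 1\<close> makes it a root of unity of
order 1, 2, 3, 4 or 6.
\<close>

lemma unit_power_12:
  assumes "u \<in> OK" "nrm u = 1"
  shows "u ^ 12 = 1"
proof -
  obtain a b where ab: "u = el a b" using assms(1) by (auto elim: OK_cases)
  define \<tau> where "\<tau> = 2 * a + t * b"
  have uc: "u * cnj u = 1" using mult_cnj_nrm[OF assms(1)] assms(2) by simp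
  have us: "u + cnj u = of_int \<tau>" by (simp add: ab el_cnj el_add \<tau>_def) (simp add: el_def)
  have sq: "u * u = of_int \<tau> * u - 1"
    using uc by (simp add: us[symmetric] algebra_simps)
  have "cmod u = 1" using real_nrm[OF assms(1)] assms(2) by (simp add: abs_square_eq_1)
  have "2 * Re u = of_int \<tau>" using arg_cong[OF us, of Re] by simp
  moreover have "\<bar>Re u\<bar> \<le> 1" using abs_Re_le_cmod[of u] \<open>cmod u = 1\<close> by simp
  ultimately have "\<bar>real_of_int \<tau>\<bar> \<le> 2" by linarith
  hence "\<bar>\<tau>\<bar> \<le> 2" by linarith
  hence "\<tau> = 0 \<or> \<tau> = 1 \<or> \<tau> = -1 \<or> \<tau> = 2 \<or> \<tau> = -2" by linarith
  then consider "u ^ 2 = -1" | "u ^ 2 = u - 1" | "u ^ 2 = - u - 1" | "(u - 1)^2 = 0" | "(u + 1)^2 = 0"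
    using sq by (auto simp: power2_eq_square algebra_simps)
  thus ?thesis
  proof cases
    case 1
    have "u ^ 12 = (u ^ 2) ^ 6" by (simp add: power_mult[symmetric])
    thus ?thesis unfolding 1 by simp
  next
    case 2
    have "u ^ 3 = u * u ^ 2" by (simp add: power3_eq_cube power2_eq_square)
    also have "\<dots> = u ^ 2 - u" unfolding 2 by (simp add: algebra_simps power2_eq_square[symmetric] 2)
    finally have c: "u ^ 3 = -1" using 2 by simp
    have "u ^ 12 = (u ^ 3) ^ 4" by (simp add: power_mult[symmetric])
    thus ?thesis unfolding c by simp
  next
    case 3
    have "u ^ 3 = u * u ^ 2" by (simp add: power3_eq_cube power2_eq_square)
    also have "\<dots> = - (u ^ 2) - u" unfolding 3 by (simp add: algebra_simps power2_eq_square[symmetric] 3)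
    finally have c: "u ^ 3 = 1" using 3 by simp
    have "u ^ 12 = (u ^ 3) ^ 4" by (simp add: power_mult[symmetric])
    thus ?thesis unfolding c by simp
  next
    case 4 thus ?thesis by simp
  next
    case 5
    hence "u = -1" by (simp add: add_eq_0_iff2)
    thus ?thesis by simp
  qed
qed

lemma q_ge: "a\<^sup>2 + b\<^sup>2 \<le> 2 * q a b"
proof -
  have "m * b\<^sup>2 \<ge> 1 * b\<^sup>2" using m_pos by (intro mult_right_mono) auto
  moreover have "0 \<le> (a + b)\<^sup>2" "0 \<le> a\<^sup>2" "0 \<le> b\<^sup>2" by simp_all
  moreover have "(a + b)\<^sup>2 = a\<^sup>2 + 2 * (a * b) + b\<^sup>2" by (simp add: power2_eq_square algebra_simps)
  ultimately have "0 \<le> a\<^sup>2 + 2 * (t * a * b) + b\<^sup>2" "1 * b\<^sup>2 \<le> m * b\<^sup>2" "0 \<le> b\<^sup>2"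
    using t_cases by (auto simp: mult.assoc)
  thus ?thesis unfolding q_def by simp
qed

text \<open>
For coefficients \<open>t \<le> 1\<close> and \<open>m \<le> 41\<close> the sum of the three coefficients is at most 43.
\<close>

lemma q_le: "0 \<le> a \<Longrightarrow> 0 \<le> b \<Longrightarrow> a \<le> c \<Longrightarrow> b \<le> c \<Longrightarrow> q a b \<le> 50 * c\<^sup>2"
proof -
  assume *: "0 \<le> a" "0 \<le> b" "a \<le> c" "b \<le> c"
  have "a\<^sup>2 \<le> c\<^sup>2" "b\<^sup>2 \<le> c\<^sup>2" using * by (auto intro: power_mono)
  moreover have "a * b \<le> c\<^sup>2" unfolding power2_eq_square using * by (intro mult_mono) auto
  moreover have "t * a * b \<le> 1 * (a * b)" using t_cases * by auto
  moreover have "m * b\<^sup>2 \<le> 41 * b\<^sup>2" using tm by (intro mult_right_mono) auto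
  moreover have "0 \<le> c\<^sup>2" by simp
  ultimately show ?thesis unfolding q_def by linarith
qed

end

section \<open>Absolutely convergent sums over the lattice\<close>

lemma powr_neg_sub_bound:
  fixes x y s :: real
  assumes "0 < x" "x / 2 \<le> y" "y \<le> 2 * x" "1 \<le> s" "s \<le> 2"
  shows "\<bar>y powr (-2 * s) - x powr (-2 * s)\<bar> \<le> 128 * x powr (-2 * s - 1) * \<bar>y - x\<bar>"
proof (cases "x = y")
  case False
  define a where "a = min x y"
  define b where "b = max x y"
  have ab: "a < b" "a > 0" "a \<ge> x / 2" using False assms by (auto simp: a_def b_def)
  have "\<exists>z. a < z \<and> z < b \<and> b powr (-2 * s) - a powr (-2 * s) = (b - a) * ((-2 * s) * z powr (-2 * s - 1))"
    using ab by (intro MVT2[of a b "\<lambda>z. z powr (-2 * s)"]) (auto intro!: derivative_eq_intros simp: powr_diff)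
  then obtain z where z: "a < z" "z < b" 
    "b powr (-2 * s) - a powr (-2 * s) = (b - a) * ((-2 * s) * z powr (-2 * s - 1))" by blast
  have "\<bar>y powr (-2 * s) - x powr (-2 * s)\<bar> = \<bar>b powr (-2 * s) - a powr (-2 * s)\<bar>"
    by (auto simp: a_def b_def min_def max_def)
  also have "\<dots> = (b - a) * (2 * s * z powr (-2 * s - 1))"
    unfolding z(3) using ab assms by (simp add: abs_mult)
  also have "b - a = \<bar>y - x\<bar>" by (auto simp: a_def b_def)
  also have "\<bar>y - x\<bar> * (2 * s * z powr (-2 * s - 1)) \<le> \<bar>y - x\<bar> * (4 * (x / 2) powr (-2 * s - 1))"
    using ab z assms by (intro mult_left_mono mult_mono powr_mono2') auto
  also have "(x / 2) powr (-2 * s - 1) = 2 powr (2 * s + 1) * x powr (-2 * s - 1)"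
    using assms by (simp add: powr_divide powr_minus divide_simps powr_add[symmetric])
  also have "\<bar>y - x\<bar> * (4 * (2 powr (2 * s + 1) * x powr (-2 * s - 1)))
      \<le> \<bar>y - x\<bar> * (4 * (2 powr 5 * x powr (-2 * s - 1)))"
    using assms by (intro mult_left_mono mult_right_mono powr_mono) auto
  also have "\<dots> = 128 * x powr (-2 * s - 1) * \<bar>y - x\<bar>" by simp
  finally show ?thesis .
qed simp

lemma norm_div_cnj: "z \<noteq> 0 \<Longrightarrow> norm (z / cnj z) = 1"
  by (simp add: norm_divide)

lemma div_cnj_sub_bound:
  fixes z w :: complex
  assumes "z \<noteq> 0" "w \<noteq> 0"
  shows "norm (w / cnj w - z / cnj z) \<le> 2 * norm (w - z) / norm w"
proof -
  have "w / cnj w - z / cnj z = ((w - z) * cnj z - z * cnj (w - z)) / (cnj w * cnj z)"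
    using assms by (simp add: field_simps)
  hence "norm (w / cnj w - z / cnj z) = norm ((w - z) * cnj z - z * cnj (w - z)) / (norm w * norm z)"
    by (simp add: norm_divide norm_mult)
  also have "norm ((w - z) * cnj z - z * cnj (w - z)) \<le> norm ((w - z) * cnj z) + norm (z * cnj (w - z))"
    by (rule norm_triangle_ineq4)
  also have "\<dots> = 2 * norm (w - z) * norm z"
    by (simp add: norm_mult del: complex_cnj_diff)
  finally show ?thesis using assms by (simp add: divide_right_mono field_simps)
qed

lemma int_powr_summable:
  fixes s :: real
  assumes "s > 1"
  shows "(\<lambda>n::int. (1 + \<bar>of_int n\<bar>) powr (-s)) summable_on UNIV"
proof -
  have "summable (\<lambda>n. real n powr (-s))" using assms by (simp add: summable_real_powr_iff)
  hence "summable (\<lambda>n. real (Suc n) powr (-s))" by (subst summable_Suc_iff)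
  hence *: "(\<lambda>n. (1 + real n) powr (-s)) summable_on UNIV"
    by (subst summable_on_UNIV_nonneg_real_iff) auto
  have "(\<lambda>n::int. (1 + \<bar>of_int n\<bar>) powr (-s)) summable_on range int"
    using * by (subst summable_on_reindex) (auto simp: o_def inj_on_def)
  moreover have "(\<lambda>n::int. (1 + \<bar>of_int n\<bar>) powr (-s)) summable_on range (\<lambda>n. - int n)"
    using * by (subst summable_on_reindex) (auto simp: o_def inj_on_def)
  moreover have "(UNIV :: int set) = range int \<union> range (\<lambda>n. - int n)"
  proof safe
    fix n :: int assume n: "n \<notin> range (\<lambda>n. - int n)"
    have "n \<ge> 0"
    proof (rule ccontr)
      assume "\<not> n \<ge> 0"
      hence "n = - int (nat (- n))" by simp
      thus False using n by blast
    qed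
    hence "n = int (nat n)" by simp
    thus "n \<in> range int" by (rule range_eqI)
  qed auto
  ultimately show ?thesis by (metis summable_on_union)
qed

text \<open>
The general term of the L-series of the Hecke character \<open>z \<mapsto> (z / cnj z)^k\<close>. It is defined and
multiplicative on all complex numbers, with value 0 at 0 because \<open>0 powr x = 0\<close>.
\<close>

definition hecke_term :: "nat \<Rightarrow> real \<Rightarrow> complex \<Rightarrow> complex" where
  "hecke_term k s z = (z / cnj z) ^ k * of_real (cmod z powr (-2 * s))"

lemma hecke_term_0 [simp]: "hecke_term k s 0 = 0"
  by (simp add: hecke_term_def)

lemma hecke_term_mult: "hecke_term k s (z * w) = hecke_term k s z * hecke_term k s w"
  by (simp add: hecke_term_def power_mult_distrib norm_mult powr_mult mult_ac power_divide)

lemma norm_hecke_term: "norm (hecke_term k s z) = cmod z powr (-2 * s)"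
  by (cases "z = 0") (simp_all add: hecke_term_def norm_mult norm_power norm_div_cnj)

text \<open>
The term is homogeneous of degree \<open>-2 s\<close>, so its gradient has degree \<open>-2 s - 1\<close>. The constant is
uniform for \<open>1 \<le> s \<le> 2\<close>.
\<close>

lemma hecke_term_sub_bound:
  assumes "z \<noteq> 0" "norm (w - z) \<le> norm z / 2" "1 \<le> s" "s \<le> 2"
  shows "norm (hecke_term k s w - hecke_term k s z) \<le> (128 * real k + 128) * norm (w - z) * norm z powr (-2 * s - 1)"
proof -
  have zw: "norm z / 2 \<le> norm w" "norm w \<le> 2 * norm z"
    using assms(2) norm_triangle_sub[of z w] norm_triangle_sub[of w z] by (auto simp: norm_minus_commute)
  have w0: "w \<noteq> 0" "norm z > 0" using zw assms(1) by auto
  have "hecke_term k s w - hecke_term k s z = ((w / cnj w) ^ k - (z / cnj z) ^ k) * of_real (cmod w powr (-2 * s))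
       + (z / cnj z) ^ k * of_real (cmod w powr (-2 * s) - cmod z powr (-2 * s))"
    by (simp add: hecke_term_def algebra_simps)
  hence "norm (hecke_term k s w - hecke_term k s z) \<le> norm ((w / cnj w) ^ k - (z / cnj z) ^ k) * cmod w powr (-2 * s)
       + 1 * \<bar>cmod w powr (-2 * s) - cmod z powr (-2 * s)\<bar>"
    using norm_triangle_ineq[of "((w / cnj w) ^ k - (z / cnj z) ^ k) * of_real (cmod w powr (-2 * s))"
        "(z / cnj z) ^ k * of_real (cmod w powr (-2 * s) - cmod z powr (-2 * s))"] assms(1)
    by (simp add: norm_mult norm_power norm_div_cnj del: of_real_diff)
  also have "norm ((w / cnj w) ^ k - (z / cnj z) ^ k) * cmod w powr (-2 * s)
     \<le> (real k * (2 * norm (w - z) / norm w)) * cmod w powr (-2 * s)"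
  proof (intro mult_right_mono)
    have "norm ((w / cnj w) ^ k - (z / cnj z) ^ k) \<le> real k * norm (w / cnj w - z / cnj z)"
      by (rule norm_power_diff) (use assms w0 norm_div_cnj in auto)
    also have "\<dots> \<le> real k * (2 * norm (w - z) / norm w)"
      by (intro mult_left_mono div_cnj_sub_bound assms w0) auto
    finally show "norm ((w / cnj w) ^ k - (z / cnj z) ^ k) \<le> real k * (2 * norm (w - z) / norm w)" .
  qed simp
  also have "\<dots> = (2 * real k * norm (w - z)) * cmod w powr (-2 * s - 1)"
    using w0 by (simp add: powr_diff field_simps)
  also have "\<dots> \<le> (2 * real k * norm (w - z)) * (cmod z / 2) powr (-2 * s - 1)"
    using zw w0 assms by (intro mult_left_mono powr_mono2') auto
  also have "(cmod z / 2) powr (-2 * s - 1) = 2 powr (2 * s + 1) * cmod z powr (-2 * s - 1)"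
    using assms by (simp add: powr_divide powr_minus divide_simps powr_add[symmetric])
  also have "(2 * real k * norm (w - z)) * (2 powr (2 * s + 1) * cmod z powr (-2 * s - 1))
    \<le> (2 * real k * norm (w - z)) * (2 powr 5 * cmod z powr (-2 * s - 1))"
    using assms by (intro mult_left_mono mult_right_mono powr_mono) auto
  also have "\<dots> = (64 * real k) * norm (w - z) * cmod z powr (-2 * s - 1)" by simp
  also have "1 * \<bar>cmod w powr (-2 * s) - cmod z powr (-2 * s)\<bar>
     \<le> 128 * cmod z powr (-2 * s - 1) * \<bar>cmod w - cmod z\<bar>"
    using powr_neg_sub_bound[of "cmod z" "cmod w" s] zw w0 assms by simp
  also have "\<dots> \<le> 128 * cmod z powr (-2 * s - 1) * norm (w - z)"
    by (intro mult_left_mono norm_triangle_ineq3) auto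
  finally have "norm (hecke_term k s w - hecke_term k s z) \<le> (64 * real k) * norm (w - z) * cmod z powr (-2 * s - 1)
     + 128 * cmod z powr (-2 * s - 1) * norm (w - z)" by simp
  also have "\<dots> = (64 * real k + 128) * (norm (w - z) * cmod z powr (-2 * s - 1))"
    by (simp add: algebra_simps)
  also have "\<dots> \<le> (128 * real k + 128) * (norm (w - z) * cmod z powr (-2 * s - 1))"
    by (intro mult_right_mono) auto
  finally show ?thesis by (simp add: mult.assoc)
qed

text \<open>
Compare the sum with the integral of \<open>u powr (-x)\<close>; each term is bounded below by the mean value theorem.
\<close>

lemma zeta_lower:
  fixes x :: real
  assumes "x > 1"
  shows "(\<Sum>n. real (Suc n) powr (-x)) \<ge> 1 / (x - 1)" "summable (\<lambda>n. real (Suc n) powr (-x))"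
proof -
  have "summable (\<lambda>n. real n powr (-x))" using assms by (simp add: summable_real_powr_iff)
  thus S: "summable (\<lambda>n. real (Suc n) powr (-x))" by (subst summable_Suc_iff)
  have step: "real (Suc n) powr (-x) \<ge> (real (Suc n) powr (1 - x) - real (Suc (Suc n)) powr (1 - x)) / (x - 1)" for n
  proof -
    have deriv: "((\<lambda>z. z powr (1 - x)) has_real_derivative (1 - x) * z powr (1 - x - 1)) (at z)"
      if "real (Suc n) \<le> z" for z
      by (rule has_real_derivative_powr) (use that in linarith)
    have "\<exists>z. real (Suc n) < z \<and> z < real (Suc (Suc n)) \<and> real (Suc (Suc n)) powr (1 - x) - real (Suc n) powr (1 - x)
       = (real (Suc (Suc n)) - real (Suc n)) * ((1 - x) * z powr (1 - x - 1))"
      by (rule MVT2) (use deriv in auto)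
    then obtain z where z: "real (Suc n) < z" "real (Suc (Suc n)) powr (1 - x) - real (Suc n) powr (1 - x)
       = (1 - x) * z powr (-x)" by auto
    have "(real (Suc n) powr (1 - x) - real (Suc (Suc n)) powr (1 - x)) / (x - 1) = z powr (-x)"
      using z(2) assms by (simp add: field_simps)
    also have "\<dots> \<le> real (Suc n) powr (-x)" using z(1) assms by (intro powr_mono2') auto
    finally show ?thesis .
  qed
  have "(\<lambda>n. real (Suc n) powr (1 - x)) \<longlonglongrightarrow> 0"
    using assms by real_asymp
  hence "(\<lambda>n. real (Suc n) powr (1 - x) - real (Suc (Suc n)) powr (1 - x)) sums (real (Suc 0) powr (1 - x) - 0)"
    by (rule telescope_sums')
  hence T: "(\<lambda>n. (real (Suc n) powr (1 - x) - real (Suc (Suc n)) powr (1 - x)) / (x - 1)) sums (1 / (x - 1))"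
    using sums_divide by fastforce
  show "(\<Sum>n. real (Suc n) powr (-x)) \<ge> 1 / (x - 1)"
    using suminf_le[OF step sums_summable[OF T] S] sums_unique[OF T] by simp
qed

context heegner_order begin

definition lattice_ball :: "real \<Rightarrow> complex set" where
  "lattice_ball R = {\<alpha>\<in>OK. cmod \<alpha> \<le> R}"

lemma lattice_ball_subset: "lattice_ball R \<subseteq> (\<lambda>(a, b). el a b) ` ({-\<lfloor>2*R\<rfloor>..\<lfloor>2*R\<rfloor>} \<times> {-\<lfloor>2*R\<rfloor>..\<lfloor>2*R\<rfloor>})"
proof
  fix \<alpha> assume \<alpha>: "\<alpha> \<in> lattice_ball R"
  then obtain a b where ab: "\<alpha> = el a b" by (auto simp: lattice_ball_def elim: OK_cases)
  have R: "cmod \<alpha> \<le> R" using \<alpha> by (simp add: lattice_ball_def)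
  hence R0: "0 \<le> R" by (meson norm_ge_zero order_trans)
  have "real_of_int (q a b) \<le> R\<^sup>2" unfolding cmod_el[symmetric] ab[symmetric] using R by (intro power_mono) auto
  moreover have "real_of_int (a\<^sup>2 + b\<^sup>2) \<le> real_of_int (2 * q a b)" unfolding of_int_le_iff by (rule q_ge)
  ultimately have le: "(real_of_int a)\<^sup>2 + (real_of_int b)\<^sup>2 \<le> 2 * R\<^sup>2" by simp
  moreover have "0 \<le> (real_of_int a)\<^sup>2" "0 \<le> (real_of_int b)\<^sup>2" "0 \<le> R\<^sup>2"
    "(2 * R)\<^sup>2 = 4 * R\<^sup>2" by simp_all
  ultimately have "(real_of_int a)\<^sup>2 \<le> (2 * R)\<^sup>2" "(real_of_int b)\<^sup>2 \<le> (2 * R)\<^sup>2" by linarith+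
  hence "\<bar>real_of_int a\<bar> \<le> 2 * R" "\<bar>real_of_int b\<bar> \<le> 2 * R" using abs_le_square_iff[of _ "2 * R"] R0 by auto
  hence "\<bar>a\<bar> \<le> \<lfloor>2 * R\<rfloor>" "\<bar>b\<bar> \<le> \<lfloor>2 * R\<rfloor>" by (simp_all add: le_floor_iff)
  thus "\<alpha> \<in> (\<lambda>(a, b). el a b) ` ({-\<lfloor>2*R\<rfloor>..\<lfloor>2*R\<rfloor>} \<times> {-\<lfloor>2*R\<rfloor>..\<lfloor>2*R\<rfloor>})"
    unfolding ab by (auto intro!: image_eqI[of _ _ "(a, b)"])
qed

lemma finite_lattice_ball [simp, intro]: "finite (lattice_ball R)"
  by (rule finite_subset[OF lattice_ball_subset]) auto

lemma card_lattice_ball: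
  assumes "R \<ge> 0"
  shows "real (card (lattice_ball R)) \<le> (4 * R + 1)\<^sup>2"
proof -
  have "card (lattice_ball R) \<le> card ((\<lambda>(a, b). el a b) ` ({-\<lfloor>2*R\<rfloor>..\<lfloor>2*R\<rfloor>} \<times> {-\<lfloor>2*R\<rfloor>..\<lfloor>2*R\<rfloor>}))"
    by (rule card_mono[OF _ lattice_ball_subset]) auto
  also have "\<dots> \<le> card ({-\<lfloor>2*R\<rfloor>..\<lfloor>2*R\<rfloor>} \<times> {-\<lfloor>2*R\<rfloor>..\<lfloor>2*R\<rfloor>})"
    by (rule card_image_le) auto
  also have "\<dots> = (nat (2 * \<lfloor>2*R\<rfloor> + 1))\<^sup>2" by (simp add: card_cartesian_product power2_eq_square)
  finally have "real (card (lattice_ball R)) \<le> real ((nat (2 * \<lfloor>2*R\<rfloor> + 1))\<^sup>2)" by (rule of_nat_mono)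
  also have "\<dots> = (2 * real_of_int \<lfloor>2*R\<rfloor> + 1)\<^sup>2" using assms by simp
  also have "\<dots> \<le> (4 * R + 1)\<^sup>2"
  proof (rule power_mono)
    have "0 \<le> \<lfloor>2*R\<rfloor>" using assms by simp
    thus "0 \<le> 2 * real_of_int \<lfloor>2*R\<rfloor> + 1" by simp
    have "real_of_int \<lfloor>2*R\<rfloor> \<le> 2 * R" by simp
    thus "2 * real_of_int \<lfloor>2*R\<rfloor> + 1 \<le> 4 * R + 1" by simp
  qed
  finally show ?thesis .
qed

lemma cmod_ge_1: "\<alpha> \<in> OK \<Longrightarrow> \<alpha> \<noteq> 0 \<Longrightarrow> cmod \<alpha> \<ge> 1"
proof -
  assume a: "\<alpha> \<in> OK" "\<alpha> \<noteq> 0"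
  hence "nrm \<alpha> \<ge> 1" using nrm_eq_0_iff[of \<alpha>] by linarith
  hence "1\<^sup>2 \<le> (cmod \<alpha>)\<^sup>2" using real_nrm[OF a(1)] by simp
  thus ?thesis by (rule power2_le_imp_le) simp
qed

text \<open>
The norm form dominates \<open>(1 + \<bar>a\<bar>) (1 + \<bar>b\<bar>) / 9\<close> away from the origin, so the double series is
dominated by a product of two convergent series.
\<close>

lemma summable_cmod_powr:
  assumes "s > 1"
  shows "(\<lambda>\<alpha>. cmod \<alpha> powr (-2 * s)) summable_on OK"
proof -
  define g where "g n = (1 + \<bar>real_of_int n\<bar>) powr (-s)" for n :: int
  have g: "g summable_on UNIV" unfolding g_def by (rule int_powr_summable[OF assms])
  have "(\<lambda>(a, b). g a * g b) summable_on UNIV \<times> UNIV"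
  proof -
    have n: "norm (g a * g b) = g a * g b" for a b by (simp add: g_def)
    have g0: "g a \<ge> 0" for a by (simp add: g_def)
    have "(\<lambda>x. norm (g (fst x) * g (snd x))) summable_on UNIV \<times> UNIV"
      using g g0 infsum_nonneg[of UNIV g]
      by (subst Infinite_Sum.abs_summable_on_Sigma_iff[where f = "\<lambda>x. g (fst x) * g (snd x)"])
        (auto simp: n infsum_cmult_right' abs_mult intro!: summable_on_cmult_right summable_on_cmult_left)
    thus ?thesis using g0 by (simp add: abs_mult case_prod_unfold)
  qed
  hence "(\<lambda>(a, b). 9 powr s * (g a * g b)) summable_on UNIV \<times> UNIV"
    by (simp add: case_prod_unfold summable_on_cmult_right)
  hence "(\<lambda>x. cmod (case x of (a, b) \<Rightarrow> el a b) powr (-2 * s)) summable_on UNIV \<times> UNIV"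
  proof (rule summable_on_comparison_test, safe)
    fix a b :: int
    show "cmod (el a b) powr (-2 * s) \<le> 9 powr s * (g a * g b)"
    proof (cases "a = 0 \<and> b = 0")
      case True thus ?thesis by (simp add: el_def g_def)
    next
      case False
      define A where "A = \<bar>real_of_int a\<bar>"
      define B where "B = \<bar>real_of_int b\<bar>"
      have AB: "A \<ge> 0" "B \<ge> 0" "A + B \<ge> 1" using False unfolding A_def B_def by auto
      have 1: "1 * (A + B) \<le> (A + B) * (A + B)" using AB by (intro mult_right_mono) auto
      have 2: "1 \<le> (A + B) * (A + B)" using order_trans[OF AB(3), of "(A + B) * (A + B)"] 1 by simp
      have "0 \<le> (A - B)\<^sup>2" by simp
      with 1 2 have "(1 + A) * (1 + B) / 9 \<le> (A\<^sup>2 + B\<^sup>2) / 2"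
        by (simp add: power2_eq_square algebra_simps)
      also have "A\<^sup>2 + B\<^sup>2 = real_of_int (a\<^sup>2 + b\<^sup>2)" by (simp add: A_def B_def)
      also have "\<dots> \<le> real_of_int (2 * q a b)" unfolding of_int_le_iff by (rule q_ge)
      also have "\<dots> = 2 * (cmod (el a b))\<^sup>2" by (simp add: cmod_el)
      finally have le: "(1 + A) * (1 + B) / 9 \<le> (cmod (el a b))\<^sup>2" by simp
      have pos: "0 < (1 + A) * (1 + B) / 9" using AB by (intro divide_pos_pos mult_pos_pos) auto
      have "cmod (el a b) powr (-2 * s) = ((cmod (el a b))\<^sup>2) powr (-s)"
        using powr_powr[of "cmod (el a b)" 2 "-s"] by simp
      also have "\<dots> \<le> ((1 + A) * (1 + B) / 9) powr (-s)"
        using le pos assms by (intro powr_mono2') auto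
      also have "\<dots> = 9 powr s * (g a * g b)"
        using AB by (simp add: powr_divide powr_mult g_def A_def[symmetric] B_def[symmetric] powr_minus divide_simps)
      finally show ?thesis .
    qed
  qed auto
  moreover have "bij_betw (\<lambda>(a, b). el a b) (UNIV \<times> UNIV) OK"
    unfolding bij_betw_def inj_on_def OK_def by (auto simp: el_inj)
  ultimately show ?thesis
    using summable_on_reindex_bij_betw[of "\<lambda>(a, b). el a b" "UNIV \<times> UNIV" OK "\<lambda>\<alpha>. cmod \<alpha> powr (-2 * s)"] by simp
qed

lemma hecke_term_abs_summable: "s > 1 \<Longrightarrow> (\<lambda>\<alpha>. norm (hecke_term k s \<alpha>)) summable_on OK"
  using summable_cmod_powr[of s] by (simp add: norm_hecke_term)

lemma hecke_term_abs_summable_subset: "s > 1 \<Longrightarrow> A \<subseteq> OK \<Longrightarrow> (\<lambda>\<alpha>. norm (hecke_term k s \<alpha>)) summable_on A"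
  by (rule summable_on_subset[OF hecke_term_abs_summable])

lemma hecke_term_summable: "s > 1 \<Longrightarrow> A \<subseteq> OK \<Longrightarrow> hecke_term k s summable_on A"
  by (rule abs_summable_summable[OF hecke_term_abs_summable_subset])

lemma coset_bij:
  assumes "\<pi> \<in> OK" "nrm \<pi> = p" "prime p"
  shows "bij_betw (\<lambda>(r, \<beta>). \<pi> * \<beta> + of_nat r) ({..<p} \<times> OK) OK"
  unfolding bij_betw_def
proof
  have \<pi>0: "\<pi> \<noteq> 0" using assms by auto
  show "inj_on (\<lambda>(r, \<beta>). \<pi> * \<beta> + of_nat r) ({..<p} \<times> OK)"
  proof (rule inj_onI)
    fix x y assume xy: "x \<in> {..<p} \<times> OK" "y \<in> {..<p} \<times> OK"
      "(case x of (r, \<beta>) \<Rightarrow> \<pi> * \<beta> + of_nat r) = (case y of (r, \<beta>) \<Rightarrow> \<pi> * \<beta> + of_nat r)"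
    obtain r \<beta> r' \<beta>' where xy': "x = (r, \<beta>)" "y = (r', \<beta>')" by (cases x, cases y)
    have r: "r \<in> {..<p}" "r' \<in> {..<p}" and b: "\<beta> \<in> OK" "\<beta>' \<in> OK"
      and eq: "\<pi> * \<beta> + of_nat r = \<pi> * \<beta>' + of_nat r'"
      using xy xy' by auto
    have d: "dv \<pi> (\<pi> * \<beta>)" "dv \<pi> (\<pi> * \<beta>')" using b by (auto intro: dv_triv)
    have "\<pi> * \<beta> + of_nat r \<in> OK" using assms b by auto
    from residue_unique[OF assms this] have "r = r'"
      using r d eq by (metis add_diff_cancel_right' lessThan_iff)
    thus "x = y" using eq \<pi>0 xy' by simp
  qed
  show "(\<lambda>(r, \<beta>). \<pi> * \<beta> + of_nat r) ` ({..<p} \<times> OK) = OK"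
  proof
    show "(\<lambda>(r, \<beta>). \<pi> * \<beta> + of_nat r) ` ({..<p} \<times> OK) \<subseteq> OK" using assms by auto
    show "OK \<subseteq> (\<lambda>(r, \<beta>). \<pi> * \<beta> + of_nat r) ` ({..<p} \<times> OK)"
    proof
      fix \<alpha> assume "\<alpha> \<in> OK"
      from residue_unique[OF assms this] obtain r where r: "r < p" "dv \<pi> (\<alpha> - of_nat r)" by blast
      then obtain \<beta> where "\<beta> \<in> OK" "\<alpha> - of_nat r = \<pi> * \<beta>" unfolding dv_def by blast
      thus "\<alpha> \<in> (\<lambda>(r, \<beta>). \<pi> * \<beta> + of_nat r) ` ({..<p} \<times> OK)"
        using r by (intro image_eqI[of _ _ "(r, \<beta>)"]) (auto simp: algebra_simps)
    qed
  qed
qed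

text \<open>
The integers \<open>0, ..., p - 1\<close> represent the cosets of \<open>\<pi> O\<close>. Comparing the cosets with one another is
the equidistribution input of the whole proof.
\<close>

lemma infsum_cosets:
  fixes g :: "complex \<Rightarrow> 'b :: {banach, second_countable_topology}"
  assumes "\<pi> \<in> OK" "nrm \<pi> = p" "prime p" "(\<lambda>\<alpha>. norm (g \<alpha>)) summable_on OK"
  shows "infsum g OK = (\<Sum>r<p. infsum (\<lambda>\<beta>. g (\<pi> * \<beta> + of_nat r)) OK)"
    and "r < p \<Longrightarrow> (\<lambda>\<beta>. norm (g (\<pi> * \<beta> + of_nat r))) summable_on OK"
proof -
  note bij = coset_bij[OF assms(1-3)]
  have S: "(\<lambda>(r, \<beta>). norm (g (\<pi> * \<beta> + of_nat r))) summable_on ({..<p} \<times> OK)"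
    using assms(4) summable_on_reindex_bij_betw[OF bij, of "\<lambda>\<alpha>. norm (g \<alpha>)"] by (simp add: case_prod_unfold)
  hence S': "(\<lambda>(r, \<beta>). g (\<pi> * \<beta> + of_nat r)) summable_on ({..<p} \<times> OK)"
    by (intro abs_summable_summable[where f = "\<lambda>(r, \<beta>). g (\<pi> * \<beta> + of_nat r)"])
      (simp only: case_prod_unfold)
  have "infsum g OK = infsum (\<lambda>(r, \<beta>). g (\<pi> * \<beta> + of_nat r)) ({..<p} \<times> OK)"
    using infsum_reindex_bij_betw[OF bij, of g] by (simp add: case_prod_unfold)
  also have "\<dots> = (\<Sum>\<^sub>\<infinity>r\<in>{..<p}. infsum (\<lambda>\<beta>. g (\<pi> * \<beta> + of_nat r)) OK)"
    using infsum_Sigma'_banach[OF S'] by simp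
  finally show "infsum g OK = (\<Sum>r<p. infsum (\<lambda>\<beta>. g (\<pi> * \<beta> + of_nat r)) OK)" by simp
  show "(\<lambda>\<beta>. norm (g (\<pi> * \<beta> + of_nat r))) summable_on OK" if "r < p"
    using summable_on_SigmaD1[OF S] that by simp
qed

end

section \<open>Hecke L-series at real points and their finite Euler products\<close>

text \<open>
From \<open>\<bar>1 - z\<bar>^2 = 1 - 2 Re z + \<bar>z\<bar>^2\<close> and \<open>1 + x \<le> exp x\<close>.
\<close>

lemma norm_one_minus_le: "norm (1 - z) \<le> exp (- Re z + (norm z)\<^sup>2 / 2)" for z :: complex
proof -
  have "(norm (1 - z))\<^sup>2 = 1 + (- 2 * Re z + (norm z)\<^sup>2)"
    unfolding cmod_power2 by (simp add: power2_eq_square algebra_simps)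
  also have "\<dots> \<le> exp (- 2 * Re z + (norm z)\<^sup>2)" by (rule exp_ge_add_one_self)
  also have "\<dots> = (exp (- Re z + (norm z)\<^sup>2 / 2))\<^sup>2"
    by (simp add: exp_double[symmetric])
  finally show ?thesis by (rule power2_le_imp_le) simp
qed

lemma infsum_diff':
  fixes f g :: "'a \<Rightarrow> 'b :: banach"
  assumes "f summable_on A" "g summable_on A"
  shows "infsum (\<lambda>x. f x - g x) A = infsum f A - infsum g A" "(\<lambda>x. f x - g x) summable_on A"
  using infsum_add[OF assms(1), of "\<lambda>x. - g x"] summable_on_add[OF assms(1), of "\<lambda>x. - g x"] assms(2)
  by (simp_all add: infsum_uminus summable_on_uminus)

context heegner_order begin

lemma el_eq_0_iff: "el a b = 0 \<longleftrightarrow> a = 0 \<and> b = 0"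
proof -
  have "el 0 0 = 0" by (simp add: el_def)
  thus ?thesis using el_inj[of a b 0 0] by simp
qed

text \<open>
If \<open>\<pi>\<close> divided its conjugate, it would divide the trace, so it is enough to exhibit an element whose norm
is a prime that does not divide its trace.
\<close>

lemma exists_split_prime: "\<exists>\<pi>\<in>OK. prime (nrm \<pi>) \<and> \<not> dv \<pi> (cnj \<pi>)"
proof -
  (* The norm and the trace of a + b lambda are q a b and 2 a + t b. *)
  have *: ?thesis if "prime p" "q a b = int p" "\<not> int p dvd 2 * a + t * b" for a b p
  proof (intro bexI conjI notI)
    have n: "nrm (el a b) = p" using nrm_el[of a b] that by simp
    thus "prime (nrm (el a b))" using that by simp
    assume "dv (el a b) (cnj (el a b))"
    hence "dv (el a b) (cnj (el a b) + el a b)" by (intro dv_add) auto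
    also have "cnj (el a b) + el a b = of_int (2 * a + t * b)"
      unfolding el_cnj el_add of_int_eq_el by simp
    finally show False unfolding dv_of_int_iff[OF OK_el n that(1)] using that(3) by simp
  qed simp
  have "prime (5::nat)" "prime (3::nat)" "prime (7::nat)" "prime (2::nat)" "prime (11::nat)" "prime (17::nat)" "prime (41::nat)"
    by (simp_all add: prime_nat_numeral_eq)
  thus ?thesis using tm *[of 5 2 1] *[of 3 1 1] *[of 7 2 1] *[of 2 0 1] *[of 3 0 1] *[of 5 0 1]
      *[of 11 0 1] *[of 17 0 1] *[of 41 0 1]
    by (auto simp: q_def)
qed

text \<open>
If \<open>\<pi>^k = (cnj \<pi>)^k\<close>, then the prime \<open>\<pi>\<close> divides its conjugate.
\<close>

lemma exists_nontrivial_angle: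
  assumes "k > 0"
  shows "\<exists>\<pi>\<in>OK. prime (nrm \<pi>) \<and> (\<pi> / cnj \<pi>) ^ k \<noteq> 1"
proof -
  obtain \<pi> where \<pi>: "\<pi> \<in> OK" "prime (nrm \<pi>)" "\<not> dv \<pi> (cnj \<pi>)" using exists_split_prime by blast
  have \<pi>0: "\<pi> \<noteq> 0" using \<pi>(2) by auto
  have "(\<pi> / cnj \<pi>) ^ k \<noteq> 1"
  proof
    assume "(\<pi> / cnj \<pi>) ^ k = 1"
    hence eq: "\<pi> ^ k = cnj \<pi> ^ k" using \<pi>0 by (simp add: power_divide)
    have ok: "cnj \<pi> ^ n \<in> OK" "\<pi> ^ n \<in> OK" for n using \<pi>(1) by (induction n) auto
    have "dv \<pi> (\<pi> ^ k)" using assms dv_triv[OF ok(2), of \<pi> "k - 1"] by (cases k) auto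
    hence "dv \<pi> (cnj \<pi> ^ k)" using eq by simp
    hence "dv \<pi> (cnj \<pi>)" using assms
    proof (induction k)
      case (Suc k)
      show ?case
      proof (cases "dv \<pi> (cnj \<pi>)")
        case False
        hence d: "dv \<pi> (cnj \<pi> ^ k)"
          using prime_norm_prime_elem[OF \<pi>(1) refl \<pi>(2) _ ok(1)[of k], of "cnj \<pi>"] Suc.prems \<pi>(1) by auto
        have "k \<noteq> 0"
        proof
          assume "k = 0"
          hence "dv \<pi> 1" using d by simp
          thus False using dv_nrm[of \<pi> 1] \<pi> by auto
        qed
        thus ?thesis using Suc.IH[OF d] by simp
      qed
    qed simp
    thus False using \<pi>(3) by simp
  qed
  thus ?thesis using \<pi> by blast
qed

lemma cmod_powr_le_1: "\<alpha> \<in> OK \<Longrightarrow> s \<ge> 0 \<Longrightarrow> cmod \<alpha> powr (- 2 * s) \<le> 1"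
  using cmod_ge_1[of \<alpha>] powr_mono[of "- 2 * s" 0 "cmod \<alpha>"] by (cases "\<alpha> = 0") auto

text \<open>
The character has mean zero because it is not invariant under multiplication by \<open>\<pi>\<close>. Let \<open>D\<close> be the
sum and \<open>\<psi> = (\<pi> / cnj \<pi>)^k\<close>. Splitting \<open>O\<close> into the \<open>p\<close> cosets of \<open>\<pi> O\<close> and moving each
coset to \<open>\<pi> O\<close> itself changes the sum by a bounded amount, while \<open>\<pi> O\<close> contributes
\<open>\<psi> p^(-s) D\<close>. Hence \<open>(1 - \<psi> p^(1-s)) D\<close> is bounded, and the factor tends to \<open>1 - \<psi> \<noteq> 0\<close>.
\<close>

lemma hecke_term_sum_bounded:
  assumes \<pi>: "\<pi> \<in> OK" "prime (nrm \<pi>)" and ne: "(\<pi> / cnj \<pi>) ^ k \<noteq> 1"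
  shows "\<exists>C. \<forall>\<^sub>F s in at_right 1. norm (infsum (hecke_term k s) OK) \<le> C"
proof -
  define p where "p = nrm \<pi>"
  have p: "prime p" "p > 0" using \<pi>(2) prime_gt_0_nat by (auto simp: p_def)
  have \<pi>0: "\<pi> \<noteq> 0" using \<pi>(2) by auto
  have \<pi>1: "cmod \<pi> \<ge> 1" by (rule cmod_ge_1[OF \<pi>(1) \<pi>0])
  define M where "M = (128 * real k + 128) * real p"
  define F where "F = lattice_ball (2 * real p)"
  (* A summable majorant, the same for all s, of the change of one term when a coset
     is moved onto the ideal: the derivative bound far out, the trivial bound 2 near 0. *)
  define e where "e \<beta> = M * cmod \<beta> powr (-2 * (3/2)) + (if \<beta> \<in> F then 2 else 0)" for \<beta>
  have M0: "M \<ge> 0" by (simp add: M_def)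
  have e: "e summable_on OK"
    unfolding e_def 
  proof (intro summable_on_add summable_on_cmult_right summable_cmod_powr)
    have "(\<lambda>\<beta>::complex. if \<beta> \<in> F then 2 else 0 :: real) summable_on F \<longleftrightarrow> (\<lambda>\<beta>::complex. if \<beta> \<in> F then 2 else 0 :: real) summable_on OK"
      by (rule summable_on_cong_neutral) (auto simp: F_def lattice_ball_def)
    thus "(\<lambda>\<beta>::complex. if \<beta> \<in> F then 2 else 0 :: real) summable_on OK" by (simp add: F_def)
  qed simp
  define B where "B = infsum e OK"
  have key: "norm (1 - of_nat p * hecke_term k s \<pi>) * norm (infsum (hecke_term k s) OK) \<le> real p * B" if s: "1 < s" "s \<le> 2" for s
  proof -
    let ?D = "infsum (hecke_term k s) OK"
    have one: "norm (infsum (\<lambda>\<beta>. hecke_term k s (\<pi> * \<beta> + of_nat r)) OK - hecke_term k s \<pi> * ?D) \<le> B" if r: "r < p" for r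
    proof -
      have S1: "(\<lambda>\<beta>. hecke_term k s (\<pi> * \<beta> + of_nat r)) summable_on OK"
        by (rule abs_summable_summable[OF infsum_cosets(2)[OF \<pi>(1) p_def[symmetric] p(1) hecke_term_abs_summable[OF s(1)] r]])
      have S2: "(\<lambda>\<beta>. hecke_term k s \<pi> * hecke_term k s \<beta>) summable_on OK"
        using hecke_term_summable[OF s(1)] by (intro summable_on_cmult_right) auto
      have "infsum (\<lambda>\<beta>. hecke_term k s (\<pi> * \<beta> + of_nat r)) OK - hecke_term k s \<pi> * ?D
         = infsum (\<lambda>\<beta>. hecke_term k s (\<pi> * \<beta> + of_nat r) - hecke_term k s \<pi> * hecke_term k s \<beta>) OK"
        by (subst infsum_diff'[OF S1 S2]) (simp add: infsum_cmult_right')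
      also have "norm \<dots> \<le> infsum e OK"
      proof (rule norm_infsum_le)
        fix \<beta> assume \<beta>: "\<beta> \<in> OK"
        show "norm (hecke_term k s (\<pi> * \<beta> + of_nat r) - hecke_term k s \<pi> * hecke_term k s \<beta>) \<le> e \<beta>"
        proof (cases "\<beta> \<in> F")
          case True
          have "norm (hecke_term k s (\<pi> * \<beta> + of_nat r)) \<le> 1" "norm (hecke_term k s (\<pi> * \<beta>)) \<le> 1"
            unfolding norm_hecke_term using \<beta> \<pi>(1) s by (intro cmod_powr_le_1 OK_add OK_mult OK_of_nat; simp)+
          hence "norm (hecke_term k s (\<pi> * \<beta> + of_nat r) - hecke_term k s \<pi> * hecke_term k s \<beta>) \<le> 2"
            unfolding hecke_term_mult[symmetric] by (intro norm_triangle_le_diff) linarith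
          thus ?thesis using True M0 by (simp add: e_def add_increasing)
        next
          case False
          hence b: "cmod \<beta> > 2 * real p" using \<beta> by (auto simp: F_def lattice_ball_def)
          have pb: "cmod (\<pi> * \<beta>) \<ge> cmod \<beta>" using mult_right_mono[OF \<pi>1, of "cmod \<beta>"] by (simp add: norm_mult)
          have b0: "cmod \<beta> \<ge> 1" using b p by linarith
          have "norm (hecke_term k s (\<pi> * \<beta> + of_nat r) - hecke_term k s (\<pi> * \<beta>)) 
            \<le> (128 * real k + 128) * norm (\<pi> * \<beta> + of_nat r - \<pi> * \<beta>) * norm (\<pi> * \<beta>) powr (-2 * s - 1)"
            using s b pb r b0 by (intro hecke_term_sub_bound) auto
          also have "\<dots> \<le> (128 * real k + 128) * real p * cmod \<beta> powr (-2 * (3/2))"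
          proof (intro mult_mono)
            have "norm (\<pi> * \<beta>) powr (-2 * s - 1) \<le> cmod \<beta> powr (-2 * s - 1)"
              using pb b0 s by (intro powr_mono2') auto
            also have "\<dots> \<le> cmod \<beta> powr (-2 * (3/2))" using b0 s by (intro powr_mono) auto
            finally show "norm (\<pi> * \<beta>) powr (-2 * s - 1) \<le> cmod \<beta> powr (-2 * (3/2))" .
          qed (use r in auto)
          finally show ?thesis using False by (simp add: e_def M_def hecke_term_mult)
        qed
      qed (use e infsum_diff'(2)[OF S1 S2] in auto)
      finally show ?thesis by (simp add: B_def)
    qed
    have "?D - of_nat p * hecke_term k s \<pi> * ?D = (\<Sum>r<p. infsum (\<lambda>\<beta>. hecke_term k s (\<pi> * \<beta> + of_nat r)) OK - hecke_term k s \<pi> * ?D)"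
      using infsum_cosets(1)[OF \<pi>(1) p_def[symmetric] p(1) hecke_term_abs_summable[OF s(1)], of k]
      by (simp add: sum_subtractf)
    also have "norm \<dots> \<le> (\<Sum>r<p. B)"
      by (rule sum_norm_le) (use one in auto)
    finally show ?thesis by (simp add: norm_mult[symmetric] algebra_simps)
  qed
  define \<psi> where "\<psi> = (\<pi> / cnj \<pi>) ^ k"
  have hsp: "of_nat p * hecke_term k s \<pi> = \<psi> * of_real (real p powr (1 - s))" for s
  proof -
    have "cmod \<pi> powr (-2 * s) = ((cmod \<pi>)\<^sup>2) powr (-s)"
      using powr_powr[of "cmod \<pi>" 2 "-s"] by simp
    also have "(cmod \<pi>)\<^sup>2 = real p" using real_nrm[OF \<pi>(1)] by (simp add: p_def)
    finally have "real p * cmod \<pi> powr (-2 * s) = real p powr (1 - s)"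
      using p by (simp add: powr_diff powr_minus field_simps)
    hence "complex_of_real (real p * cmod \<pi> powr (-2 * s)) = of_real (real p powr (1 - s))" by simp
    thus ?thesis by (simp add: hecke_term_def \<psi>_def mult_ac)
  qed
  have "((\<lambda>s. norm (1 - \<psi> * of_real (real p powr (1 - s)))) \<longlongrightarrow> norm (1 - \<psi> * of_real (real p powr (1 - 1)))) (at_right 1)"
    using p by (intro tendsto_intros) auto
  moreover have "norm (1 - \<psi>) / 2 < norm (1 - \<psi> * of_real (real p powr (1 - 1)))"
    using p ne by (simp add: \<psi>_def)
  ultimately have "\<forall>\<^sub>F s in at_right 1. norm (1 - \<psi>) / 2 < norm (1 - \<psi> * of_real (real p powr (1 - s)))"
    by (rule order_tendstoD(1))
  moreover have "\<forall>\<^sub>F s::real in at_right 1. s > 1 \<and> s \<le> 2"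
    using eventually_at_right_real[of 1 2] by (rule eventually_mono) auto
  ultimately have "\<forall>\<^sub>F s in at_right 1. norm (infsum (hecke_term k s) OK) \<le> real p * B / (norm (1 - \<psi>) / 2)"
  proof eventually_elim
    case (elim s)
    have "norm (1 - \<psi>) / 2 * norm (infsum (hecke_term k s) OK) \<le> norm (1 - of_nat p * hecke_term k s \<pi>) * norm (infsum (hecke_term k s) OK)"
      unfolding hsp using elim by (intro mult_right_mono) auto
    also have "\<dots> \<le> real p * B" using key elim by blast
    finally show ?case using ne by (simp add: \<psi>_def field_simps)
  qed
  thus ?thesis by blast
qed

text \<open>
Keep only the points \<open>a + b \<lambda>\<close> with \<open>1 \<le> b \<le> a\<close>, whose norm is at most \<open>50 a^2\<close>.
\<close>

lemma zeta_sum_lower: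
  assumes s: "1 < s" "s \<le> 2"
  shows "infsum (\<lambda>\<alpha>. cmod \<alpha> powr (-2 * s)) OK \<ge> 1 / (5000 * (s - 1))"
proof -
  let ?D = "infsum (\<lambda>\<alpha>. cmod \<alpha> powr (-2 * s)) OK"
  have partial: "(\<Sum>a<N. real (Suc a) powr (-(2 * s - 1))) \<le> 2500 * ?D" for N
  proof -
    define S where "S = Sigma {..<N} (\<lambda>a. {..a})"
    have inj: "inj_on (\<lambda>(a, b). el (int (Suc a)) (int (Suc b))) S"
      by (auto simp: inj_on_def el_inj)
    have "(\<Sum>a<N. real (Suc a) powr (-(2 * s - 1))) = (\<Sum>a<N. \<Sum>b\<le>a. real (Suc a) powr (-2 * s))"
      by (intro sum.cong refl) (simp add: powr_diff powr_minus field_simps)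
    also have "\<dots> = (\<Sum>(a, b)\<in>S. real (Suc a) powr (-2 * s))"
      unfolding S_def by (rule sum.Sigma) auto
    also have "\<dots> \<le> (\<Sum>(a, b)\<in>S. 2500 * cmod (el (int (Suc a)) (int (Suc b))) powr (-2 * s))"
    proof (intro sum_mono, clarify)
      fix a b assume "(a, b) \<in> S"
      hence "q (int (Suc a)) (int (Suc b)) \<le> 50 * (int (Suc a))\<^sup>2"
        by (intro q_le) (auto simp: S_def)
      hence "real_of_int (q (int (Suc a)) (int (Suc b))) \<le> real_of_int (50 * (int (Suc a))\<^sup>2)" unfolding of_int_le_iff .
      hence le: "(cmod (el (int (Suc a)) (int (Suc b))))\<^sup>2 \<le> 50 * (real (Suc a))\<^sup>2" unfolding cmod_el by simp
      have "el (int (Suc a)) (int (Suc b)) \<noteq> 0" unfolding el_eq_0_iff by simp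
      hence pos: "0 < (cmod (el (int (Suc a)) (int (Suc b))))\<^sup>2" by simp
      have "(50 * (real (Suc a))\<^sup>2) powr (-s) \<le> ((cmod (el (int (Suc a)) (int (Suc b))))\<^sup>2) powr (-s)"
        using le pos s by (intro powr_mono2') auto
      also have "\<dots> = cmod (el (int (Suc a)) (int (Suc b))) powr (-2 * s)"
        using powr_powr[of "cmod (el (int (Suc a)) (int (Suc b)))" 2 "-s"] by simp
      finally have 1: "(50 * (real (Suc a))\<^sup>2) powr (-s) \<le> cmod (el (int (Suc a)) (int (Suc b))) powr (-2 * s)" .
      have p2: "real (Suc a) powr (-2 * s) = (real (Suc a))\<^sup>2 powr (-s)"
        using powr_powr[of "real (Suc a)" 2 "-s"] by simp
      have c: "1 / 2500 = (50::real) powr (-2)" by (simp add: powr_minus)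
      have "(1 / 2500) * real (Suc a) powr (-2 * s) = 50 powr (-2) * (real (Suc a))\<^sup>2 powr (-s)"
        unfolding c p2 ..
      also have "\<dots> \<le> 50 powr (-s) * (real (Suc a))\<^sup>2 powr (-s)"
        using s by (intro mult_right_mono powr_mono) auto
      also have "\<dots> = (50 * (real (Suc a))\<^sup>2) powr (-s)"
        by (simp add: powr_mult)
      finally show "real (Suc a) powr (-2 * s) \<le> 2500 * cmod (el (int (Suc a)) (int (Suc b))) powr (-2 * s)"
        using 1 by simp
    qed
    also have "\<dots> = 2500 * (\<Sum>(a, b)\<in>S. cmod (el (int (Suc a)) (int (Suc b))) powr (-2 * s))"
      by (simp add: sum_distrib_left case_prod_unfold)
    also have "(\<Sum>(a, b)\<in>S. cmod (el (int (Suc a)) (int (Suc b))) powr (-2 * s))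
      = (\<Sum>\<alpha>\<in>(\<lambda>(a, b). el (int (Suc a)) (int (Suc b))) ` S. cmod \<alpha> powr (-2 * s))"
      by (subst sum.reindex[OF inj]) (simp add: case_prod_unfold)
    also have "\<dots> \<le> ?D"
      by (rule finite_sum_le_infsum[OF summable_cmod_powr[OF s(1)]]) (auto simp: S_def)
    finally show ?thesis by simp
  qed
  have x: "2 * s - 1 > 1" using s by simp
  have "1 / (2 * s - 1 - 1) \<le> (\<Sum>n. real (Suc n) powr (-(2 * s - 1)))" by (rule zeta_lower(1)[OF x])
  also have "\<dots> \<le> 2500 * ?D" by (rule suminf_le_const[OF zeta_lower(2)[OF x] partial])
  finally show ?thesis using s by (simp add: field_simps)
qed

text \<open>
The sieved ring elements that carry the finite Euler products: each further prime \<open>\<pi>\<close> removes a copy of the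
set scaled by \<open>\<pi>\<close>, which multiplies the sum by \<open>1 - hecke_term k s \<pi>\<close>.
\<close>

definition coprime_to :: "complex set \<Rightarrow> complex set" where
  "coprime_to Q = {\<alpha>\<in>OK. \<forall>\<pi>\<in>Q. \<not> dv \<pi> \<alpha>}"

definition units :: "complex set" where
  "units = {u\<in>OK. nrm u = 1}"

lemma finite_units [simp]: "finite units"
proof (rule finite_subset)
  show "units \<subseteq> lattice_ball 1"
  proof
    fix u assume "u \<in> units"
    hence "u \<in> OK" "(cmod u)\<^sup>2 = 1" using real_nrm[of u] by (auto simp: units_def)
    thus "u \<in> lattice_ball 1" by (simp add: lattice_ball_def abs_square_eq_1)
  qed
qed simp

lemma coprime_to_subset: "coprime_to Q \<subseteq> OK" by (auto simp: coprime_to_def)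

lemma coprime_to_insert:
  assumes "\<pi> \<in> prime_reps" "\<pi> \<notin> Q" "Q \<subseteq> prime_reps"
  shows "coprime_to Q = coprime_to (insert \<pi> Q) \<union> (*) \<pi> ` coprime_to Q"
    and "coprime_to (insert \<pi> Q) \<inter> (*) \<pi> ` coprime_to Q = {}"
proof -
  have \<pi>: "\<pi> \<in> OK" using prime_reps_OK assms by blast
  show "coprime_to Q = coprime_to (insert \<pi> Q) \<union> (*) \<pi> ` coprime_to Q"
  proof (intro subset_antisym subsetI)
    fix \<alpha> assume a: "\<alpha> \<in> coprime_to Q"
    show "\<alpha> \<in> coprime_to (insert \<pi> Q) \<union> (*) \<pi> ` coprime_to Q"
    proof (cases "dv \<pi> \<alpha>")
      case True
      then obtain \<beta> where b: "\<beta> \<in> OK" "\<alpha> = \<pi> * \<beta>" unfolding dv_def by blast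
      have "\<beta> \<in> coprime_to Q" using a b \<pi> dv_mult[of _ \<beta> \<pi>] by (auto simp: coprime_to_def mult.commute)
      thus ?thesis using b by blast
    qed (use a in \<open>auto simp: coprime_to_def\<close>)
  next
    fix \<alpha> assume "\<alpha> \<in> coprime_to (insert \<pi> Q) \<union> (*) \<pi> ` coprime_to Q"
    thus "\<alpha> \<in> coprime_to Q"
    proof
      assume "\<alpha> \<in> (*) \<pi> ` coprime_to Q"
      then obtain \<beta> where b: "\<beta> \<in> coprime_to Q" "\<alpha> = \<pi> * \<beta>" by blast
      have bO: "\<beta> \<in> OK" using b by (simp add: coprime_to_def)
      have "\<not> dv \<rho> \<alpha>" if r: "\<rho> \<in> Q" for \<rho>
      proof
        assume "dv \<rho> \<alpha>"
        hence "dv \<rho> \<pi> \<or> dv \<rho> \<beta>" using prime_reps_prime[of \<rho> \<pi> \<beta>] r assms \<pi> bO b(2) by auto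
        thus False using prime_reps_dv_eq[of \<rho> \<pi>] r assms b(1) by (auto simp: coprime_to_def)
      qed
      thus ?thesis using b(2) \<pi> bO by (auto simp: coprime_to_def)
    qed (auto simp: coprime_to_def)
  qed
  show "coprime_to (insert \<pi> Q) \<inter> (*) \<pi> ` coprime_to Q = {}"
    by (auto simp: coprime_to_def dv_def)
qed

lemma euler_product_finite:
  assumes s: "s > 1" and "finite Q" "Q \<subseteq> prime_reps"
  shows "infsum (hecke_term k s) (coprime_to Q) = (\<Prod>\<pi>\<in>Q. 1 - hecke_term k s \<pi>) * infsum (hecke_term k s) OK"
  using assms(2,3)
proof (induction Q rule: finite_induct)
  case empty
  show ?case by (simp add: coprime_to_def)
next
  case (insert \<pi> Q)
  have "\<pi> \<noteq> 0" using insert prime_reps_nonzero by auto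
  hence inj: "inj_on ((*) \<pi>) A" for A by (auto simp: inj_on_def)
  have \<pi>: "\<pi> \<in> OK" using insert prime_reps_OK by auto
  note ins = coprime_to_insert[of \<pi> Q]
  have sub: "(*) \<pi> ` coprime_to Q \<subseteq> OK" using \<pi> by (auto simp: coprime_to_def)
  have "infsum (hecke_term k s) (coprime_to Q) = infsum (hecke_term k s) (coprime_to (insert \<pi> Q) \<union> (*) \<pi> ` coprime_to Q)"
    using ins(1) insert by simp
  also have "\<dots> = infsum (hecke_term k s) (coprime_to (insert \<pi> Q)) + infsum (hecke_term k s) ((*) \<pi> ` coprime_to Q)"
    using insert ins(2) sub by (intro infsum_Un_disjoint hecke_term_summable s coprime_to_subset) auto
  also have "infsum (hecke_term k s) ((*) \<pi> ` coprime_to Q) = hecke_term k s \<pi> * infsum (hecke_term k s) (coprime_to Q)"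
    by (subst infsum_reindex[OF inj]) (simp add: o_def hecke_term_mult infsum_cmult_right')
  finally have "infsum (hecke_term k s) (coprime_to (insert \<pi> Q)) 
      = infsum (hecke_term k s) (coprime_to Q) - hecke_term k s \<pi> * infsum (hecke_term k s) (coprime_to Q)"
    unfolding eq_diff_eq by (rule sym)
  also have "\<dots> = (1 - hecke_term k s \<pi>) * infsum (hecke_term k s) (coprime_to Q)"
    by (simp only: left_diff_distrib mult_1_left)
  also have "infsum (hecke_term k s) (coprime_to Q) = (\<Prod>\<pi>\<in>Q. 1 - hecke_term k s \<pi>) * infsum (hecke_term k s) OK"
    using insert.prems by (intro insert.IH) simp
  finally show ?case using insert.hyps by (simp add: mult.assoc)
qed

text \<open>
For a unit \<open>u / cnj u = u^2\<close>, so the exponent \<open>2 k\<close> has to be a multiple of 12.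
\<close>

lemma hecke_term_unit:
  assumes "u \<in> units" "6 dvd k"
  shows "hecke_term k s u = 1"
proof -
  have u: "u \<in> OK" "nrm u = 1" using assms by (auto simp: units_def)
  have "u * cnj u = 1" using mult_cnj_nrm[OF u(1)] u(2) by simp
  hence "u / cnj u = u ^ 2" by (cases "u = 0") (auto simp: field_simps power2_eq_square)
  moreover obtain l where "k = 6 * l" using assms by blast
  ultimately have "(u / cnj u) ^ k = (u ^ 12) ^ l" by (simp add: power_mult[symmetric])
  also have "\<dots> = 1" using unit_power_12[OF u] by simp
  finally show ?thesis using real_nrm[OF u(1)] u(2) by (simp add: hecke_term_def abs_square_eq_1)
qed

text \<open>
Once \<open>Q\<close> contains a prime divisor of every non-unit in a large finite set, only the units and a tail
of the absolutely convergent series are left. This is the Euler product, without infinite products.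
\<close>

lemma coprime_to_limit:
  assumes s: "s > 1" and k: "6 dvd k"
  shows "\<forall>\<^sub>F Q in finite_subsets_at_top prime_reps. norm (infsum (hecke_term k s) (coprime_to Q) - of_nat (card units)) < 1 / 2"
proof -
  let ?g = "\<lambda>\<alpha>. norm (hecke_term k s \<alpha>)"
  obtain F0 where F0: "finite F0" "F0 \<subseteq> OK" "dist (sum ?g F0) (infsum ?g OK) \<le> 1 / 4"
    using infsum_finite_approximation[OF hecke_term_abs_summable[OF s], of "1/4"] by auto
  define F where "F = F0 \<union> units"
  have F: "finite F" using F0(1) finite_units by (simp add: F_def)
  have F_OK: "F \<subseteq> OK" using F0(2) by (auto simp: F_def units_def)
  have tail: "infsum ?g (OK - F) < 1 / 2"
  proof -
    have "infsum ?g OK = infsum ?g (OK - F0) + sum ?g F0"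
    proof -
      have "(OK - F0) \<inter> F0 = {}" "(OK - F0) \<union> F0 = OK" using F0(2) by auto
      thus ?thesis
        using infsum_Un_disjoint[of ?g "OK - F0" F0] hecke_term_abs_summable_subset[OF s, of _ k] F0(1) by simp
    qed
    hence "infsum ?g (OK - F0) \<le> 1 / 4" using F0(3) by (simp add: dist_real_def)
    moreover have "infsum ?g (OK - F) \<le> infsum ?g (OK - F0)"
      by (rule infsum_mono2) (auto intro!: hecke_term_abs_summable_subset s simp: F_def)
    ultimately show ?thesis by simp
  qed
  have "\<forall>\<alpha>\<in>F - units. \<exists>\<pi>\<in>prime_reps. dv \<pi> \<alpha>"
    using F_OK exists_prime_divisor by (auto simp: units_def)
  then obtain f where f: "\<And>\<alpha>. \<alpha> \<in> F - units \<Longrightarrow> f \<alpha> \<in> prime_reps \<and> dv (f \<alpha>) \<alpha>" by metis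
  show ?thesis
    unfolding eventually_finite_subsets_at_top
  proof (intro exI conjI allI impI)
    show "finite (f ` (F - units))" "f ` (F - units) \<subseteq> prime_reps" using F f by auto
    fix Q assume Q: "finite Q \<and> f ` (F - units) \<subseteq> Q \<and> Q \<subseteq> prime_reps"
    have "units \<subseteq> coprime_to Q"
    proof
      fix u assume u: "u \<in> units"
      have "\<not> dv \<pi> u" if "\<pi> \<in> Q" for \<pi>
        using dv_nrm[of \<pi> u] prime_reps_nrm[of \<pi>] prime_reps_OK[of \<pi>] that Q u by (auto simp: units_def)
      thus "u \<in> coprime_to Q" using u by (auto simp: coprime_to_def units_def)
    qed
    moreover have "coprime_to Q \<inter> F \<subseteq> units"
      using f Q by (auto simp: coprime_to_def)
    ultimately have eq: "coprime_to Q = units \<union> (coprime_to Q - F)" "units \<inter> (coprime_to Q - F) = {}"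
      by (auto simp: F_def)
    have "infsum (hecke_term k s) (coprime_to Q) = infsum (hecke_term k s) (units \<union> (coprime_to Q - F))"
      using eq(1) by simp
    also have "\<dots> = infsum (hecke_term k s) units + infsum (hecke_term k s) (coprime_to Q - F)"
      using eq(2) coprime_to_subset by (intro infsum_Un_disjoint hecke_term_summable s) (auto simp: units_def)
    also have "infsum (hecke_term k s) units = of_nat (card units)"
      using hecke_term_unit[OF _ k] by simp
    finally have "norm (infsum (hecke_term k s) (coprime_to Q) - of_nat (card units)) = norm (infsum (hecke_term k s) (coprime_to Q - F))"
      by simp
    also have "\<dots> \<le> infsum ?g (OK - F)"
    proof (rule order_trans[OF norm_infsum_bound infsum_mono2])
      show "?g summable_on coprime_to Q - F" using coprime_to_subset by (intro hecke_term_abs_summable_subset s) auto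
    qed (use coprime_to_subset in \<open>auto intro!: hecke_term_abs_summable_subset s\<close>)
    also have "\<dots> < 1 / 2" by (rule tail)
    finally show "norm (infsum (hecke_term k s) (coprime_to Q) - of_nat (card units)) < 1 / 2" .
  qed
qed


end

section \<open>Consequences of the Euler product for sums over primes\<close>

context heegner_order begin

lemma summable_cmod_4: "(\<lambda>\<alpha>. cmod \<alpha> powr (-4)) summable_on OK"
  using summable_cmod_powr[of 2] by simp

lemma norm_hecke_term_sq: "\<alpha> \<in> OK \<Longrightarrow> s > 1 \<Longrightarrow> (norm (hecke_term k s \<alpha>))\<^sup>2 \<le> cmod \<alpha> powr (-4)"
proof (cases "\<alpha> = 0")
  case False
  assume "\<alpha> \<in> OK" "s > 1"
  have "(norm (hecke_term k s \<alpha>))\<^sup>2 = cmod \<alpha> powr (-4 * s)"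
    using powr_powr[of "cmod \<alpha>" "-2 * s" 2] by (simp add: norm_hecke_term)
  also have "\<dots> \<le> cmod \<alpha> powr (-4)"
    using cmod_ge_1[OF \<open>\<alpha> \<in> OK\<close> False] \<open>s > 1\<close> by (intro powr_mono) auto
  finally show ?thesis .
qed simp

text \<open>
Bounds the squares of the terms in the expansion of \<open>ln (1 - z)\<close>, uniformly in \<open>s\<close>.
\<close>

definition Z4 :: real where "Z4 = infsum (\<lambda>\<alpha>. cmod \<alpha> powr (-4)) OK"

lemma sum_sq_le: 
  assumes "finite Q" "Q \<subseteq> OK" "s > 1"
  shows "(\<Sum>\<pi>\<in>Q. (norm (hecke_term k s \<pi>))\<^sup>2) \<le> Z4"
proof -
  have "(\<Sum>\<pi>\<in>Q. (norm (hecke_term k s \<pi>))\<^sup>2) \<le> (\<Sum>\<pi>\<in>Q. cmod \<pi> powr (-4))"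
    using assms by (intro sum_mono norm_hecke_term_sq) auto
  also have "\<dots> \<le> Z4" unfolding Z4_def
    by (rule finite_sum_le_infsum[OF summable_cmod_4]) (use assms in auto)
  finally show ?thesis .
qed

lemma card_units_pos: "card units \<ge> 1"
proof -
  have "1 \<in> units" by (simp add: units_def)
  thus ?thesis using finite_units card_gt_0_iff[of units] by (metis One_nat_def Suc_leI empty_iff)
qed

text \<open>
An upper bound for the L-series bounds the sum over primes from above, because the sieved sum does not
vanish: it is close to the number of units.
\<close>

lemma euler_upper:
  assumes s: "s > 1" and k: "6 dvd k" and C: "norm (infsum (hecke_term k s) OK) \<le> C" "C > 0"
  shows "infsum (\<lambda>\<pi>. Re (hecke_term k s \<pi>)) prime_reps \<le> ln (2 * C) + Z4"
proof (rule tendsto_upperbound)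
  have PPOK: "prime_reps \<subseteq> OK" using prime_reps_OK by blast
  have fin: "\<forall>\<^sub>F Q in finite_subsets_at_top prime_reps. finite Q \<and> Q \<subseteq> prime_reps"
    by (rule eventually_finite_subsets_at_top_weakI) auto
  show "(sum (\<lambda>\<pi>. Re (hecke_term k s \<pi>)) \<longlongrightarrow> infsum (\<lambda>\<pi>. Re (hecke_term k s \<pi>)) prime_reps) (finite_subsets_at_top prime_reps)"
    using hecke_term_summable[OF s PPOK] by (intro infsum_tendsto summable_on_Re)
  show "\<forall>\<^sub>F Q in finite_subsets_at_top prime_reps. (\<Sum>\<pi>\<in>Q. Re (hecke_term k s \<pi>)) \<le> ln (2 * C) + Z4"
    using coprime_to_limit[OF s k] fin
  proof eventually_elim
    case (elim Q)
    hence Q: "finite Q" "Q \<subseteq> prime_reps" by auto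
    have QO: "Q \<subseteq> OK" using Q prime_reps_OK by blast
    have "real (card units) \<le> norm (infsum (hecke_term k s) (coprime_to Q)) + 1 / 2"
      using norm_triangle_sub[of "of_nat (card units)" "infsum (hecke_term k s) (coprime_to Q)"] elim(1)
      by (simp add: norm_minus_commute)
    hence "1 / 2 \<le> norm (infsum (hecke_term k s) (coprime_to Q))" using card_units_pos by linarith
    also have "\<dots> = (\<Prod>\<pi>\<in>Q. norm (1 - hecke_term k s \<pi>)) * norm (infsum (hecke_term k s) OK)"
      unfolding euler_product_finite[OF s Q] by (simp add: norm_mult prod_norm)
    also have "\<dots> \<le> (\<Prod>\<pi>\<in>Q. exp (- Re (hecke_term k s \<pi>) + (norm (hecke_term k s \<pi>))\<^sup>2 / 2)) * C"
      by (intro mult_mono prod_mono C prod_nonneg conjI norm_one_minus_le) auto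
    also have "(\<Prod>\<pi>\<in>Q. exp (- Re (hecke_term k s \<pi>) + (norm (hecke_term k s \<pi>))\<^sup>2 / 2))
      = exp (- (\<Sum>\<pi>\<in>Q. Re (hecke_term k s \<pi>)) + (\<Sum>\<pi>\<in>Q. (norm (hecke_term k s \<pi>))\<^sup>2) / 2)"
      using Q(1) by (simp add: exp_sum[symmetric] sum.distrib sum_negf sum_subtractf sum_divide_distrib)
    also have "\<dots> * C \<le> exp (- (\<Sum>\<pi>\<in>Q. Re (hecke_term k s \<pi>)) + Z4) * C"
    proof -
      have "0 \<le> (\<Sum>\<pi>\<in>Q. (norm (hecke_term k s \<pi>))\<^sup>2)" by (intro sum_nonneg) auto
      thus ?thesis using sum_sq_le[OF Q(1) QO s, of k] C(2) by (intro mult_right_mono) auto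
    qed
    finally have "1 \<le> (2 * C) * exp (- (\<Sum>\<pi>\<in>Q. Re (hecke_term k s \<pi>)) + Z4)" by (simp add: mult_ac)
    hence "ln 1 \<le> ln ((2 * C) * exp (- (\<Sum>\<pi>\<in>Q. Re (hecke_term k s \<pi>)) + Z4))" by (subst ln_le_cancel_iff) (use C in auto)
    also have "\<dots> = ln (2 * C) + (- (\<Sum>\<pi>\<in>Q. Re (hecke_term k s \<pi>)) + Z4)" using C(2) by (subst ln_mult) auto
    finally show ?case by simp
  qed
qed simp

text \<open>
The same identity for the trivial character, read in the other direction: the series is at least a
multiple of \<open>1 / (s - 1)\<close>, and the sieved sum is bounded.
\<close>

lemma euler_lower:
  assumes s: "1 < s" "s \<le> 2"
  shows "infsum (\<lambda>\<pi>. cmod \<pi> powr (-2 * s)) prime_reps \<ge> ln (1 / (5000 * (s - 1))) - ln (real (card units) + 1) - 2 * Z4"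
proof (rule tendsto_lowerbound)
  define D where "D = infsum (\<lambda>\<alpha>. cmod \<alpha> powr (-2 * s)) OK"
  have D: "D \<ge> 1 / (5000 * (s - 1))" unfolding D_def by (rule zeta_sum_lower[OF s])
  have pos: "1 / (5000 * (s - 1)) > 0" using s by simp
  have PPOK: "prime_reps \<subseteq> OK" using prime_reps_OK by blast
  have fin: "\<forall>\<^sub>F Q in finite_subsets_at_top prime_reps. finite Q \<and> Q \<subseteq> prime_reps"
    by (rule eventually_finite_subsets_at_top_weakI) auto
  show "(sum (\<lambda>\<pi>. cmod \<pi> powr (-2 * s)) \<longlongrightarrow> infsum (\<lambda>\<pi>. cmod \<pi> powr (-2 * s)) prime_reps) (finite_subsets_at_top prime_reps)"
    by (intro infsum_tendsto summable_on_subset[OF summable_cmod_powr[OF s(1)] PPOK])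
  have hs0: "hecke_term 0 s = (\<lambda>\<alpha>. of_real (cmod \<alpha> powr (-2 * s)))" by (auto simp: hecke_term_def)
  have inf0: "infsum (hecke_term 0 s) OK = of_real D"
    unfolding hs0 D_def by (rule infsumI has_sum_of_real has_sum_infsum summable_cmod_powr s)+
  show "\<forall>\<^sub>F Q in finite_subsets_at_top prime_reps. 
    (\<Sum>\<pi>\<in>Q. cmod \<pi> powr (-2 * s)) \<ge> ln (1 / (5000 * (s - 1))) - ln (real (card units) + 1) - 2 * Z4"
    using coprime_to_limit[OF s(1) dvd_0_right] fin
  proof eventually_elim
    case (elim Q)
    hence Q: "finite Q" "Q \<subseteq> prime_reps" by auto
    have QO: "Q \<subseteq> OK" using Q prime_reps_OK by blast
    define x where "x \<pi> = cmod \<pi> powr (-2 * s)" for \<pi>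
    have x: "0 \<le> x \<pi>" "x \<pi> \<le> 1 / 2" if "\<pi> \<in> Q" for \<pi>
    proof -
      have "2 \<le> (cmod \<pi>)\<^sup>2" using prime_reps_nrm[of \<pi>] real_nrm[of \<pi>] that Q QO by force
      hence "((cmod \<pi>)\<^sup>2) powr (-s) \<le> 2 powr (-s)" using s by (intro powr_mono2') auto
      also have "\<dots> \<le> 2 powr (-1)" using s by (intro powr_mono) auto
      finally show "x \<pi> \<le> 1 / 2" using powr_powr[of "cmod \<pi>" 2 "-s"] by (simp add: x_def powr_minus)
    qed (simp add: x_def)
    have "norm (infsum (hecke_term 0 s) (coprime_to Q)) \<le> real (card units) + 1 / 2"
      using norm_triangle_sub[of "infsum (hecke_term 0 s) (coprime_to Q)" "of_nat (card units)"] elim(1) by simp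
    also have "infsum (hecke_term 0 s) (coprime_to Q) = of_real ((\<Prod>\<pi>\<in>Q. 1 - x \<pi>) * D)"
      unfolding euler_product_finite[OF s(1) Q] inf0 by (simp add: hecke_term_def x_def)
    finally have "(\<Prod>\<pi>\<in>Q. 1 - x \<pi>) * D \<le> real (card units) + 1"
      unfolding norm_of_real by linarith
    have "exp (- (\<Sum>\<pi>\<in>Q. x \<pi>) - 2 * Z4) \<le> exp (\<Sum>\<pi>\<in>Q. - x \<pi> - 2 * (x \<pi>)\<^sup>2)"
      using sum_sq_le[OF Q(1) QO s(1), of 0] 
      by (simp add: sum_subtractf sum_negf sum_distrib_left[symmetric] x_def norm_hecke_term)
    also have "\<dots> = (\<Prod>\<pi>\<in>Q. exp (- x \<pi> - 2 * (x \<pi>)\<^sup>2))" using Q(1) by (rule exp_sum)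
    also have "\<dots> \<le> (\<Prod>\<pi>\<in>Q. 1 - x \<pi>)"
    proof (intro prod_mono conjI)
      fix \<pi> assume "\<pi> \<in> Q"
      note x = x[OF this]
      have "exp (- x \<pi> - 2 * (x \<pi>)\<^sup>2) \<le> exp (ln (1 - x \<pi>))"
        using ln_one_minus_pos_lower_bound[OF x] by simp
      thus "exp (- x \<pi> - 2 * (x \<pi>)\<^sup>2) \<le> 1 - x \<pi>" using x by simp
    qed simp
    finally have "exp (- (\<Sum>\<pi>\<in>Q. x \<pi>) - 2 * Z4) * (1 / (5000 * (s - 1))) \<le> (\<Prod>\<pi>\<in>Q. 1 - x \<pi>) * D"
      using D pos x by (intro mult_mono prod_nonneg) force+
    also have "\<dots> \<le> real (card units) + 1" by fact
    finally have "ln (exp (- (\<Sum>\<pi>\<in>Q. x \<pi>) - 2 * Z4) * (1 / (5000 * (s - 1)))) \<le> ln (real (card units) + 1)"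
      using pos by (subst ln_le_cancel_iff) auto
    also have "ln (exp (- (\<Sum>\<pi>\<in>Q. x \<pi>) - 2 * Z4) * (1 / (5000 * (s - 1)))) 
        = (- (\<Sum>\<pi>\<in>Q. x \<pi>) - 2 * Z4) + ln (1 / (5000 * (s - 1)))"
      using pos by (subst ln_mult) auto
    finally show ?case by (simp add: x_def)
  qed
qed simp

lemma deg1_primes_inert_primes_disjoint: "deg1_primes \<inter> inert_primes = {}"
proof -
  have sq: "\<not> prime (p\<^sup>2)" for p :: nat by (simp add: prime_power_iff)
  have "\<pi> \<notin> inert_primes" if "\<pi> \<in> deg1_primes" for \<pi>
  proof
    assume "\<pi> \<in> inert_primes"
    then obtain p where "\<pi> = of_nat p" by (elim inert_primesD)
    thus False using deg1_primesD(2)[OF that] sq by (simp add: nrm_of_nat)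
  qed
  thus ?thesis by blast
qed

lemma deg1_primes_sub: "deg1_primes \<subseteq> OK" and inert_primes_sub: "inert_primes \<subseteq> OK" and prime_reps_eq: "prime_reps = deg1_primes \<union> inert_primes"
  using prime_reps_OK by (auto simp: prime_reps_def)

lemma summable_inert_primes: "(\<lambda>\<pi>. cmod \<pi> powr (-2)) summable_on inert_primes"
proof -
  have "summable (\<lambda>n. real n powr (-2))" by (simp add: summable_real_powr_iff)
  hence "(\<lambda>n. real n powr (-2)) summable_on UNIV" by (subst summable_on_UNIV_nonneg_real_iff) auto
  hence "(\<lambda>n. real n powr (-2)) summable_on {p. prime p \<and> \<not> has_root p}" by (rule summable_on_subset) simp
  thus ?thesis unfolding inert_primes_def by (subst summable_on_reindex) (auto simp: inj_on_def o_def)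
qed

definition Z2 :: real where "Z2 = infsum (\<lambda>\<pi>. cmod \<pi> powr (-2)) inert_primes"

lemma inert_primes_bound: 
  assumes "s > 1" "\<And>\<pi>. \<pi> \<in> inert_primes \<Longrightarrow> \<bar>g \<pi>\<bar> \<le> cmod \<pi> powr (-2 * s)" "g summable_on inert_primes"
  shows "\<bar>infsum g inert_primes\<bar> \<le> Z2"
proof -
  have "norm (infsum g inert_primes) \<le> Z2" unfolding Z2_def
  proof (rule norm_infsum_le)
    fix \<pi> assume p: "\<pi> \<in> inert_primes"
    have "cmod \<pi> powr (-2 * s) \<le> cmod \<pi> powr (-2)"
      using cmod_ge_1[of \<pi>] p inert_primes_sub prime_reps_nonzero[of \<pi>] assms(1) by (intro powr_mono) (auto simp: prime_reps_def)
    thus "norm (g \<pi>) \<le> cmod \<pi> powr (-2)" using assms(2)[OF p] by simp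
  qed (use assms summable_inert_primes in auto)
  thus ?thesis by simp
qed

theorem deg1_primes_angle_sum_bounded:
  assumes "k > 0" "6 dvd k"
  shows "\<exists>C. \<forall>\<^sub>F s in at_right 1. infsum (\<lambda>\<pi>. Re (hecke_term k s \<pi>)) deg1_primes \<le> C"
proof -
  obtain \<pi> where "\<pi> \<in> OK" "prime (nrm \<pi>)" "(\<pi> / cnj \<pi>) ^ k \<noteq> 1"
    using exists_nontrivial_angle assms(1) by blast
  from hecke_term_sum_bounded[OF this] obtain C where C: "\<forall>\<^sub>F s in at_right 1. norm (infsum (hecke_term k s) OK) \<le> C" by blast
  have "\<forall>\<^sub>F s::real in at_right 1. s > 1" by (simp add: eventually_at_right_less)
  with C have "\<forall>\<^sub>F s in at_right 1. infsum (\<lambda>\<pi>. Re (hecke_term k s \<pi>)) deg1_primes \<le> ln (2 * (\<bar>C\<bar> + 1)) + Z4 + Z2"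
  proof eventually_elim
    case (elim s)
    have prime_reps: "infsum (\<lambda>\<pi>. Re (hecke_term k s \<pi>)) prime_reps \<le> ln (2 * (\<bar>C\<bar> + 1)) + Z4"
      by (rule euler_upper) (use elim assms in auto)
    have S: "(\<lambda>\<pi>. Re (hecke_term k s \<pi>)) summable_on A" if "A \<subseteq> OK" for A
      by (intro summable_on_Re hecke_term_summable elim that)
    have "infsum (\<lambda>\<pi>. Re (hecke_term k s \<pi>)) prime_reps = infsum (\<lambda>\<pi>. Re (hecke_term k s \<pi>)) deg1_primes + infsum (\<lambda>\<pi>. Re (hecke_term k s \<pi>)) inert_primes"
      unfolding prime_reps_eq using deg1_primes_inert_primes_disjoint deg1_primes_sub inert_primes_sub by (intro infsum_Un_disjoint S) auto
    moreover have "\<bar>infsum (\<lambda>\<pi>. Re (hecke_term k s \<pi>)) inert_primes\<bar> \<le> Z2"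
      by (rule inert_primes_bound[OF elim(2)]) (use abs_Re_le_cmod[of "hecke_term k s _"] inert_primes_sub in \<open>auto simp: norm_hecke_term intro!: S\<close>)
    ultimately show ?case using prime_reps by linarith
  qed
  thus ?thesis by blast
qed

theorem deg1_primes_sum_lower:
  "\<exists>C. \<forall>\<^sub>F s in at_right 1. infsum (\<lambda>\<pi>. cmod \<pi> powr (-2 * s)) deg1_primes \<ge> ln (1 / (s - 1)) - C"
proof -
  have "\<forall>\<^sub>F s::real in at_right 1. s > 1 \<and> s \<le> 2"
    using eventually_at_right_real[of 1 2] by (rule eventually_mono) auto
  hence "\<forall>\<^sub>F s in at_right 1. infsum (\<lambda>\<pi>. cmod \<pi> powr (-2 * s)) deg1_primes 
      \<ge> ln (1 / (s - 1)) - (ln 5000 + ln (real (card units) + 1) + 2 * Z4 + Z2)"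
  proof eventually_elim
    case (elim s)
    hence s: "1 < s" "s \<le> 2" by auto
    have S: "(\<lambda>\<pi>. cmod \<pi> powr (-2 * s)) summable_on A" if "A \<subseteq> OK" for A
      by (rule summable_on_subset[OF summable_cmod_powr[OF s(1)] that])
    have "infsum (\<lambda>\<pi>. cmod \<pi> powr (-2 * s)) prime_reps = infsum (\<lambda>\<pi>. cmod \<pi> powr (-2 * s)) deg1_primes + infsum (\<lambda>\<pi>. cmod \<pi> powr (-2 * s)) inert_primes"
      unfolding prime_reps_eq using deg1_primes_inert_primes_disjoint deg1_primes_sub inert_primes_sub by (intro infsum_Un_disjoint S) auto
    moreover have "\<bar>infsum (\<lambda>\<pi>. cmod \<pi> powr (-2 * s)) inert_primes\<bar> \<le> Z2"
      by (rule inert_primes_bound[OF s(1) _ S[OF inert_primes_sub]]) simp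
    moreover have "ln (1 / (5000 * (s - 1))) = ln (1 / (s - 1)) - ln 5000"
    proof -
      have eq: "1 / (5000 * (s - 1)) = (1 / (s - 1)) / 5000" by simp
      show ?thesis unfolding eq by (subst ln_divide_pos) (use s in auto)
    qed
    ultimately show ?case using euler_lower[OF s] by linarith
  qed
  thus ?thesis by blast
qed

end

section \<open>Ultrafilter limits of lattice means and the dual Turan-Kubilius inequality\<close>

text \<open>
A predicate of its own, so that it can be passed to lemmas by first-order unification.
\<close>

definition supp :: "(complex \<Rightarrow> real) \<Rightarrow> real \<Rightarrow> bool" where
  "supp \<phi> r \<longleftrightarrow> (\<forall>z. norm z > r \<longrightarrow> \<phi> z = 0)"

lemma suppD: "supp \<phi> r \<Longrightarrow> norm z > r \<Longrightarrow> \<phi> z = 0"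
  by (simp add: supp_def)

text \<open>
Lipschitz functions supported in a disc, with explicit constants. Scaling the argument by \<open>z\<close> stays in
this class and changes the constants in a controlled way, which is what makes \<open>G\<close> continuous below.
\<close>

definition test :: "(complex \<Rightarrow> real) \<Rightarrow> real \<Rightarrow> real \<Rightarrow> bool" where
  "test \<phi> K r \<longleftrightarrow> K \<ge> 0 \<and> r > 0 \<and> (\<forall>z w. \<bar>\<phi> z - \<phi> w\<bar> \<le> K * norm (z - w)) \<and> supp \<phi> r"

lemma testD:
  assumes "test \<phi> K r"
  shows "K \<ge> 0" "r > 0" "\<bar>\<phi> z - \<phi> w\<bar> \<le> K * norm (z - w)" "supp \<phi> r" "\<bar>\<phi> z\<bar> \<le> 3 * K * r"
proof -
  show *: "K \<ge> 0" "r > 0" "\<bar>\<phi> z - \<phi> w\<bar> \<le> K * norm (z - w)" "supp \<phi> r" for z w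
    using assms by (auto simp: test_def)
  show "\<bar>\<phi> z\<bar> \<le> 3 * K * r"
  proof (cases "norm z \<le> r")
    case True
    have "\<phi> (of_real (2 * r)) = 0" using *(2) by (intro suppD[OF *(4)]) simp
    hence "\<bar>\<phi> z\<bar> \<le> K * norm (z - of_real (2 * r))" using *(3)[of z "of_real (2 * r)"] by simp
    also have "K * norm (z - of_real (2 * r)) \<le> K * (3 * r)"
      using norm_triangle_ineq4[of z "of_real (2 * r)"] True *(1,2) by (intro mult_left_mono) auto
    finally show ?thesis by simp
  next
    case False
    thus ?thesis using suppD[OF *(4), of z] *(1,2) by simp
  qed
qed

lemma test_abs: "test \<phi> K r \<Longrightarrow> test (\<lambda>z. \<bar>\<phi> z\<bar>) K r"
  unfolding test_def supp_def by (auto intro: order_trans[OF abs_triangle_ineq3])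

lemma test_scale:
  assumes "test \<phi> K r" "z \<noteq> 0"
  shows "test (\<lambda>w. \<phi> (z * w)) (K * norm z) (r / norm z)"
  unfolding test_def
proof (intro conjI allI impI)
  note T = testD[OF assms(1)]
  show "0 \<le> K * norm z" "0 < r / norm z" using T assms(2) by auto
  show "\<bar>\<phi> (z * u) - \<phi> (z * v)\<bar> \<le> K * norm z * norm (u - v)" for u v
    using T(3)[of "z * u" "z * v"] by (simp add: norm_mult right_diff_distrib[symmetric] mult.assoc)
  show "supp (\<lambda>w. \<phi> (z * w)) (r / norm z)"
    unfolding supp_def using assms(2) by (intro allI impI suppD[OF T(4)]) (simp add: norm_mult field_simps)
qed

context heegner_order begin

definition lattice_mean :: "(complex \<Rightarrow> real) \<Rightarrow> (complex \<Rightarrow> real) \<Rightarrow> real \<Rightarrow> real" where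
  "lattice_mean \<phi> g X = infsum (\<lambda>\<alpha>. \<phi> (\<alpha> / of_real X) * g \<alpha>) OK / X\<^sup>2"

lemma infsum_finite_support:
  fixes f :: "complex \<Rightarrow> real"
  assumes "finite F" "F \<subseteq> OK" "\<And>\<alpha>. \<alpha> \<in> OK \<Longrightarrow> \<alpha> \<notin> F \<Longrightarrow> f \<alpha> = 0"
  shows "infsum f OK = sum f F" "f summable_on OK" "(\<lambda>x. norm (f x)) summable_on OK"
proof -
  have "infsum f OK = infsum f F" by (rule infsum_cong_neutral) (use assms in auto)
  thus "infsum f OK = sum f F" using assms by simp
  have "f summable_on OK \<longleftrightarrow> f summable_on F" by (rule summable_on_cong_neutral) (use assms in auto)
  thus "f summable_on OK" using assms by simp
  have "(\<lambda>x. norm (f x)) summable_on OK \<longleftrightarrow> (\<lambda>x. norm (f x)) summable_on F" by (rule summable_on_cong_neutral) (use assms in auto)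
  thus "(\<lambda>x. norm (f x)) summable_on OK" using assms by simp
qed

lemma support_lattice_ball:
  assumes "supp \<phi> r" "X > 0" "\<alpha> \<in> OK" "\<alpha> \<notin> lattice_ball (r * X)"
  shows "\<phi> (\<alpha> / of_real X) = 0"
  using assms by (intro suppD[OF assms(1)]) (auto simp: lattice_ball_def norm_divide field_simps)

lemma lattice_ball_subset_OK: "lattice_ball R \<subseteq> OK"
  by (auto simp: lattice_ball_def)

lemma lattice_mean_eq:
  assumes "supp \<phi> r" "X > 0"
  shows "lattice_mean \<phi> g X = (\<Sum>\<alpha>\<in>lattice_ball (r * X). \<phi> (\<alpha> / of_real X) * g \<alpha>) / X\<^sup>2"
  unfolding lattice_mean_def using support_lattice_ball[OF assms]
  by (subst infsum_finite_support(1)[OF finite_lattice_ball[of "r * X"] lattice_ball_subset_OK]) auto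

lemma lattice_mean_bound:
  assumes supp: "supp \<phi> r" and r: "r > 0" "X \<ge> 1 / r"
    and B: "\<And>z. \<bar>\<phi> z\<bar> \<le> B" "\<And>\<alpha>. \<bar>g \<alpha>\<bar> \<le> A"
  shows "\<bar>lattice_mean \<phi> g X\<bar> \<le> 25 * B * A * r\<^sup>2"
proof -
  have X: "X > 0" using r by (meson less_le_trans zero_less_divide_1_iff)
  have rX: "r * X \<ge> 1" using r by (simp add: field_simps)
  have B0: "B \<ge> 0" "A \<ge> 0" using B(1)[of 0] B(2)[of 0] by linarith+
  have "\<bar>\<Sum>\<alpha>\<in>lattice_ball (r * X). \<phi> (\<alpha> / of_real X) * g \<alpha>\<bar> \<le> (\<Sum>\<alpha>\<in>lattice_ball (r * X). B * A)"
    by (rule order_trans[OF sum_abs sum_mono]) (auto simp: abs_mult intro!: mult_mono B B0)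
  also have "\<dots> = real (card (lattice_ball (r * X))) * (B * A)" by simp
  also have "\<dots> \<le> (4 * (r * X) + 1)\<^sup>2 * (B * A)"
    using rX B0 by (intro mult_right_mono card_lattice_ball) auto
  also have "\<dots> \<le> (5 * (r * X))\<^sup>2 * (B * A)"
    using rX B0 by (intro mult_right_mono power_mono mult_nonneg_nonneg) linarith+
  finally have "\<bar>\<Sum>\<alpha>\<in>lattice_ball (r * X). \<phi> (\<alpha> / of_real X) * g \<alpha>\<bar> / X\<^sup>2 \<le> (5 * (r * X))\<^sup>2 * (B * A) / X\<^sup>2"
    by (intro divide_right_mono) auto
  also have "\<dots> = 25 * B * A * r\<^sup>2" using X by (simp add: field_simps power2_eq_square)
  finally show ?thesis unfolding lattice_mean_eq[OF supp X] by simp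
qed

lemma lattice_mean_eventually_bounded:
  assumes "test \<phi> K r" "\<And>\<alpha>. \<bar>g \<alpha>\<bar> \<le> A"
  shows "\<forall>\<^sub>F X in at_top. \<bar>lattice_mean \<phi> g X\<bar> \<le> 25 * (3 * K * r) * A * r\<^sup>2"
proof -
  note T = testD[OF assms(1)]
  have "\<forall>\<^sub>F X::real in at_top. X \<ge> 1 / r" by (rule eventually_ge_at_top)
  thus ?thesis
    by eventually_elim (rule lattice_mean_bound[OF T(4) T(2) _ T(5) assms(2)])
qed

lemma lattice_mean_sum:
  assumes "supp \<phi> r" "X > 0" "finite I"
  shows "lattice_mean \<phi> (\<lambda>\<alpha>. \<Sum>i\<in>I. c i * h i \<alpha>) X = (\<Sum>i\<in>I. c i * lattice_mean \<phi> (h i) X)"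
proof -
  have "(\<Sum>\<alpha>\<in>lattice_ball (r * X). \<phi> (\<alpha> / of_real X) * (\<Sum>i\<in>I. c i * h i \<alpha>)) 
     = (\<Sum>i\<in>I. c i * (\<Sum>\<alpha>\<in>lattice_ball (r * X). \<phi> (\<alpha> / of_real X) * h i \<alpha>))"
    unfolding sum_distrib_left by (subst sum.swap) (simp add: mult_ac)
  thus ?thesis unfolding lattice_mean_eq[OF assms(1,2)]
    by (simp only: sum_divide_distrib[of _ I] times_divide_eq_right)
qed

lemma lattice_mean_lin:
  assumes "supp \<phi> r" "X > 0"
  shows "lattice_mean \<phi> (\<lambda>\<alpha>. c * g \<alpha> + d * h \<alpha>) X = c * lattice_mean \<phi> g X + d * lattice_mean \<phi> h X"
  unfolding lattice_mean_eq[OF assms] by (simp add: sum.distrib sum_distrib_left add_divide_distrib algebra_simps)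

text \<open>
Restricting a lattice mean to multiples of \<open>\<gamma>\<close> amounts to scaling the test function by \<open>\<gamma>\<close>.
\<close>

lemma lattice_mean_dv:
  assumes "\<gamma> \<in> OK" "\<gamma> \<noteq> 0"
  shows "lattice_mean \<phi> (\<lambda>\<alpha>. h \<alpha> * of_bool (dv \<gamma> \<alpha>)) X = lattice_mean (\<lambda>w. \<phi> (\<gamma> * w)) (\<lambda>\<beta>. h (\<gamma> * \<beta>)) X"
proof -
  have inj: "inj_on ((*) \<gamma>) OK" using assms by (auto simp: inj_on_def)
  have "infsum (\<lambda>\<alpha>. \<phi> (\<alpha> / of_real X) * (h \<alpha> * of_bool (dv \<gamma> \<alpha>))) OK
     = infsum (\<lambda>\<alpha>. \<phi> (\<alpha> / of_real X) * h \<alpha>) ((*) \<gamma> ` OK)"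
    by (rule infsum_cong_neutral) (use assms in \<open>auto simp: dv_def\<close>)
  also have "\<dots> = infsum (\<lambda>\<beta>. \<phi> (\<gamma> * (\<beta> / of_real X)) * h (\<gamma> * \<beta>)) OK"
    by (subst infsum_reindex[OF inj]) (simp add: o_def)
  finally show ?thesis by (simp add: lattice_mean_def)
qed

text \<open>
The \<open>p\<close> cosets of \<open>\<pi> O\<close> have asymptotically equal means, since translating by
\<open>s < p\<close> moves the argument of \<open>\<phi>\<close> by at most \<open>p / X\<close>. In the limit this is the covariance of
area under multiplication by \<open>\<pi>\<close>.
\<close>

lemma lattice_mean_scale_covariant:
  assumes \<pi>: "\<pi> \<in> OK" "nrm \<pi> = p" "prime p" and t: "test \<phi> K r"
  shows "((\<lambda>X. lattice_mean \<phi> (\<lambda>_. 1) X - real p * lattice_mean (\<lambda>w. \<phi> (\<pi> * w)) (\<lambda>_. 1) X) \<longlongrightarrow> 0) at_top"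
proof -
  note T = testD[OF t]
  have p: "p > 0" using \<pi>(3) prime_gt_0_nat by blast
  have \<pi>0: "\<pi> \<noteq> 0" using \<pi> by auto
  have \<pi>1: "cmod \<pi> \<ge> 1" by (rule cmod_ge_1[OF \<pi>(1) \<pi>0])
  define R where "R = r + real p + 1"
  have R: "R > 0" "R \<ge> r" using T by (auto simp: R_def)
  have bound: "norm (lattice_mean \<phi> (\<lambda>_. 1) X - real p * lattice_mean (\<lambda>w. \<phi> (\<pi> * w)) (\<lambda>_. 1) X) \<le> (real p * (K * real p * (5 * R)\<^sup>2)) / X"
    if X: "X \<ge> 1" for X
  proof -
    have RX: "R * X \<ge> 1" using X R T(2) mult_mono[of 1 R 1 X] by (simp add: R_def)
    define f where "f \<alpha> = \<phi> (\<alpha> / of_real X)" for \<alpha>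
    have f0: "f (\<pi> * \<beta> + of_nat s) = 0" if "\<beta> \<in> OK" "\<beta> \<notin> lattice_ball (R * X)" "s < p" for \<beta> s
    proof -
      have "R * X < cmod \<beta>" using that by (auto simp: lattice_ball_def)
      also have "\<dots> \<le> cmod (\<pi> * \<beta>)" using mult_right_mono[OF \<pi>1, of "cmod \<beta>"] by (simp add: norm_mult)
      also have "\<dots> \<le> cmod (\<pi> * \<beta> + of_nat s) + real s"
        using norm_triangle_ineq4[of "\<pi> * \<beta> + of_nat s" "of_nat s"] by simp
      finally have "R * X - real p < cmod (\<pi> * \<beta> + of_nat s)" using that(3) by linarith
      moreover have "r * X + real p \<le> R * X"
        using X mult_left_mono[OF X, of "real p"] by (simp add: R_def algebra_simps)
      ultimately have "r * X < cmod (\<pi> * \<beta> + of_nat s)" by linarith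
      thus ?thesis unfolding f_def using X by (intro suppD[OF T(4)]) (simp add: norm_divide field_simps)
    qed
    have fsumm: "(\<lambda>\<alpha>. norm (f \<alpha>)) summable_on OK"
      by (rule infsum_finite_support(3)[of "lattice_ball (r * X)"])
        (use support_lattice_ball[OF T(4), of X] X lattice_ball_subset_OK in \<open>auto simp: f_def\<close>)
    have "infsum f OK = (\<Sum>s<p. infsum (\<lambda>\<beta>. f (\<pi> * \<beta> + of_nat s)) OK)"
      by (rule infsum_cosets(1)[OF \<pi> fsumm])
    also have "\<dots> = (\<Sum>s<p. \<Sum>\<beta>\<in>lattice_ball (R * X). f (\<pi> * \<beta> + of_nat s))"
      by (intro sum.cong refl infsum_finite_support(1)) (use f0 lattice_ball_subset_OK in auto)
    finally have 1: "infsum f OK = (\<Sum>s<p. \<Sum>\<beta>\<in>lattice_ball (R * X). f (\<pi> * \<beta> + of_nat s))" .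
    have 2: "infsum (\<lambda>\<beta>. f (\<pi> * \<beta>)) OK = (\<Sum>\<beta>\<in>lattice_ball (R * X). f (\<pi> * \<beta>))"
      by (intro infsum_finite_support(1)) (use f0[of _ 0] p lattice_ball_subset_OK in auto)
    have "infsum f OK - real p * infsum (\<lambda>\<beta>. f (\<pi> * \<beta>)) OK
       = (\<Sum>s<p. \<Sum>\<beta>\<in>lattice_ball (R * X). f (\<pi> * \<beta> + of_nat s) - f (\<pi> * \<beta>))"
      unfolding 1 2 by (simp add: sum_subtractf)
    also have "\<bar>\<dots>\<bar> \<le> (\<Sum>s<p. \<Sum>\<beta>\<in>lattice_ball (R * X). K * real p / X)"
    proof (rule order_trans[OF sum_abs sum_mono], rule order_trans[OF sum_abs sum_mono])
      fix s \<beta> assume s: "s \<in> {..<p}"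
      have "\<bar>f (\<pi> * \<beta> + of_nat s) - f (\<pi> * \<beta>)\<bar> \<le> K * norm ((\<pi> * \<beta> + of_nat s) / of_real X - \<pi> * \<beta> / of_real X)"
        unfolding f_def by (rule T(3))
      also have "(\<pi> * \<beta> + of_nat s) / of_real X - \<pi> * \<beta> / of_real X = of_nat s / of_real X"
        by (simp add: add_divide_distrib)
      also have "K * norm (of_nat s / of_real X :: complex) = K * (real s / X)" using X by (simp add: norm_divide)
      also have "\<dots> \<le> K * (real p / X)" using s X T(1) by (intro mult_left_mono divide_right_mono) auto
      finally show "\<bar>f (\<pi> * \<beta> + of_nat s) - f (\<pi> * \<beta>)\<bar> \<le> K * real p / X" by simp
    qed
    also have "\<dots> = real p * (real (card (lattice_ball (R * X))) * (K * real p / X))" by simp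
    also have "\<dots> \<le> real p * ((4 * (R * X) + 1)\<^sup>2 * (K * real p / X))"
      using RX T(1) X by (intro mult_left_mono mult_right_mono card_lattice_ball) auto
    also have "\<dots> \<le> real p * ((5 * (R * X))\<^sup>2 * (K * real p / X))"
      using RX T(1) X by (intro mult_left_mono mult_right_mono power_mono) auto
    finally have "\<bar>infsum f OK - real p * infsum (\<lambda>\<beta>. f (\<pi> * \<beta>)) OK\<bar> / X\<^sup>2 
        \<le> real p * ((5 * (R * X))\<^sup>2 * (K * real p / X)) / X\<^sup>2"
      by (rule divide_right_mono) simp
    also have "\<dots> = (real p * (K * real p * (5 * R)\<^sup>2)) / X"
      using X by (simp add: field_simps power2_eq_square)
    finally have le: "\<bar>infsum f OK - real p * infsum (\<lambda>\<beta>. f (\<pi> * \<beta>)) OK\<bar> / X\<^sup>2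
      \<le> (real p * (K * real p * (5 * R)\<^sup>2)) / X" .
    have eq: "lattice_mean \<phi> (\<lambda>_. 1) X - real p * lattice_mean (\<lambda>w. \<phi> (\<pi> * w)) (\<lambda>_. 1) X
        = (infsum f OK - real p * infsum (\<lambda>\<beta>. f (\<pi> * \<beta>)) OK) / X\<^sup>2"
      by (simp add: lattice_mean_def f_def[abs_def] diff_divide_distrib)
    show ?thesis using le unfolding eq real_norm_def abs_divide by simp
  qed
  show ?thesis
  proof (rule Lim_null_comparison)
    show "\<forall>\<^sub>F X in at_top. norm (lattice_mean \<phi> (\<lambda>_. 1) X - real p * lattice_mean (\<lambda>w. \<phi> (\<pi> * w)) (\<lambda>_. 1) X) \<le> (real p * (K * real p * (5 * R)\<^sup>2)) / X"
      using eventually_ge_at_top[of 1] by eventually_elim (rule bound)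
    show "((\<lambda>X::real. (real p * (K * real p * (5 * R)\<^sup>2)) / X) \<longlongrightarrow> 0) at_top"
      by (intro tendsto_divide_0[OF tendsto_const] filterlim_at_top_imp_at_infinity filterlim_ident)
  qed
qed

end

text \<open>
The filter is as provided by \<open>ultrafilter_refinement\<close>: every quantity that stays bounded as \<open>X\<close> grows
has a limit along \<open>F\<close>.
\<close>

locale omega_limit = heegner_order +
  fixes F :: "real filter" and a :: "nat \<Rightarrow> real" and A :: real
  assumes F_le: "F \<le> at_top" and F_bot: "F \<noteq> bot"
    and F_conv: "\<And>h :: real \<Rightarrow> real. (\<exists>B. \<forall>\<^sub>F x in at_top. \<bar>h x\<bar> \<le> B) \<Longrightarrow> \<exists>l. (h \<longlongrightarrow> l) F"
    and a_bound: "\<And>n. \<bar>a n\<bar> \<le> A"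
begin

lemma A_nonneg: "A \<ge> 0" using a_bound[of 0] by linarith

text \<open>
The value at 0 is set to 0, so that \<open>g_prime_mult\<close> holds there as well.
\<close>

definition g :: "nat \<Rightarrow> complex \<Rightarrow> real" where
  "g j \<alpha> = (if \<alpha> = 0 then 0 else a (big_Omega (nrm \<alpha>) + j))"

definition L :: "nat \<Rightarrow> (complex \<Rightarrow> real) \<Rightarrow> real" where
  "L j \<phi> = Lim F (lattice_mean \<phi> (g j))"

definition M :: "(complex \<Rightarrow> real) \<Rightarrow> real" where
  "M \<phi> = Lim F (lattice_mean \<phi> (\<lambda>_. 1))"

lemma g_bound: "\<bar>g j \<alpha>\<bar> \<le> A"
  using a_bound A_nonneg by (simp add: g_def)

lemma g_prime_mult:
  assumes "\<pi> \<in> deg1_primes" "\<beta> \<in> OK"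
  shows "g j (\<pi> * \<beta>) = g (Suc j) \<beta>"
  using assms big_Omega_mult_prime[of \<pi> \<beta>] deg1_primesD(2)[of \<pi>] by (auto simp: g_def)

lemma eventually_F: "eventually P at_top \<Longrightarrow> eventually P F"
  using F_le by (rule filter_leD)

lemma tendsto_F: "(h \<longlongrightarrow> l) at_top \<Longrightarrow> (h \<longlongrightarrow> l) F"
  using F_le by (rule tendsto_mono)

lemma Lim_lattice_mean_tendsto:
  assumes "test \<phi> K r" "\<And>\<alpha>. \<bar>h \<alpha>\<bar> \<le> B"
  shows "(lattice_mean \<phi> h \<longlongrightarrow> Lim F (lattice_mean \<phi> h)) F"
proof -
  have "\<exists>B. \<forall>\<^sub>F X in at_top. \<bar>lattice_mean \<phi> h X\<bar> \<le> B"
    using lattice_mean_eventually_bounded[where g = h, OF assms] by (rule exI)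
  from F_conv[OF this] obtain l where l: "(lattice_mean \<phi> h \<longlongrightarrow> l) F" by blast
  thus ?thesis using tendsto_Lim[OF F_bot l] by simp
qed

lemma L_tendsto: "test \<phi> K r \<Longrightarrow> (lattice_mean \<phi> (g j) \<longlongrightarrow> L j \<phi>) F"
  unfolding L_def by (rule Lim_lattice_mean_tendsto[where h = "g j", OF _ g_bound])

lemma M_tendsto: "test \<phi> K r \<Longrightarrow> (lattice_mean \<phi> (\<lambda>_. 1) \<longlongrightarrow> M \<phi>) F"
  unfolding M_def by (rule Lim_lattice_mean_tendsto[where h = "\<lambda>_. 1" and B = 1]) simp_all

lemma M_scale:
  assumes "\<pi> \<in> deg1_primes" "test \<phi> K r"
  shows "M (\<lambda>w. \<phi> (\<pi> * w)) = M \<phi> / nrm \<pi>"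
proof -
  have \<pi>: "\<pi> \<in> OK" "prime (nrm \<pi>)" "\<pi> \<noteq> 0" using deg1_primesD[OF assms(1)] by auto
  have "((\<lambda>X. lattice_mean \<phi> (\<lambda>_. 1) X - nrm \<pi> * lattice_mean (\<lambda>w. \<phi> (\<pi> * w)) (\<lambda>_. 1) X) \<longlongrightarrow> M \<phi> - nrm \<pi> * M (\<lambda>w. \<phi> (\<pi> * w))) F"
    by (intro tendsto_intros M_tendsto[OF assms(2)] M_tendsto[OF test_scale[OF assms(2) \<pi>(3)]])
  moreover have "((\<lambda>X. lattice_mean \<phi> (\<lambda>_. 1) X - nrm \<pi> * lattice_mean (\<lambda>w. \<phi> (\<pi> * w)) (\<lambda>_. 1) X) \<longlongrightarrow> 0) F"
    by (rule tendsto_F[OF lattice_mean_scale_covariant[OF \<pi>(1) refl \<pi>(2) assms(2)]])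
  ultimately have "M \<phi> - nrm \<pi> * M (\<lambda>w. \<phi> (\<pi> * w)) = 0" using tendsto_unique[OF F_bot] by blast
  thus ?thesis using prime_gt_0_nat[OF \<pi>(2)] by (simp add: field_simps)
qed

lemma lattice_mean_eq_F: 
  assumes "test \<phi> K r" "\<And>X. X > 0 \<Longrightarrow> f X = h X" "(h \<longlongrightarrow> l) F"
  shows "(f \<longlongrightarrow> l) F"
proof -
  have "\<forall>\<^sub>F X in F. f X = h X"
    using eventually_F[OF eventually_gt_at_top[of 0]] by eventually_elim (rule assms(2))
  thus ?thesis using assms(3) by (simp add: tendsto_cong)
qed

lemma dv_both_iff:
  assumes "\<pi> \<in> deg1_primes" "\<rho> \<in> deg1_primes" "\<pi> \<noteq> \<rho>" "\<alpha> \<in> OK"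
  shows "dv \<pi> \<alpha> \<and> dv \<rho> \<alpha> \<longleftrightarrow> dv (\<pi> * \<rho>) \<alpha>"
proof
  assume *: "dv \<pi> \<alpha> \<and> dv \<rho> \<alpha>"
  then obtain \<beta> where b: "\<beta> \<in> OK" "\<alpha> = \<pi> * \<beta>" unfolding dv_def by blast
  have "\<not> dv \<rho> \<pi>" using prime_reps_dv_eq[of \<rho> \<pi>] assms by (auto simp: prime_reps_def)
  hence "dv \<rho> \<beta>" using prime_reps_prime[of \<rho> \<pi> \<beta>] assms * b deg1_primesD(1) by (auto simp: prime_reps_def)
  thus "dv (\<pi> * \<rho>) \<alpha>" unfolding b(2) dv_def by (auto simp: mult.assoc)
next
  assume "dv (\<pi> * \<rho>) \<alpha>"
  then obtain \<beta> where "\<beta> \<in> OK" "\<alpha> = \<pi> * \<rho> * \<beta>" unfolding dv_def by blast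
  moreover from this have "\<alpha> = \<rho> * (\<pi> * \<beta>)" "\<alpha> = \<pi> * (\<rho> * \<beta>)" by (simp_all add: mult_ac)
  ultimately show "dv \<pi> \<alpha> \<and> dv \<rho> \<alpha>" using assms deg1_primesD(1) unfolding dv_def by blast
qed

text \<open>
The events \<open>\<pi> | \<alpha>\<close> and \<open>\<rho> | \<alpha>\<close> are independent in the limit for distinct primes, and each has
density \<open>1 / N \<pi>\<close>.
\<close>

lemma correlation:
  assumes t: "test \<phi> K r" and \<pi>: "\<pi> \<in> deg1_primes" "\<rho> \<in> deg1_primes"
  shows "((\<lambda>X. lattice_mean \<phi> (\<lambda>\<alpha>. (1 / nrm \<pi> - of_bool (dv \<pi> \<alpha>)) * (1 / nrm \<rho> - of_bool (dv \<rho> \<alpha>))) X)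
    \<longlongrightarrow> (if \<pi> = \<rho> then (1 / nrm \<pi> - 1 / (nrm \<pi>)\<^sup>2) * M \<phi> else 0)) F"
proof -
  note T = testD[OF t]
  define u where "u = 1 / real (nrm \<pi>)"
  define v where "v = 1 / real (nrm \<rho>)"
  have OKs: "\<pi> \<in> OK" "\<rho> \<in> OK" "\<pi> \<noteq> 0" "\<rho> \<noteq> 0" using deg1_primesD[OF \<pi>(1)] deg1_primesD[OF \<pi>(2)] by auto
  have one: "(lattice_mean \<phi> (\<lambda>\<alpha>. of_bool (dv \<gamma> \<alpha>)) \<longlongrightarrow> M (\<lambda>w. \<phi> (\<gamma> * w))) F" if "\<gamma> \<in> OK" "\<gamma> \<noteq> 0" for \<gamma>
  proof -
    have "lattice_mean \<phi> (\<lambda>\<alpha>. of_bool (dv \<gamma> \<alpha>)) = lattice_mean (\<lambda>w. \<phi> (\<gamma> * w)) (\<lambda>_. 1)"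
      using lattice_mean_dv[OF that, of \<phi> "\<lambda>_. 1"] by auto
    thus ?thesis using M_tendsto[OF test_scale[OF t that(2)]] by simp
  qed
  define e where "e = (if \<pi> = \<rho> then \<pi> else \<pi> * \<rho>)"
  have e: "e \<in> OK" "e \<noteq> 0" using OKs by (auto simp: e_def)
  have both: "of_bool (dv \<pi> \<alpha>) * of_bool (dv \<rho> \<alpha>) = (of_bool (dv e \<alpha>) :: real)" if "\<alpha> \<in> OK" for \<alpha>
    using dv_both_iff[OF \<pi> _ that] unfolding e_def by (cases "\<pi> = \<rho>") (auto simp: of_bool_def)
  have lim: "((\<lambda>X. 1 * ((u * v) * lattice_mean \<phi> (\<lambda>_. 1) X + (-v) * lattice_mean \<phi> (\<lambda>\<alpha>. of_bool (dv \<pi> \<alpha>)) X)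
      + 1 * ((-u) * lattice_mean \<phi> (\<lambda>\<alpha>. of_bool (dv \<rho> \<alpha>)) X + 1 * lattice_mean \<phi> (\<lambda>\<alpha>. of_bool (dv e \<alpha>)) X))
    \<longlongrightarrow> 1 * ((u * v) * M \<phi> + (-v) * M (\<lambda>w. \<phi> (\<pi> * w))) + 1 * ((-u) * M (\<lambda>w. \<phi> (\<rho> * w)) + 1 * M (\<lambda>w. \<phi> (e * w)))) F"
    by (intro tendsto_intros M_tendsto[OF t] one OKs e)
  have "M (\<lambda>w. \<phi> (e * w)) = (if \<pi> = \<rho> then u * M \<phi> else u * v * M \<phi>)"
    using M_scale[OF \<pi>(1) t] M_scale[OF \<pi>(2) test_scale[OF t OKs(3)]]
    by (auto simp: e_def u_def v_def mult.assoc)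
  hence "1 * ((u * v) * M \<phi> + (-v) * M (\<lambda>w. \<phi> (\<pi> * w))) + 1 * ((-u) * M (\<lambda>w. \<phi> (\<rho> * w)) + 1 * M (\<lambda>w. \<phi> (e * w)))
    = (if \<pi> = \<rho> then (u - u\<^sup>2) * M \<phi> else 0)"
    using M_scale[OF \<pi>(1) t] M_scale[OF \<pi>(2) t]
    by (auto simp: u_def v_def power2_eq_square algebra_simps)
  note lim = lim[unfolded this]
  have uu: "1 / real ((nrm \<pi>)\<^sup>2) = u\<^sup>2" by (simp add: u_def power_divide)
  show ?thesis unfolding uu u_def[symmetric] v_def[symmetric]
  proof (rule lattice_mean_eq_F[OF t])
    fix X :: real assume X: "X > 0"
    have "lattice_mean \<phi> (\<lambda>\<alpha>. (u - of_bool (dv \<pi> \<alpha>)) * (v - of_bool (dv \<rho> \<alpha>))) X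
        = lattice_mean \<phi> (\<lambda>\<alpha>. 1 * ((u * v) * 1 + (-v) * of_bool (dv \<pi> \<alpha>)) + 1 * ((-u) * of_bool (dv \<rho> \<alpha>) + 1 * of_bool (dv e \<alpha>))) X"
      unfolding lattice_mean_def by (intro arg_cong2[of _ _ _ _ "(/)"] infsum_cong refl arg_cong2[of _ _ _ _ "(*)"])
        (auto simp: both[symmetric] algebra_simps)
    also have "\<dots> = 1 * ((u * v) * lattice_mean \<phi> (\<lambda>_. 1) X + (-v) * lattice_mean \<phi> (\<lambda>\<alpha>. of_bool (dv \<pi> \<alpha>)) X)
      + 1 * ((-u) * lattice_mean \<phi> (\<lambda>\<alpha>. of_bool (dv \<rho> \<alpha>)) X + 1 * lattice_mean \<phi> (\<lambda>\<alpha>. of_bool (dv e \<alpha>)) X)"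
      by (simp only: lattice_mean_lin[OF T(4) X])
    finally show "lattice_mean \<phi> (\<lambda>\<alpha>. (u - of_bool (dv \<pi> \<alpha>)) * (v - of_bool (dv \<rho> \<alpha>))) X
      = 1 * ((u * v) * lattice_mean \<phi> (\<lambda>_. 1) X + (-v) * lattice_mean \<phi> (\<lambda>\<alpha>. of_bool (dv \<pi> \<alpha>)) X)
      + 1 * ((-u) * lattice_mean \<phi> (\<lambda>\<alpha>. of_bool (dv \<rho> \<alpha>)) X + 1 * lattice_mean \<phi> (\<lambda>\<alpha>. of_bool (dv e \<alpha>)) X)" .
  qed (rule lim)
qed

text \<open>
Let \<open>D \<pi>\<close> be the difference in the sum. Because \<open>\<Omega>\<close> grows by one under multiplication by \<open>\<pi>\<close>,
\<open>D \<pi> / N \<pi>\<close> is the limit mean of \<open>\<phi> g j\<close> against the centred indicator \<open>w \<pi>\<close> of divisibility by \<open>\<pi>\<close>.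
So the sum \<open>V\<close> is the mean of \<open>\<phi> g j\<close> against \<open>W = \<Sum> D \<pi> w \<pi>\<close>. As \<open>g j\<close> is
bounded, it is controlled by the mean square of \<open>W\<close>, which by the independence above is
at most a multiple of \<open>V\<close> itself. The inequality \<open>A \<bar>W\<bar> \<le> (A^2 \<tau> + W^2 / \<tau>) / 2\<close> with \<open>\<tau> = MM + 1\<close>
then closes the estimate.
\<close>

theorem turan_kubilius_dual:
  assumes t: "test \<phi> K r" and Q: "finite Q" "Q \<subseteq> deg1_primes"
  shows "(\<Sum>\<pi>\<in>Q. (L j \<phi> - nrm \<pi> * L (Suc j) (\<lambda>w. \<phi> (\<pi> * w)))\<^sup>2 / nrm \<pi>) \<le> A\<^sup>2 * (M (\<lambda>z. \<bar>\<phi> z\<bar>) + 1)\<^sup>2"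
proof -
  note T = testD[OF t]
  note ta = test_abs[OF t]
  note Ta = testD[OF ta]
  define D where "D \<pi> = L j \<phi> - nrm \<pi> * L (Suc j) (\<lambda>w. \<phi> (\<pi> * w))" for \<pi>
  define V where "V = (\<Sum>\<pi>\<in>Q. (D \<pi>)\<^sup>2 / nrm \<pi>)"
  (* MM is the total mass; adding 1 in tau keeps it positive when phi vanishes. *)
  define MM where "MM = M (\<lambda>z. \<bar>\<phi> z\<bar>)"
  define \<tau> where "\<tau> = MM + 1"
  define w where "w \<pi> \<alpha> = 1 / real (nrm \<pi>) - of_bool (dv \<pi> \<alpha>)" for \<pi> \<alpha>
  define W where "W \<alpha> = (\<Sum>\<pi>\<in>Q. D \<pi> * w \<pi> \<alpha>)" for \<alpha>
  have P: "\<pi> \<in> OK" "\<pi> \<noteq> 0" "nrm \<pi> > 0" "\<pi> \<in> deg1_primes" if "\<pi> \<in> Q" for \<pi>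
  proof -
    show p: "\<pi> \<in> deg1_primes" using that Q by blast
    show "\<pi> \<in> OK" by (rule deg1_primesD(1)[OF p])
    show "nrm \<pi> > 0" by (rule prime_gt_0_nat[OF deg1_primesD(2)[OF p]])
    thus "\<pi> \<noteq> 0" by auto
  qed
  have MM0: "MM \<ge> 0"
  proof -
    have "\<forall>\<^sub>F X in F. 0 \<le> lattice_mean (\<lambda>z. \<bar>\<phi> z\<bar>) (\<lambda>_. 1) X"
      by (rule always_eventually) (auto simp: lattice_mean_def intro!: divide_nonneg_nonneg infsum_nonneg)
    thus ?thesis unfolding MM_def by (rule tendsto_lowerbound[OF M_tendsto[OF ta] _ F_bot])
  qed
  hence \<tau>0: "\<tau> > 0" by (simp add: \<tau>_def)
  have V0: "V \<ge> 0" unfolding V_def by (intro sum_nonneg) auto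
  have lim1: "(lattice_mean \<phi> (\<lambda>\<alpha>. g j \<alpha> * W \<alpha>) \<longlongrightarrow> V) F"
  proof (rule lattice_mean_eq_F[OF t])
    fix X :: real assume X: "X > 0"
    have "lattice_mean \<phi> (\<lambda>\<alpha>. g j \<alpha> * W \<alpha>) X = lattice_mean \<phi> (\<lambda>\<alpha>. \<Sum>\<pi>\<in>Q. D \<pi> * ((1 / nrm \<pi>) * g j \<alpha> + (-1) * (g j \<alpha> * of_bool (dv \<pi> \<alpha>)))) X"
      by (simp add: W_def w_def sum_distrib_left algebra_simps)
    also have "\<dots> = (\<Sum>\<pi>\<in>Q. D \<pi> * ((1 / nrm \<pi>) * lattice_mean \<phi> (g j) X + (-1) * lattice_mean \<phi> (\<lambda>\<alpha>. g j \<alpha> * of_bool (dv \<pi> \<alpha>)) X))"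
      by (simp only: lattice_mean_sum[OF T(4) X Q(1)] lattice_mean_lin[OF T(4) X])
    also have "\<dots> = (\<Sum>\<pi>\<in>Q. D \<pi> * ((1 / nrm \<pi>) * lattice_mean \<phi> (g j) X + (-1) * lattice_mean (\<lambda>w. \<phi> (\<pi> * w)) (g (Suc j)) X))"
    proof (intro sum.cong refl)
      fix \<pi> assume "\<pi> \<in> Q"
      note P = P[OF this]
      have "lattice_mean \<phi> (\<lambda>\<alpha>. g j \<alpha> * of_bool (dv \<pi> \<alpha>)) X = lattice_mean (\<lambda>w. \<phi> (\<pi> * w)) (\<lambda>\<beta>. g j (\<pi> * \<beta>)) X"
        by (rule lattice_mean_dv[OF P(1,2)])
      also have "\<dots> = lattice_mean (\<lambda>w. \<phi> (\<pi> * w)) (g (Suc j)) X"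
        unfolding lattice_mean_def by (intro arg_cong2[of _ _ _ _ "(/)"] infsum_cong refl arg_cong2[of _ _ _ _ "(*)"] g_prime_mult P)
      finally show "D \<pi> * ((1 / nrm \<pi>) * lattice_mean \<phi> (g j) X + (-1) * lattice_mean \<phi> (\<lambda>\<alpha>. g j \<alpha> * of_bool (dv \<pi> \<alpha>)) X)
        = D \<pi> * ((1 / nrm \<pi>) * lattice_mean \<phi> (g j) X + (-1) * lattice_mean (\<lambda>w. \<phi> (\<pi> * w)) (g (Suc j)) X)" by simp
    qed
    finally show "lattice_mean \<phi> (\<lambda>\<alpha>. g j \<alpha> * W \<alpha>) X = 
      (\<Sum>\<pi>\<in>Q. D \<pi> * ((1 / nrm \<pi>) * lattice_mean \<phi> (g j) X + (-1) * lattice_mean (\<lambda>w. \<phi> (\<pi> * w)) (g (Suc j)) X))" .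
  next
    have "((\<lambda>X. \<Sum>\<pi>\<in>Q. D \<pi> * ((1 / nrm \<pi>) * lattice_mean \<phi> (g j) X + (-1) * lattice_mean (\<lambda>w. \<phi> (\<pi> * w)) (g (Suc j)) X))
      \<longlongrightarrow> (\<Sum>\<pi>\<in>Q. D \<pi> * ((1 / nrm \<pi>) * L j \<phi> + (-1) * L (Suc j) (\<lambda>w. \<phi> (\<pi> * w))))) F"
      using P by (intro tendsto_intros L_tendsto[OF t] L_tendsto[OF test_scale[OF t]]) auto
    also have "(\<Sum>\<pi>\<in>Q. D \<pi> * ((1 / nrm \<pi>) * L j \<phi> + (-1) * L (Suc j) (\<lambda>w. \<phi> (\<pi> * w)))) = V"
      unfolding V_def using P by (intro sum.cong refl) (simp add: D_def power2_eq_square field_simps)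
    finally show "((\<lambda>X. \<Sum>\<pi>\<in>Q. D \<pi> * ((1 / nrm \<pi>) * lattice_mean \<phi> (g j) X + (-1) * lattice_mean (\<lambda>w. \<phi> (\<pi> * w)) (g (Suc j)) X)) \<longlongrightarrow> V) F" .
  qed
  define V2 where "V2 = (\<Sum>\<pi>\<in>Q. D \<pi> * (D \<pi> * ((1 / nrm \<pi> - 1 / (nrm \<pi>)\<^sup>2) * MM)))"
  have lim2: "(lattice_mean (\<lambda>z. \<bar>\<phi> z\<bar>) (\<lambda>\<alpha>. (W \<alpha>)\<^sup>2) \<longlongrightarrow> V2) F"
  proof (rule lattice_mean_eq_F[OF ta])
    fix X :: real assume X: "X > 0"
    have "lattice_mean (\<lambda>z. \<bar>\<phi> z\<bar>) (\<lambda>\<alpha>. (W \<alpha>)\<^sup>2) X = lattice_mean (\<lambda>z. \<bar>\<phi> z\<bar>) (\<lambda>\<alpha>. \<Sum>\<pi>\<in>Q. D \<pi> * (\<Sum>\<rho>\<in>Q. D \<rho> * (w \<pi> \<alpha> * w \<rho> \<alpha>))) X"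
      by (simp add: W_def power2_eq_square sum_product sum_distrib_left mult_ac)
    also have "\<dots> = (\<Sum>\<pi>\<in>Q. D \<pi> * (\<Sum>\<rho>\<in>Q. D \<rho> * lattice_mean (\<lambda>z. \<bar>\<phi> z\<bar>) (\<lambda>\<alpha>. w \<pi> \<alpha> * w \<rho> \<alpha>) X))"
      by (simp only: lattice_mean_sum[OF Ta(4) X Q(1)])
    finally show "lattice_mean (\<lambda>z. \<bar>\<phi> z\<bar>) (\<lambda>\<alpha>. (W \<alpha>)\<^sup>2) X = (\<Sum>\<pi>\<in>Q. D \<pi> * (\<Sum>\<rho>\<in>Q. D \<rho> * lattice_mean (\<lambda>z. \<bar>\<phi> z\<bar>) (\<lambda>\<alpha>. w \<pi> \<alpha> * w \<rho> \<alpha>) X))" .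
  next
    have "((\<lambda>X. \<Sum>\<pi>\<in>Q. D \<pi> * (\<Sum>\<rho>\<in>Q. D \<rho> * lattice_mean (\<lambda>z. \<bar>\<phi> z\<bar>) (\<lambda>\<alpha>. w \<pi> \<alpha> * w \<rho> \<alpha>) X))
      \<longlongrightarrow> (\<Sum>\<pi>\<in>Q. D \<pi> * (\<Sum>\<rho>\<in>Q. D \<rho> * (if \<pi> = \<rho> then (1 / nrm \<pi> - 1 / (nrm \<pi>)\<^sup>2) * MM else 0)))) F"
      unfolding w_def MM_def using P by (intro tendsto_intros correlation[OF ta]) auto
    also have "(\<Sum>\<pi>\<in>Q. D \<pi> * (\<Sum>\<rho>\<in>Q. D \<rho> * (if \<pi> = \<rho> then (1 / nrm \<pi> - 1 / (nrm \<pi>)\<^sup>2) * MM else 0))) = V2"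
      unfolding V2_def
    proof (intro sum.cong refl arg_cong2[of _ _ _ _ "(*)"])
      fix \<pi> assume "\<pi> \<in> Q"
      have "(\<Sum>\<rho>\<in>Q. D \<rho> * (if \<pi> = \<rho> then (1 / nrm \<pi> - 1 / (nrm \<pi>)\<^sup>2) * MM else 0))
        = (\<Sum>\<rho>\<in>Q. if \<pi> = \<rho> then D \<rho> * ((1 / nrm \<pi> - 1 / (nrm \<pi>)\<^sup>2) * MM) else 0)"
        by (intro sum.cong) auto
      also have "\<dots> = D \<pi> * ((1 / nrm \<pi> - 1 / (nrm \<pi>)\<^sup>2) * MM)"
        using \<open>\<pi> \<in> Q\<close> Q(1) by (subst sum.delta') auto
      finally show "(\<Sum>\<rho>\<in>Q. D \<rho> * (if \<pi> = \<rho> then (1 / nrm \<pi> - 1 / (nrm \<pi>)\<^sup>2) * MM else 0))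
        = D \<pi> * ((1 / nrm \<pi> - 1 / (nrm \<pi>)\<^sup>2) * MM)" .
    qed
    finally show "((\<lambda>X. \<Sum>\<pi>\<in>Q. D \<pi> * (\<Sum>\<rho>\<in>Q. D \<rho> * lattice_mean (\<lambda>z. \<bar>\<phi> z\<bar>) (\<lambda>\<alpha>. w \<pi> \<alpha> * w \<rho> \<alpha>) X)) \<longlongrightarrow> V2) F" .
  qed
  have V2: "V2 \<le> V * MM"
    unfolding V2_def V_def sum_distrib_right
  proof (rule sum_mono)
    fix \<pi>
    have "(D \<pi>)\<^sup>2 * ((1 / nrm \<pi> - 1 / (nrm \<pi>)\<^sup>2) * MM) \<le> (D \<pi>)\<^sup>2 * ((1 / nrm \<pi>) * MM)"
      using MM0 by (intro mult_left_mono mult_right_mono) auto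
    thus "D \<pi> * (D \<pi> * ((1 / nrm \<pi> - 1 / (nrm \<pi>)\<^sup>2) * MM)) \<le> (D \<pi>)\<^sup>2 / nrm \<pi> * MM"
      by (simp add: power2_eq_square mult_ac)
  qed
  have "V \<le> (A\<^sup>2 * \<tau> / 2) * MM + (1 / (2 * \<tau>)) * V2"
  proof (rule tendsto_le[OF F_bot _ lim1])
    show "((\<lambda>X. (A\<^sup>2 * \<tau> / 2) * lattice_mean (\<lambda>z. \<bar>\<phi> z\<bar>) (\<lambda>_. 1) X + (1 / (2 * \<tau>)) * lattice_mean (\<lambda>z. \<bar>\<phi> z\<bar>) (\<lambda>\<alpha>. (W \<alpha>)\<^sup>2) X)
      \<longlongrightarrow> (A\<^sup>2 * \<tau> / 2) * MM + (1 / (2 * \<tau>)) * V2) F"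
      unfolding MM_def by (intro tendsto_intros M_tendsto[OF ta] lim2)
    show "\<forall>\<^sub>F X in F. lattice_mean \<phi> (\<lambda>\<alpha>. g j \<alpha> * W \<alpha>) X \<le> 
      (A\<^sup>2 * \<tau> / 2) * lattice_mean (\<lambda>z. \<bar>\<phi> z\<bar>) (\<lambda>_. 1) X + (1 / (2 * \<tau>)) * lattice_mean (\<lambda>z. \<bar>\<phi> z\<bar>) (\<lambda>\<alpha>. (W \<alpha>)\<^sup>2) X"
      using eventually_F[OF eventually_gt_at_top[of 0]]
    proof eventually_elim
      case (elim X)
      have pw: "\<phi> z * (g j \<alpha> * W \<alpha>) \<le> \<bar>\<phi> z\<bar> * ((A\<^sup>2 * \<tau> / 2) * 1 + (1 / (2 * \<tau>)) * (W \<alpha>)\<^sup>2)" for z \<alpha>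
      proof -
        have "\<phi> z * (g j \<alpha> * W \<alpha>) \<le> \<bar>\<phi> z * (g j \<alpha> * W \<alpha>)\<bar>" by simp
        also have "\<dots> = \<bar>\<phi> z\<bar> * (\<bar>g j \<alpha>\<bar> * \<bar>W \<alpha>\<bar>)" by (simp add: abs_mult)
        also have "\<dots> \<le> \<bar>\<phi> z\<bar> * (A * \<bar>W \<alpha>\<bar>)" by (intro mult_left_mono mult_right_mono g_bound) auto
        also have "A * \<bar>W \<alpha>\<bar> \<le> (A\<^sup>2 * \<tau> / 2) * 1 + (1 / (2 * \<tau>)) * (W \<alpha>)\<^sup>2"
        proof -
          have "0 \<le> (A * \<tau> - \<bar>W \<alpha>\<bar>)\<^sup>2 / (2 * \<tau>)" using \<tau>0 by simp
          also have "\<dots> = (A\<^sup>2 * \<tau> / 2) * 1 + (1 / (2 * \<tau>)) * (W \<alpha>)\<^sup>2 - A * \<bar>W \<alpha>\<bar>"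
            using \<tau>0 by (simp add: power2_diff power_mult_distrib field_simps power2_eq_square)
          finally show ?thesis by linarith
        qed
        finally show ?thesis by (simp add: mult_left_mono)
      qed
      have "lattice_mean \<phi> (\<lambda>\<alpha>. g j \<alpha> * W \<alpha>) X \<le> lattice_mean (\<lambda>z. \<bar>\<phi> z\<bar>) (\<lambda>\<alpha>. (A\<^sup>2 * \<tau> / 2) * 1 + (1 / (2 * \<tau>)) * (W \<alpha>)\<^sup>2) X"
        unfolding lattice_mean_eq[OF T(4) elim] lattice_mean_eq[OF Ta(4) elim]
        by (intro divide_right_mono sum_mono pw) simp
      also have "\<dots> = (A\<^sup>2 * \<tau> / 2) * lattice_mean (\<lambda>z. \<bar>\<phi> z\<bar>) (\<lambda>_. 1) X + (1 / (2 * \<tau>)) * lattice_mean (\<lambda>z. \<bar>\<phi> z\<bar>) (\<lambda>\<alpha>. (W \<alpha>)\<^sup>2) X"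
        by (rule lattice_mean_lin[OF Ta(4) elim])
      finally show ?case .
    qed
  qed
  also have "\<dots> \<le> (A\<^sup>2 * \<tau> / 2) * \<tau> + (1 / (2 * \<tau>)) * (V * \<tau>)"
    using \<tau>0 V0 MM0 by (intro add_mono mult_left_mono order_trans[OF V2]) (auto simp: \<tau>_def)
  also have "\<dots> = (A\<^sup>2 * \<tau>\<^sup>2 + V) / 2" using \<tau>0 by (simp add: power2_eq_square field_simps)
  finally have "V \<le> A\<^sup>2 * \<tau>\<^sup>2" by (simp add: field_simps)
  thus ?thesis by (simp add: V_def D_def \<tau>_def MM_def)
qed

end

section \<open>Sets of primes with finite logarithmic mass, and the angles of split primes\<close>

text \<open>
Multiples of a small positive element are dense.
\<close>

lemma closed_subgroup_real_UNIV:
  fixes A :: "real set"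
  assumes diff: "\<And>x y. x \<in> A \<Longrightarrow> y \<in> A \<Longrightarrow> x - y \<in> A"
    and closed: "\<And>x. (\<And>\<delta>. \<delta> > 0 \<Longrightarrow> \<exists>y\<in>A. \<bar>y - x\<bar> \<le> \<delta>) \<Longrightarrow> x \<in> A"
    and small: "\<And>\<eta>. \<eta> > 0 \<Longrightarrow> \<exists>x\<in>A. 0 < x \<and> x < \<eta>"
  shows "x \<in> A"
proof (rule closed)
  fix \<delta> :: real assume "\<delta> > 0"
  then obtain y where y: "y \<in> A" "0 < y" "y < \<delta>" using small by blast
  have zero: "0 \<in> A" using diff[OF y(1) y(1)] by simp
  have neg: "- u \<in> A" if "u \<in> A" for u using diff[OF zero that] by simp
  have nat: "real n * y \<in> A" for n
  proof (induction n)
    case (Suc n)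
    thus ?case using diff[OF Suc neg[OF y(1)]] by (simp add: algebra_simps)
  qed (use zero in simp)
  define n where "n = \<lfloor>x / y\<rfloor>"
  have "of_int n * y \<in> A"
  proof (cases "n \<ge> 0")
    case True thus ?thesis using nat[of "nat n"] by simp
  next
    case False thus ?thesis using neg[OF nat[of "nat (-n)"]] by simp
  qed
  moreover have "\<bar>of_int n * y - x\<bar> \<le> \<delta>"
  proof -
    have "of_int n \<le> x / y" "x / y < of_int n + 1" unfolding n_def by linarith+
    hence "of_int n * y \<le> x" "x < of_int n * y + y" using y by (simp_all add: field_simps)
    thus ?thesis using y by linarith
  qed
  ultimately show "\<exists>y\<in>A. \<bar>y - x\<bar> \<le> \<delta>" by blast
qed

context heegner_order begin

text \<open>
Sets of finite logarithmic mass: the exceptional sets produced by \<open>turan_kubilius_dual\<close>. The set of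
all degree one primes is not small.
\<close>

definition small :: "complex set \<Rightarrow> bool" where
  "small E \<longleftrightarrow> E \<subseteq> deg1_primes \<and> (\<exists>C. \<forall>Q. finite Q \<and> Q \<subseteq> E \<longrightarrow> (\<Sum>\<pi>\<in>Q. 1 / nrm \<pi>) \<le> C)"

lemma smallI:
  "E \<subseteq> deg1_primes \<Longrightarrow> (\<And>Q. finite Q \<Longrightarrow> Q \<subseteq> E \<Longrightarrow> (\<Sum>\<pi>\<in>Q. 1 / real (nrm \<pi>)) \<le> C) \<Longrightarrow> small E"
  unfolding small_def by auto

lemma smallE:
  assumes "small E"
  obtains C where "\<And>Q. finite Q \<Longrightarrow> Q \<subseteq> E \<Longrightarrow> (\<Sum>\<pi>\<in>Q. 1 / real (nrm \<pi>)) \<le> C"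
  using assms unfolding small_def by auto

lemma small_deg1_primes: "small E \<Longrightarrow> E \<subseteq> deg1_primes" by (simp add: small_def)

lemma small_subset: "small E \<Longrightarrow> D \<subseteq> E \<Longrightarrow> small D"
  unfolding small_def by (meson subset_trans)

lemma small_empty: "small {}"
  unfolding small_def by (auto intro!: exI[of _ 0])

lemma small_Un:
  assumes "small D" "small E"
  shows "small (D \<union> E)"
proof -
  obtain C1 where C1: "\<And>Q. finite Q \<Longrightarrow> Q \<subseteq> D \<Longrightarrow> (\<Sum>\<pi>\<in>Q. 1 / nrm \<pi>) \<le> C1" by (rule smallE[OF assms(1)]) blast
  obtain C2 where C2: "\<And>Q. finite Q \<Longrightarrow> Q \<subseteq> E \<Longrightarrow> (\<Sum>\<pi>\<in>Q. 1 / nrm \<pi>) \<le> C2" by (rule smallE[OF assms(2)]) blast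
  have "(\<Sum>\<pi>\<in>Q. 1 / nrm \<pi>) \<le> C1 + C2" if "finite Q" "Q \<subseteq> D \<union> E" for Q
  proof -
    have "(\<Sum>\<pi>\<in>Q. 1 / nrm \<pi>) = (\<Sum>\<pi>\<in>Q \<inter> D. 1 / nrm \<pi>) + (\<Sum>\<pi>\<in>Q - D. 1 / nrm \<pi>)"
      using sum.Int_Diff[OF that(1), of "\<lambda>\<pi>. 1 / real (nrm \<pi>)" D] .
    also have "\<dots> \<le> C1 + C2" using that by (intro add_mono C1 C2) auto
    finally show ?thesis .
  qed
  thus ?thesis using assms small_deg1_primes by (intro smallI[of _ "C1 + C2"]) auto
qed

lemma small_Union: "finite I \<Longrightarrow> (\<And>i. i \<in> I \<Longrightarrow> small (f i)) \<Longrightarrow> small (\<Union>i\<in>I. f i)"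
  by (induction I rule: finite_induct) (auto intro: small_empty small_Un)

lemma summable_deg1_primes: "s > 1 \<Longrightarrow> E \<subseteq> deg1_primes \<Longrightarrow> (\<lambda>\<pi>. cmod \<pi> powr (-2 * s)) summable_on E"
  using deg1_primes_sub by (intro summable_on_subset[OF summable_cmod_powr]) auto

lemma cmod_powr_nrm: "\<alpha> \<in> OK \<Longrightarrow> cmod \<alpha> powr (-2 * s) = real (nrm \<alpha>) powr (-s)"
  using powr_powr[of "cmod \<alpha>" 2 "-s"] by (simp add: real_nrm)

lemma cmod_powr_le_inverse_nrm: "\<pi> \<in> deg1_primes \<Longrightarrow> s \<ge> 1 \<Longrightarrow> cmod \<pi> powr (-2 * s) \<le> 1 / nrm \<pi>"
proof -
  assume p: "\<pi> \<in> deg1_primes" and s: "s \<ge> 1"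
  have "nrm \<pi> \<ge> 1" using prime_ge_1_nat[OF deg1_primesD(2)[OF p]] .
  hence "real (nrm \<pi>) powr (-s) \<le> real (nrm \<pi>) powr (-1)" using s by (intro powr_mono) auto
  thus ?thesis using cmod_powr_nrm[OF deg1_primesD(1)[OF p]] by (simp add: powr_minus divide_inverse)
qed

lemma small_infsum:
  assumes "small E"
  obtains C where "\<And>s. s > 1 \<Longrightarrow> infsum (\<lambda>\<pi>. cmod \<pi> powr (-2 * s)) E \<le> C"
proof -
  obtain C where C: "\<And>Q. finite Q \<Longrightarrow> Q \<subseteq> E \<Longrightarrow> (\<Sum>\<pi>\<in>Q. 1 / nrm \<pi>) \<le> C" by (rule smallE[OF assms]) blast
  have E: "E \<subseteq> deg1_primes" by (rule small_deg1_primes[OF assms])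
  have "infsum (\<lambda>\<pi>. cmod \<pi> powr (-2 * s)) E \<le> C" if s: "s > 1" for s
  proof (rule infsum_le_finite_sums[OF summable_deg1_primes[OF s E]])
    fix Q assume Q: "finite Q" "Q \<subseteq> E"
    have "(\<Sum>\<pi>\<in>Q. cmod \<pi> powr (-2 * s)) \<le> (\<Sum>\<pi>\<in>Q. 1 / nrm \<pi>)"
      using Q E s by (intro sum_mono cmod_powr_le_inverse_nrm) auto
    also have "\<dots> \<le> C" by (rule C[OF Q])
    finally show "(\<Sum>\<pi>\<in>Q. cmod \<pi> powr (-2 * s)) \<le> C" .
  qed
  thus ?thesis using that by blast
qed

lemma ln_unbounded: "\<forall>\<^sub>F s::real in at_right 1. ln (1 / (s - 1)) > C"
proof -
  have "filterlim (\<lambda>s::real. ln (1 / (s - 1))) at_top (at_right 1)" by real_asymp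
  thus ?thesis by (simp add: filterlim_at_top_dense)
qed

text \<open>
Every contradiction about primes below comes from this: the logarithmic mass of the degree one
primes at \<open>s > 1\<close> is \<open>ln (1 / (s - 1))\<close> up to a bounded error, so it cannot be a proper fraction of it.
\<close>

lemma sparse_contradiction:
  assumes c: "c < 1" and H: "\<forall>\<^sub>F s in at_right 1. infsum (\<lambda>\<pi>. cmod \<pi> powr (-2 * s)) deg1_primes \<le> C + c * ln (1 / (s - 1))"
  shows False
proof -
  obtain C' where C': "\<forall>\<^sub>F s in at_right 1. infsum (\<lambda>\<pi>. cmod \<pi> powr (-2 * s)) deg1_primes \<ge> ln (1 / (s - 1)) - C'"
    using deg1_primes_sum_lower by blast
  have "\<forall>\<^sub>F s::real in at_right 1. False"
    using H C' ln_unbounded[of "(C + C') / (1 - c)"]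
  proof eventually_elim
    case (elim s)
    have "(1 - c) * ln (1 / (s - 1)) \<le> C + C'" using elim(1,2) by (simp add: algebra_simps)
    thus False using elim(3) c by (simp add: field_simps)
  qed
  thus False by simp
qed

lemma deg1_primes_not_small: "\<not> small deg1_primes"
proof
  assume "small deg1_primes"
  then obtain C where C: "\<And>s. s > 1 \<Longrightarrow> infsum (\<lambda>\<pi>. cmod \<pi> powr (-2 * s)) deg1_primes \<le> C" using small_infsum by metis
  have "\<forall>\<^sub>F s::real in at_right 1. s > 1" by (simp add: eventually_at_right_less)
  hence "\<forall>\<^sub>F s in at_right 1. infsum (\<lambda>\<pi>. cmod \<pi> powr (-2 * s)) deg1_primes \<le> C + 0 * ln (1 / (s - 1))"
    by eventually_elim (use C in simp)
  thus False by (rule sparse_contradiction[rotated]) simp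
qed

lemma small_infinite_complement: "small E \<Longrightarrow> \<exists>\<pi>. \<pi> \<in> deg1_primes - E"
  using deg1_primes_not_small small_subset by blast

lemma canon_cnj_inj: "inj_on (\<lambda>\<pi>. canon (cnj \<pi>)) deg1_primes"
proof (rule inj_onI)
  fix \<pi> \<rho> assume p: "\<pi> \<in> deg1_primes" "\<rho> \<in> deg1_primes" "canon (cnj \<pi>) = canon (cnj \<rho>)"
  have "assoc (cnj \<pi>) (cnj \<rho>)"
    using canon(2)[of "cnj \<pi>"] canon(2)[of "cnj \<rho>"] p deg1_primesD(1) assoc_sym assoc_trans by (metis OK_cnj)
  hence "dv \<pi> \<rho>" using dv_cnj[of "cnj \<pi>" "cnj \<rho>"] by (simp add: assoc_def)
  thus "\<pi> = \<rho>" using prime_reps_dv_eq[of \<pi> \<rho>] p by (auto simp: prime_reps_def)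
qed

lemma canon_cnj_deg1_primes: "\<pi> \<in> deg1_primes \<Longrightarrow> canon (cnj \<pi>) \<in> deg1_primes" "\<pi> \<in> deg1_primes \<Longrightarrow> nrm (canon (cnj \<pi>)) = nrm \<pi>"
  using canon_in_deg1_primes[of "cnj \<pi>"] canon(3)[of "cnj \<pi>"] deg1_primesD[of \<pi>] by auto

text \<open>
Conjugation permutes the degree one primes up to associates and preserves norms.
\<close>

lemma small_conj:
  assumes "small E"
  shows "small {\<pi>\<in>deg1_primes. canon (cnj \<pi>) \<in> E}"
proof -
  obtain C where C: "\<And>Q. finite Q \<Longrightarrow> Q \<subseteq> E \<Longrightarrow> (\<Sum>\<pi>\<in>Q. 1 / nrm \<pi>) \<le> C" by (rule smallE[OF assms]) blast
  have "(\<Sum>\<pi>\<in>Q. 1 / nrm \<pi>) \<le> C" if Q: "finite Q" "Q \<subseteq> {\<pi>\<in>deg1_primes. canon (cnj \<pi>) \<in> E}" for Q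
  proof -
    have "inj_on (\<lambda>\<pi>. canon (cnj \<pi>)) Q" by (rule inj_on_subset[OF canon_cnj_inj]) (use Q in auto)
    hence "(\<Sum>\<pi>\<in>(\<lambda>\<pi>. canon (cnj \<pi>)) ` Q. 1 / real (nrm \<pi>)) = (\<Sum>\<pi>\<in>Q. 1 / nrm (canon (cnj \<pi>)))"
      by (simp add: sum.reindex)
    also have "\<dots> = (\<Sum>\<pi>\<in>Q. 1 / nrm \<pi>)" using Q canon_cnj_deg1_primes(2) by (intro sum.cong) auto
    finally show ?thesis using C[of "(\<lambda>\<pi>. canon (cnj \<pi>)) ` Q"] Q by auto
  qed
  thus ?thesis by (intro smallI[of _ C]) auto
qed

text \<open>
The representative of \<open>cnj \<pi>\<close> differs from it by a unit, whose 12th power is 1.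
\<close>

lemma canon_cnj_quotient_power:
  assumes "\<pi> \<in> deg1_primes" "12 dvd k"
  shows "(\<pi> / canon (cnj \<pi>)) ^ k = (\<pi> / cnj \<pi>) ^ k"
proof -
  have c: "cnj \<pi> \<in> OK" using deg1_primesD[OF assms(1)] by auto
  note can = canon[OF c]
  have \<pi>0: "cnj \<pi> \<noteq> 0" using deg1_primesD(2)[OF assms(1)] by auto
  obtain u where u: "u \<in> OK" "canon (cnj \<pi>) = cnj \<pi> * u" using can(2) unfolding assoc_def dv_def by blast
  have "nrm (cnj \<pi>) * nrm u = nrm (cnj \<pi>)" using can(3) u c by (simp add: nrm_mult)
  hence "nrm u = 1" using nrm_eq_0_iff[OF c] \<pi>0 by simp
  hence "u ^ 12 = 1" by (rule unit_power_12[OF u(1)])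
  moreover obtain l where "k = 12 * l" using assms(2) by blast
  ultimately have "u ^ k = 1" by (simp add: power_mult)
  thus ?thesis unfolding u(2) by (simp add: power_divide power_mult_distrib)
qed

text \<open>
Otherwise the sum of \<open>Re (\<pi> / cnj \<pi>)^k N(\<pi>)^(-s)\<close> would be at least half the logarithmic mass, up to a bounded
error, although it stays bounded.
\<close>

lemma split_angles_spread:
  assumes "small E" "k > 0" "12 dvd k"
  shows "\<exists>\<pi>\<in>deg1_primes - E. Re ((\<pi> / cnj \<pi>) ^ k) \<le> 1 / 2"
proof (rule ccontr)
  assume H: "\<not> ?thesis"
  hence H: "Re ((\<pi> / cnj \<pi>) ^ k) > 1 / 2" if "\<pi> \<in> deg1_primes - E" for \<pi> using that by force
  have E: "E \<subseteq> deg1_primes" using assms(1) by (simp add: small_def)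
  obtain CE where CE: "\<And>s. s > 1 \<Longrightarrow> infsum (\<lambda>\<pi>. cmod \<pi> powr (-2 * s)) E \<le> CE" using small_infsum[OF assms(1)] by metis
  have "6 dvd k" using dvd_trans[of 6 12 k] assms(3) by simp
  then obtain C where C: "\<forall>\<^sub>F s in at_right 1. infsum (\<lambda>\<pi>. Re (hecke_term k s \<pi>)) deg1_primes \<le> C"
    using deg1_primes_angle_sum_bounded assms(2) by blast
  have "\<forall>\<^sub>F s::real in at_right 1. s > 1" by (simp add: eventually_at_right_less)
  with C have "\<forall>\<^sub>F s in at_right 1. infsum (\<lambda>\<pi>. cmod \<pi> powr (-2 * s)) deg1_primes \<le> (2 * C + 3 * CE) + 0 * ln (1 / (s - 1))"
  proof eventually_elim
    case (elim s)
    let ?x = "\<lambda>\<pi>. cmod \<pi> powr (-2 * s)"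
    have Sx: "?x summable_on D" if "D \<subseteq> deg1_primes" for D using summable_deg1_primes[OF elim(2) that] .
    have SR: "(\<lambda>\<pi>. Re (hecke_term k s \<pi>)) summable_on D" if "D \<subseteq> deg1_primes" for D
      using that deg1_primes_sub by (intro summable_on_Re hecke_term_summable elim) auto
    have part: "deg1_primes = E \<union> (deg1_primes - E)" using E by blast
    have "infsum ?x deg1_primes = infsum ?x E + infsum ?x (deg1_primes - E)"
      using infsum_Un_disjoint[OF Sx Sx, of E "deg1_primes - E"] part E by simp
    moreover have "infsum (\<lambda>\<pi>. Re (hecke_term k s \<pi>)) deg1_primes = infsum (\<lambda>\<pi>. Re (hecke_term k s \<pi>)) E + infsum (\<lambda>\<pi>. Re (hecke_term k s \<pi>)) (deg1_primes - E)"
      using infsum_Un_disjoint[OF SR SR, of E "deg1_primes - E"] part E by simp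
    moreover have "infsum (\<lambda>\<pi>. Re (hecke_term k s \<pi>)) (deg1_primes - E) \<ge> infsum (\<lambda>\<pi>. (1 / 2) * ?x \<pi>) (deg1_primes - E)"
    proof (rule infsum_mono[OF summable_on_cmult_right[OF Sx] SR])
      fix \<pi> assume "\<pi> \<in> deg1_primes - E"
      thus "(1 / 2) * ?x \<pi> \<le> Re (hecke_term k s \<pi>)"
        using H[of \<pi>] mult_right_mono[of "1 / 2" "Re ((\<pi> / cnj \<pi>) ^ k)" "?x \<pi>"] by (simp add: hecke_term_def)
    qed auto
    moreover have "infsum (\<lambda>\<pi>. (1 / 2) * ?x \<pi>) (deg1_primes - E) = (1 / 2) * infsum ?x (deg1_primes - E)"
      by (rule infsum_cmult_right')
    moreover have "\<bar>infsum (\<lambda>\<pi>. Re (hecke_term k s \<pi>)) E\<bar> \<le> infsum ?x E"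
    proof -
      have "norm (infsum (\<lambda>\<pi>. Re (hecke_term k s \<pi>)) E) \<le> infsum ?x E"
      proof (rule norm_infsum_le[OF has_sum_infsum[OF SR[OF E]] has_sum_infsum[OF Sx[OF E]]])
        fix \<pi>
        show "norm (Re (hecke_term k s \<pi>)) \<le> ?x \<pi>" using abs_Re_le_cmod[of "hecke_term k s \<pi>"] by (simp only: norm_hecke_term real_norm_def)
      qed
      thus ?thesis by simp
    qed
    ultimately show ?case using CE[OF elim(2)] elim(1) by linarith
  qed
  thus False by (rule sparse_contradiction[rotated]) simp
qed

end

section \<open>Primes in short intervals and the norms of split primes\<close>

lemma prod_primes_dvd:
  fixes N :: nat
  assumes "finite A" "\<And>p. p \<in> A \<Longrightarrow> prime p \<and> p dvd N"
  shows "\<Prod>A dvd N"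
  using assms
proof (induction A rule: finite_induct)
  case (insert p A)
  have "coprime p (\<Prod>A)"
  proof (rule prod_coprime_right)
    fix r assume "r \<in> A"
    thus "coprime p r" using insert by (intro primes_coprime) auto
  qed
  thus ?case using insert by (auto intro: divides_mult)
qed simp

lemma fact_add_le: "fact (n + h) \<le> fact n * (n + h) ^ h" for n h :: nat
proof (induction h)
  case (Suc h)
  have "fact (n + Suc h) = (n + Suc h) * fact (n + h)" by simp
  also have "\<dots> \<le> (n + Suc h) * (fact n * (n + h) ^ h)" using Suc by (rule mult_left_mono) simp
  also have "\<dots> \<le> (n + Suc h) * (fact n * (n + Suc h) ^ h)"
    by (intro mult_left_mono power_mono) auto
  finally show ?case by (simp add: mult_ac)
qed simp

lemma power_le_exp_fact: "real h ^ h \<le> exp (real h) * fact h"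
proof -
  have "(\<Sum>k\<in>{h}. real h ^ k /\<^sub>R fact k) \<le> exp (real h)"
    unfolding exp_def by (rule sum_le_suminf[OF summable_exp_generic]) auto
  thus ?thesis by (simp add: field_simps)
qed

text \<open>
All these primes divide the binomial coefficient \<open>n + h choose h\<close>, which is at most
\<open>(e (n + h) / h)^h\<close>.
\<close>

lemma card_primes_short_interval:
  fixes n h :: nat
  assumes h: "1 \<le> h" "h \<le> n" and n: "n \<ge> 2"
  shows "real (card {p. prime p \<and> n < p \<and> p \<le> n + h}) * ln (real n) \<le> real h * (1 + ln (real (n + h) / real h))"
proof -
  define A where "A = {p. prime p \<and> n < p \<and> p \<le> n + h}"
  have fin: "finite A" by (rule finite_subset[of _ "{..n + h}"]) (auto simp: A_def)
  define N where "N = (n + h) choose h"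
  have fN: "fact h * fact n * N = (fact (n + h) :: nat)"
    using binomial_fact_lemma[of h "n + h"] by (simp add: N_def)
  have N0: "N > 0" by (simp add: N_def)
  have "\<Prod>A dvd N"
  proof (rule prod_primes_dvd[OF fin])
    fix p assume p: "p \<in> A"
    hence pp: "prime p" by (simp add: A_def)
    have "p dvd fact h * fact n * N" unfolding fN using p by (simp add: A_def prime_dvd_fact_iff)
    moreover have "\<not> p dvd fact h" "\<not> p dvd fact n"
      using p h by (simp_all add: A_def prime_dvd_fact_iff)
    ultimately show "prime p \<and> p dvd N" using pp by (simp add: prime_dvd_mult_iff)
  qed
  hence "\<Prod>A \<le> N" using N0 by (rule dvd_imp_le)
  moreover have "n ^ card A \<le> \<Prod>A"
    using prod_mono[of A "\<lambda>_. n" "\<lambda>p. p"] by (auto simp: A_def)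
  ultimately have 1: "real (n ^ card A) \<le> real N" by linarith
  have "fact n * (fact h * N) \<le> fact n * (n + h) ^ h" using fact_add_le[of n h] fN by (simp add: mult_ac)
  hence "fact h * N \<le> (n + h) ^ h" by simp
  hence "real (fact h * N) \<le> real ((n + h) ^ h)" by (rule of_nat_mono)
  hence 2: "real N * fact h \<le> real (n + h) ^ h" by (simp add: mult.commute)
  have "real (n ^ card A) * real h ^ h \<le> real N * (exp (real h) * fact h)"
    using 1 power_le_exp_fact[of h] by (intro mult_mono) auto
  also have "\<dots> \<le> real (n + h) ^ h * exp (real h)"
    using mult_right_mono[OF 2, of "exp (real h)"] by (simp add: mult_ac)
  finally have "real n ^ card A * real h ^ h \<le> real (n + h) ^ h * exp (real h)" by simp
  hence "real n ^ card A \<le> (real (n + h) / real h) ^ h * exp (real h)"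
    using h by (simp add: power_divide field_simps)
  hence "ln (real n ^ card A) \<le> ln ((real (n + h) / real h) ^ h * exp (real h))"
    using n h by (subst ln_le_cancel_iff) auto
  also have "\<dots> = real h * ln (real (n + h) / real h) + real h"
    using n h by (subst ln_mult) (auto simp: ln_realpow)
  also have "ln (real n ^ card A) = real (card A) * ln (real n)" using n by (simp add: ln_realpow)
  finally show ?thesis by (simp add: A_def algebra_simps)
qed

text \<open>
Take \<open>h = \<lfloor>\<delta> n\<rfloor>\<close> in the previous bound: the resulting constant \<open>\<delta> (1 + ln (3 / \<delta>))\<close> tends to 0 with
\<open>\<delta>\<close>.
\<close>

lemma primes_in_short_intervals:
  fixes \<eta> :: real
  assumes "\<eta> > 0"
  obtains \<delta> n0 where "\<delta> > 0" "\<And>n::nat. n \<ge> n0 \<Longrightarrow> n \<ge> 2 \<and>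
    real (card {p. prime p \<and> n < p \<and> real p \<le> (1 + \<delta>) * real n}) \<le> \<eta> * real n / ln (real n)"
proof -
  have "((\<lambda>d::real. d * (1 + ln (3 / d))) \<longlongrightarrow> 0) (at_right 0)" by real_asymp
  hence "\<forall>\<^sub>F d::real in at_right 0. d * (1 + ln (3 / d)) < \<eta>" using assms by (rule order_tendstoD(2))
  moreover have "\<forall>\<^sub>F d::real in at_right 0. 0 < d \<and> d < 1 / 2"
    using eventually_at_right_real[of 0 "1/2"] by (rule eventually_mono) auto
  ultimately have "\<forall>\<^sub>F d::real in at_right 0. d * (1 + ln (3 / d)) < \<eta> \<and> 0 < d \<and> d < 1 / 2"
    by eventually_elim auto
  then obtain d where d: "d * (1 + ln (3 / d)) < \<eta>" "0 < d" "d < 1 / 2"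
    using eventually_happens'[OF trivial_limit_at_right_real] by blast
  define n0 where "n0 = max 2 (nat \<lceil>1 / d\<rceil>)"
  show ?thesis
  proof (rule that[OF d(2)])
    fix n :: nat assume "n \<ge> n0"
    hence n: "n \<ge> 2" "real n \<ge> 1 / d" unfolding n0_def by linarith+
    define h where "h = nat \<lfloor>d * real n\<rfloor>"
    have dn: "d * real n \<ge> 1" using n(2) d by (simp add: field_simps)
    have hr: "real h = of_int \<lfloor>d * real n\<rfloor>" unfolding h_def using dn by simp
    have hb: "real h \<le> d * real n" "d * real n < real h + 1" unfolding hr by linarith+
    have "real h > 0" using hb dn by linarith
    hence h1: "h \<ge> 1" by simp
    have "d * real n \<le> 1 * real n" using d by (intro mult_right_mono) auto
    hence hn: "h \<le> n" using hb by linarith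
    have h2: "real h \<ge> d * real n / 2" using hb h1 by linarith
    have lnn: "ln (real n) > 0" using n by simp
    have "{p. prime p \<and> n < p \<and> real p \<le> (1 + d) * real n} \<subseteq> {p. prime p \<and> n < p \<and> p \<le> n + h}"
    proof clarify
      fix p assume "real p \<le> (1 + d) * real n"
      hence "real p < real (n + h) + 1" using hb by (simp add: algebra_simps)
      thus "p \<le> n + h" by linarith
    qed
    hence "card {p. prime p \<and> n < p \<and> real p \<le> (1 + d) * real n} \<le> card {p. prime p \<and> n < p \<and> p \<le> n + h}"
      by (intro card_mono) (auto intro: finite_subset[of _ "{..n + h}"])
    hence "real (card {p. prime p \<and> n < p \<and> real p \<le> (1 + d) * real n}) * ln (real n)
      \<le> real (card {p. prime p \<and> n < p \<and> p \<le> n + h}) * ln (real n)"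
      using lnn by (intro mult_right_mono) auto
    also have "\<dots> \<le> real h * (1 + ln (real (n + h) / real h))"
      by (rule card_primes_short_interval[OF h1 hn n(1)])
    also have "\<dots> \<le> (d * real n) * (1 + ln (3 / d))"
    proof (rule mult_mono)
      have "real (n + h) / real h = real n / real h + 1" using h1 by (simp add: add_divide_distrib)
      also have "real n / real h \<le> 2 / d" using h2 h1 d n by (simp add: field_simps)
      also have "2 / d + 1 \<le> 3 / d" using d by (simp add: field_simps)
      finally have "real (n + h) / real h \<le> 3 / d" by simp
      moreover have "0 < real (n + h) / real h" "0 < 3 / d" using h1 d by auto
      ultimately have "ln (real (n + h) / real h) \<le> ln (3 / d)" by (subst ln_le_cancel_iff)
      thus "1 + ln (real (n + h) / real h) \<le> 1 + ln (3 / d)" by simp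
      have "real (n + h) / real h \<ge> 1" using h1 by simp
      thus "0 \<le> 1 + ln (real (n + h) / real h)" by simp
    qed (use hb d in auto)
    also have "\<dots> = (d * (1 + ln (3 / d))) * real n" by simp
    also have "\<dots> \<le> \<eta> * real n" using d by (intro mult_right_mono) auto
    finally show "n \<ge> 2 \<and> real (card {p. prime p \<and> n < p \<and> real p \<le> (1 + d) * real n}) \<le> \<eta> * real n / ln (real n)"
      using lnn n by (simp add: field_simps)
  qed
qed

lemma log_series_bound:
  fixes x :: real
  assumes "0 \<le> x" "x < 1" "finite K"
  shows "(\<Sum>k\<in>K. x ^ k / real k) \<le> - ln (1 - x)"
proof -
  have "(\<lambda>n. - ((- (- x)) ^ n) / real n) sums ln (1 + (- x))"
    using assms by (intro ln_series') auto
  hence s: "(\<lambda>n. x ^ n / real n) sums (- ln (1 - x))" using sums_minus by fastforce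
  have "(\<Sum>k\<in>K. x ^ k / real k) \<le> (\<Sum>k. x ^ k / real k)"
    using assms by (intro sum_le_suminf sums_summable[OF s]) auto
  thus ?thesis using sums_unique[OF s] by simp
qed

lemma one_minus_exp_lower: "0 \<le> x \<Longrightarrow> x \<le> 1 \<Longrightarrow> x / 2 \<le> 1 - exp (- x)" for x :: real
proof -
  assume x: "0 \<le> x" "x \<le> 1"
  have "exp (- x) * (1 + x) \<le> exp (- x) * exp x" using exp_ge_add_one_self[of x] by (intro mult_left_mono) auto
  hence "exp (- x) \<le> 1 / (1 + x)" using x by (simp add: exp_minus field_simps)
  also have "\<dots> \<le> 1 - x / 2"
  proof -
    have "x * x \<le> 1 * x" using x by (intro mult_right_mono) auto
    thus ?thesis using x by (simp add: field_simps)
  qed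
  finally show ?thesis by simp
qed

context heegner_order begin

lemma card_deg1_primes_le: "finite W \<Longrightarrow> W \<subseteq> deg1_primes \<Longrightarrow> card W \<le> 2 * card (nrm ` W)"
proof -
  assume W: "finite W" "W \<subseteq> deg1_primes"
  have "card W = (\<Sum>\<pi>\<in>W. 1::nat)" by simp
  also have "\<dots> = (\<Sum>p\<in>nrm ` W. \<Sum>\<pi>\<in>{\<pi>\<in>W. nrm \<pi> = p}. 1)" by (rule sum.image_gen[OF W(1)])
  also have "\<dots> \<le> (\<Sum>p\<in>nrm ` W. 2)"
  proof (rule sum_mono)
    fix p
    have "card {\<pi>\<in>W. nrm \<pi> = p} \<le> card {\<pi>\<in>deg1_primes. nrm \<pi> = p}"
      using W by (intro card_mono card_deg1_primes_norm) auto
    thus "(\<Sum>\<pi>\<in>{\<pi>\<in>W. nrm \<pi> = p}. 1) \<le> (2::nat)" using card_deg1_primes_norm(2)[of p] by simp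
  qed
  finally show ?thesis by simp
qed

text \<open>
Suppose that no quotient of two primes outside \<open>E\<close> has absolute value between \<open>exp \<delta>\<close> and \<open>exp R\<close>.
Cut the primes into the windows \<open>k R \<le> ln \<bar>\<pi>\<bar> < (k + 1) R\<close>. Inside a window all of
them lie within a factor \<open>exp \<delta>\<close> of the smallest one, so their norms lie in a short interval, and the window has
mass at most \<open>y^k / (2 k)\<close> with \<open>y = exp (-2 R (s - 1))\<close>. Summing over \<open>k\<close> gives about
\<open>ln (1 / (s - 1)) / 2\<close>, half of what there is.
\<close>

lemma split_norms_spread:
  assumes R: "R > 0"
  obtains \<delta> where "0 < \<delta>" "\<delta> < R"
    "\<And>E. small E \<Longrightarrow> \<exists>\<pi>\<in>deg1_primes - E. \<exists>\<rho>\<in>deg1_primes - E. exp \<delta> \<le> cmod \<pi> / cmod \<rho> \<and> cmod \<pi> / cmod \<rho> \<le> exp R"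
proof -
  (* R / 4 makes the total mass in the windows half of the logarithmic mass. *)
  define \<eta> where "\<eta> = R / 4"
  have \<eta>: "\<eta> > 0" using R by (simp add: \<eta>_def)
  obtain \<delta>' n0 where d': "\<delta>' > 0" and n0: "\<And>n::nat. n \<ge> n0 \<Longrightarrow> n \<ge> 2 \<and>
    real (card {p. prime p \<and> n < p \<and> real p \<le> (1 + \<delta>') * real n}) \<le> \<eta> * real n / ln (real n)"
    using primes_in_short_intervals[OF \<eta>] by blast
  have "((\<lambda>x::real. ln x / x) \<longlongrightarrow> 0) at_top" by real_asymp
  hence "\<forall>\<^sub>F x::real in at_top. ln x / x < \<eta>" using \<eta> by (rule order_tendstoD(2))
  then obtain x1 where x1: "\<And>x. x \<ge> x1 \<Longrightarrow> ln x / x < \<eta>" unfolding eventually_at_top_linorder by blast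
  define \<delta> where "\<delta> = min (R / 2) (ln (1 + \<delta>') / 2)"
  have \<delta>: "0 < \<delta>" "\<delta> < R" using R d' by (auto simp: \<delta>_def)
  have ed: "exp (2 * \<delta>) \<le> 1 + \<delta>'"
  proof -
    have "exp (2 * \<delta>) \<le> exp (ln (1 + \<delta>'))" unfolding exp_le_cancel_iff \<delta>_def by simp
    thus ?thesis using d' by simp
  qed
  show ?thesis
  proof (rule that[OF \<delta>], rule ccontr)
    fix E assume E: "small E" and H: "\<not> (\<exists>\<pi>\<in>deg1_primes - E. \<exists>\<rho>\<in>deg1_primes - E. exp \<delta> \<le> cmod \<pi> / cmod \<rho> \<and> cmod \<pi> / cmod \<rho> \<le> exp R)"
    have EP: "E \<subseteq> deg1_primes" by (rule small_deg1_primes[OF E])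
    obtain CE where CE: "\<And>s. s > 1 \<Longrightarrow> infsum (\<lambda>\<pi>. cmod \<pi> powr (-2 * s)) E \<le> CE" using small_infsum[OF E] by metis
    define N1 where "N1 = max 1 (max (real n0) x1)"
    (* The finitely many windows before k0 are too near the origin for the prime bound
       and contribute at most C0. *)
    define k0 where "k0 = nat \<lceil>N1 / R\<rceil> + 1"
    have k0: "k0 \<ge> 1" "N1 \<le> real k * R" if "k \<ge> k0" for k
    proof -
      show "k0 \<ge> 1" by (simp add: k0_def)
      have "N1 / R \<le> real k" using that unfolding k0_def by linarith
      thus "N1 \<le> real k * R" using R by (simp add: field_simps)
    qed
    define f where "f \<pi> = nat \<lfloor>ln (cmod \<pi>) / R\<rfloor>" for \<pi>
    have P1ge: "cmod \<pi> \<ge> 1" if "\<pi> \<in> deg1_primes" for \<pi>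
      using cmod_ge_1[of \<pi>] prime_reps_nonzero[of \<pi>] deg1_primes_sub that by (auto simp: prime_reps_def)
    have f: "real (f \<pi>) * R \<le> ln (cmod \<pi>)" "ln (cmod \<pi>) < (real (f \<pi>) + 1) * R" if "\<pi> \<in> deg1_primes" for \<pi>
    proof -
      have "0 \<le> ln (cmod \<pi>) / R" using P1ge[OF that] R by simp
      hence "real (f \<pi>) = of_int \<lfloor>ln (cmod \<pi>) / R\<rfloor>" unfolding f_def by simp
      hence "real (f \<pi>) \<le> ln (cmod \<pi>) / R" "ln (cmod \<pi>) / R < real (f \<pi>) + 1" by linarith+
      thus "real (f \<pi>) * R \<le> ln (cmod \<pi>)" "ln (cmod \<pi>) < (real (f \<pi>) + 1) * R"
        using R by (simp_all add: field_simps)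
    qed
    define C0 where "C0 = real (card (lattice_ball (exp (real k0 * R))))"
    have block: "(\<Sum>\<pi>\<in>W. cmod \<pi> powr (-2 * s)) \<le> (1 / 2) * (exp (- (2 * R * (s - 1))) ^ k / real k)"
      if W: "finite W" "W \<subseteq> deg1_primes - E" "\<And>\<pi>. \<pi> \<in> W \<Longrightarrow> f \<pi> = k" and k: "k \<ge> k0" and s: "s > 1" for W k s
    proof (cases "W = {}")
      case False
      define n where "n = Min (nrm ` W)"
      have "n \<in> nrm ` W" unfolding n_def using W(1) False by (intro Min_in) auto
      then obtain \<pi>0 where p0: "\<pi>0 \<in> W" "nrm \<pi>0 = n" by blast
      have nmin: "n \<le> nrm \<pi>" if "\<pi> \<in> W" for \<pi> unfolding n_def using W(1) that by (intro Min_le) auto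
      have p0P: "\<pi>0 \<in> deg1_primes" using p0 W by auto
      have c0: "cmod \<pi>0 \<ge> 1" by (rule P1ge[OF p0P])
      have kR: "real k * R \<le> ln (cmod \<pi>0)" using f(1)[OF p0P] W(3)[OF p0(1)] by simp
      have ncm: "real n = (cmod \<pi>0)\<^sup>2" using real_nrm[OF deg1_primesD(1)[OF p0P]] p0(2) by simp
      have lnn: "ln (real n) = 2 * ln (cmod \<pi>0)" unfolding ncm using c0 by (subst ln_realpow) auto
      have "N1 \<le> ln (cmod \<pi>0)" using k0(2)[OF k] kR by linarith
      also have "\<dots> \<le> cmod \<pi>0" using c0 ln_bound[of "cmod \<pi>0"] by linarith
      also have "\<dots> \<le> real n" unfolding ncm power2_eq_square using mult_left_mono[OF c0, of "cmod \<pi>0"] c0 by simp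
      finally have nN: "N1 \<le> real n" .
      have nbig: "n \<ge> n0" "real n \<ge> x1" using nN by (auto simp: N1_def)
      note n2 = n0[OF nbig(1)]
      have k1: "k \<ge> 1" using k k0(1)[OF k] by linarith
      have lnpos: "ln (real n) \<ge> 2 * (real k * R)" "real k * R > 0" using lnn kR k1 R by auto
      have sub: "nrm ` W \<subseteq> insert n {p. prime p \<and> n < p \<and> real p \<le> (1 + \<delta>') * real n}"
      proof
        fix p assume "p \<in> nrm ` W"
        then obtain \<pi> where \<pi>: "\<pi> \<in> W" "p = nrm \<pi>" by blast
        have \<pi>P: "\<pi> \<in> deg1_primes" using \<pi> W by auto
        have np: "n \<le> p" using nmin \<pi> by simp
        have pc: "real p = (cmod \<pi>)\<^sup>2" using real_nrm[OF deg1_primesD(1)[OF \<pi>P]] \<pi> by simp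
        have c1: "cmod \<pi> \<ge> 1" by (rule P1ge[OF \<pi>P])
        have "ln (cmod \<pi>) - ln (cmod \<pi>0) \<le> R"
          using f(2)[OF \<pi>P] f(1)[OF p0P] W(3)[OF \<pi>(1)] W(3)[OF p0(1)] by (simp add: algebra_simps)
        hence "exp (ln (cmod \<pi>) - ln (cmod \<pi>0)) \<le> exp R" by simp
        moreover have "0 < cmod \<pi>" "0 < cmod \<pi>0" using c0 c1 by linarith+
        ultimately have "cmod \<pi> / cmod \<pi>0 \<le> exp R" by (simp add: exp_diff)
        hence "cmod \<pi> / cmod \<pi>0 < exp \<delta>" using H \<pi>(1) p0(1) W(2) by force
        hence "cmod \<pi> \<le> exp \<delta> * cmod \<pi>0" using \<open>0 < cmod \<pi>0\<close> by (simp add: field_simps)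
        hence "(cmod \<pi>)\<^sup>2 \<le> (exp \<delta> * cmod \<pi>0)\<^sup>2" by (intro power_mono) auto
        also have "\<dots> = exp (2 * \<delta>) * real n" by (simp add: power_mult_distrib exp_double ncm)
        also have "\<dots> \<le> (1 + \<delta>') * real n" using ed by (intro mult_right_mono) auto
        finally have "real p \<le> (1 + \<delta>') * real n" using pc by simp
        thus "p \<in> insert n {p. prime p \<and> n < p \<and> real p \<le> (1 + \<delta>') * real n}"
          using np deg1_primesD(2)[OF \<pi>P] \<pi>(2) by auto
      qed
      have fin: "finite {p. prime p \<and> n < p \<and> real p \<le> (1 + \<delta>') * real n}"
      proof (rule finite_subset)
        show "{p. prime p \<and> n < p \<and> real p \<le> (1 + \<delta>') * real n} \<subseteq> {..nat \<lceil>(1 + \<delta>') * real n\<rceil>}"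
          by (auto; linarith)
      qed simp
      have "card (nrm ` W) \<le> Suc (card {p. prime p \<and> n < p \<and> real p \<le> (1 + \<delta>') * real n})"
        using card_mono[OF _ sub] fin by (auto simp: card_insert_if split: if_splits)
      hence "real (card W) \<le> 2 * (1 + real (card {p. prime p \<and> n < p \<and> real p \<le> (1 + \<delta>') * real n}))"
        using card_deg1_primes_le[of W] W by force
      also have "\<dots> \<le> 2 * (1 + \<eta> * real n / ln (real n))" using n2 by simp
      finally have cW: "real (card W) \<le> 2 * (1 + \<eta> * real n / ln (real n))" .
      have npos: "real n \<ge> 2" using n2 by simp
      have "1 \<le> \<eta> * real n / ln (real n)"
        using x1[OF nbig(2)] npos lnpos by (simp add: field_simps)
      hence "real (card W) \<le> 4 * (\<eta> * real n / ln (real n))" using cW by simp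
      also have "\<dots> \<le> 4 * (\<eta> * real n / (2 * (real k * R)))"
        using lnpos \<eta> npos by (intro mult_left_mono divide_left_mono) auto
      also have "\<dots> = real n / (2 * real k)" using R k1 by (simp add: \<eta>_def field_simps)
      finally have cW: "real (card W) \<le> real n / (2 * real k)" .
      have "(\<Sum>\<pi>\<in>W. cmod \<pi> powr (-2 * s)) \<le> (\<Sum>\<pi>\<in>W. real n powr (-s))"
      proof (rule sum_mono)
        fix \<pi> assume \<pi>: "\<pi> \<in> W"
        hence "\<pi> \<in> OK" using W deg1_primesD(1) by auto
        hence "cmod \<pi> powr (-2 * s) = real (nrm \<pi>) powr (-s)" by (rule cmod_powr_nrm)
        also have "\<dots> \<le> real n powr (-s)" using nmin[OF \<pi>] npos s by (intro powr_mono2') auto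
        finally show "cmod \<pi> powr (-2 * s) \<le> real n powr (-s)" .
      qed
      also have "\<dots> = real (card W) * real n powr (-s)" by simp
      also have "\<dots> \<le> real n / (2 * real k) * real n powr (-s)" using cW by (intro mult_right_mono) auto
      also have "\<dots> = (1 / (2 * real k)) * real n powr (1 - s)"
        using npos by (simp add: powr_diff powr_minus field_simps)
      also have "real n powr (1 - s) = exp ((1 - s) * ln (real n))" using npos by (simp add: powr_def)
      also have "(1 / (2 * real k)) * exp ((1 - s) * ln (real n)) \<le> (1 / (2 * real k)) * exp ((1 - s) * (2 * (real k * R)))"
      proof -
        have "(s - 1) * (2 * (real k * R)) \<le> (s - 1) * ln (real n)"
          using lnpos s by (intro mult_left_mono) auto
        hence "(1 - s) * ln (real n) \<le> (1 - s) * (2 * (real k * R))" by (simp add: algebra_simps)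
        thus ?thesis by (intro mult_left_mono) auto
      qed
      also have "exp ((1 - s) * (2 * (real k * R))) = exp (- (2 * R * (s - 1))) ^ k"
        unfolding exp_of_nat_mult[symmetric] by (simp add: algebra_simps)
      finally show ?thesis by (simp add: field_simps)
    qed simp
    have main: "infsum (\<lambda>\<pi>. cmod \<pi> powr (-2 * s)) deg1_primes \<le> (CE + C0 - ln R / 2) + (1 / 2) * ln (1 / (s - 1))"
      if s: "1 < s" "2 * R * (s - 1) \<le> 1" for s
    proof -
      let ?x = "\<lambda>\<pi>. cmod \<pi> powr (-2 * s)"
      define y where "y = exp (- (2 * R * (s - 1)))"
      have y: "0 \<le> y" "y < 1" using R s by (auto simp: y_def)
      have "infsum ?x (deg1_primes - E) \<le> C0 + (1 / 2) * (- ln (1 - y))"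
      proof (rule infsum_le_finite_sums)
        show "?x summable_on deg1_primes - E" using s by (intro summable_deg1_primes) auto
        fix Q assume Q: "finite Q" "Q \<subseteq> deg1_primes - E"
        define Q0 where "Q0 = {\<pi>\<in>Q. f \<pi> < k0}"
        define Q1 where "Q1 = {\<pi>\<in>Q. \<not> f \<pi> < k0}"
        have "(\<Sum>\<pi>\<in>Q0. ?x \<pi>) \<le> (\<Sum>\<pi>\<in>Q0. 1)"
          using Q deg1_primes_sub s by (intro sum_mono cmod_powr_le_1) (auto simp: Q0_def)
        also have "\<dots> = real (card Q0)" by simp
        also have "card Q0 \<le> card (lattice_ball (exp (real k0 * R)))"
        proof (rule card_mono)
          show "Q0 \<subseteq> lattice_ball (exp (real k0 * R))"
          proof
            fix \<pi> assume "\<pi> \<in> Q0"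
            hence \<pi>: "\<pi> \<in> deg1_primes" "f \<pi> + 1 \<le> k0" using Q by (auto simp: Q0_def)
            have "ln (cmod \<pi>) \<le> (real (f \<pi>) + 1) * R" using f(2)[OF \<pi>(1)] by simp
            also have "\<dots> \<le> real k0 * R" using \<pi>(2) R by (intro mult_right_mono) linarith+
            finally have "exp (ln (cmod \<pi>)) \<le> exp (real k0 * R)" by simp
            hence "cmod \<pi> \<le> exp (real k0 * R)" using P1ge[OF \<pi>(1)] by (subst (asm) exp_ln) auto
            thus "\<pi> \<in> lattice_ball (exp (real k0 * R))" using deg1_primesD(1)[OF \<pi>(1)] by (simp add: lattice_ball_def)
          qed
        qed simp
        finally have Q0: "(\<Sum>\<pi>\<in>Q0. ?x \<pi>) \<le> C0" by (simp add: C0_def)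
        have fin1: "finite Q1" using Q by (simp add: Q1_def)
        have "(\<Sum>\<pi>\<in>Q1. ?x \<pi>) = (\<Sum>k\<in>f ` Q1. \<Sum>\<pi>\<in>{\<pi>\<in>Q1. f \<pi> = k}. ?x \<pi>)"
          by (rule sum.image_gen[OF fin1])
        also have "\<dots> \<le> (\<Sum>k\<in>f ` Q1. (1 / 2) * (y ^ k / real k))"
          unfolding y_def by (intro sum_mono block s) (use Q in \<open>auto simp: Q1_def\<close>)
        also have "\<dots> = (1 / 2) * (\<Sum>k\<in>f ` Q1. y ^ k / real k)" by (simp add: sum_distrib_left)
        also have "\<dots> \<le> (1 / 2) * (- ln (1 - y))"
          using fin1 by (intro mult_left_mono log_series_bound y) auto
        finally have "(\<Sum>\<pi>\<in>Q1. ?x \<pi>) \<le> (1 / 2) * (- ln (1 - y))" .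
        moreover have "(\<Sum>\<pi>\<in>Q. ?x \<pi>) = (\<Sum>\<pi>\<in>Q0. ?x \<pi>) + (\<Sum>\<pi>\<in>Q1. ?x \<pi>)"
        proof -
          have "Q = Q0 \<union> Q1" "Q0 \<inter> Q1 = {}" by (auto simp: Q0_def Q1_def)
          thus ?thesis using Q(1) fin1 by (metis finite_Un sum.union_disjoint)
        qed
        ultimately show "(\<Sum>\<pi>\<in>Q. ?x \<pi>) \<le> C0 + (1 / 2) * (- ln (1 - y))" using Q0 by linarith
      qed
      moreover have "infsum ?x deg1_primes = infsum ?x E + infsum ?x (deg1_primes - E)"
      proof -
        have "E \<union> (deg1_primes - E) = deg1_primes" using EP by blast
        thus ?thesis using infsum_Un_disjoint[of ?x E "deg1_primes - E"] summable_deg1_primes[OF s(1) EP] summable_deg1_primes[OF s(1), of "deg1_primes - E"] by simp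
      qed
      moreover have "- ln (1 - y) \<le> ln (1 / (s - 1)) - ln R"
      proof -
        have "R * (s - 1) \<le> 1 - y" using one_minus_exp_lower[of "2 * R * (s - 1)"] s R by (simp add: y_def)
        hence "ln (R * (s - 1)) \<le> ln (1 - y)" using R s by (subst ln_le_cancel_iff) (auto simp: y_def)
        moreover have "ln (R * (s - 1)) = ln R + ln (s - 1)" using R s by (intro ln_mult_pos) auto
        moreover have "ln (1 / (s - 1)) = - ln (s - 1)" using s by (simp add: ln_div)
        ultimately show ?thesis by linarith
      qed
      ultimately show ?thesis using CE[OF s(1)] by (simp add: field_simps)
    qed
    have "\<forall>\<^sub>F s::real in at_right 1. 1 < s \<and> s < 1 + 1 / (2 * R)"
      using eventually_at_right_real[of 1 "1 + 1 / (2 * R)"] R by (auto elim: eventually_mono)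
    hence "\<forall>\<^sub>F s in at_right 1. infsum (\<lambda>\<pi>. cmod \<pi> powr (-2 * s)) deg1_primes \<le> (CE + C0 - ln R / 2) + (1 / 2) * ln (1 / (s - 1))"
    proof eventually_elim
      case (elim s)
      have "2 * R * (s - 1) \<le> 1" using elim R by (simp add: field_simps)
      thus ?case using main elim by blast
    qed
    thus False by (rule sparse_contradiction[rotated]) simp
  qed
qed

end

section \<open>Multiplicative symmetries of the limit functional\<close>

locale omega_limit_test = omega_limit +
  fixes \<phi> :: "complex \<Rightarrow> real" and K r :: real
  assumes test: "test \<phi> K r"
begin

text \<open>
The factor \<open>\<bar>z\<bar>^2\<close> makes \<open>G\<close> uniformly continuous for the multiplicative structure, with a constant that
is independent of \<open>z\<close>, and turns the weight \<open>N \<pi>\<close> in \<open>turan_kubilius_dual\<close> into the plain difference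
\<open>G j z - G (j+1) (z \<pi>)\<close>.
\<close>

definition G :: "nat \<Rightarrow> complex \<Rightarrow> real" where
  "G j z = (norm z)\<^sup>2 * L j (\<lambda>w. \<phi> (z * w))"

text \<open>
The first summand bounds the change of the test function, the second one the change of the factor
\<open>\<bar>z\<bar>^2\<close>; see \<open>G_cont\<close>.
\<close>

definition cont_const :: real where
  "cont_const = 200 * K * r ^ 3 * A + 900 * K * r ^ 3 * A"

lemma cont_const_nonneg: "cont_const \<ge> 0"
  using testD(1,2)[OF test] A_nonneg by (simp add: cont_const_def)

lemma L_bound:
  assumes "test \<psi> K' r'" "\<And>z. \<bar>\<psi> z\<bar> \<le> B"
  shows "\<bar>L j \<psi>\<bar> \<le> 25 * B * A * r'\<^sup>2"
proof (rule tendsto_upperbound[OF tendsto_rabs[OF L_tendsto[OF assms(1)]] _ F_bot])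
  show "\<forall>\<^sub>F X in F. \<bar>lattice_mean \<psi> (g j) X\<bar> \<le> 25 * B * A * r'\<^sup>2"
    using eventually_F[OF eventually_ge_at_top[of "1 / r'"]]
    by eventually_elim
      (rule lattice_mean_bound[OF testD(4)[OF assms(1)] testD(2)[OF assms(1)] _ assms(2) g_bound])
qed

lemma L_diff_bound:
  assumes \<psi>: "test \<psi>1 K1 r1" "test \<psi>2 K2 r2"
    and d: "\<And>z. \<bar>\<psi>1 z - \<psi>2 z\<bar> \<le> B" "supp (\<lambda>z. \<psi>1 z - \<psi>2 z) \<rho>" "\<rho> > 0"
  shows "\<bar>L j \<psi>1 - L j \<psi>2\<bar> \<le> 25 * B * A * \<rho>\<^sup>2"
proof (rule tendsto_upperbound[OF tendsto_rabs[OF tendsto_diff[OF L_tendsto[OF \<psi>(1)] L_tendsto[OF \<psi>(2)]]] _ F_bot])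
  show "\<forall>\<^sub>F X in F. \<bar>lattice_mean \<psi>1 (g j) X - lattice_mean \<psi>2 (g j) X\<bar> \<le> 25 * B * A * \<rho>\<^sup>2"
    using eventually_F[OF eventually_ge_at_top[of "1 / \<rho>"]] eventually_F[OF eventually_gt_at_top[of 0]]
  proof eventually_elim
    case (elim X)
    define r3 where "r3 = max r1 r2"
    have s: "supp \<psi>1 r3" "supp \<psi>2 r3" using testD(4)[OF \<psi>(1)] testD(4)[OF \<psi>(2)] by (auto simp: supp_def r3_def)
    have s3: "supp (\<lambda>z. \<psi>1 z - \<psi>2 z) r3" using s by (auto simp: supp_def)
    have "lattice_mean \<psi>1 (g j) X - lattice_mean \<psi>2 (g j) X = lattice_mean (\<lambda>z. \<psi>1 z - \<psi>2 z) (g j) X"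
      unfolding lattice_mean_eq[OF s(1) elim(2)] lattice_mean_eq[OF s(2) elim(2)] lattice_mean_eq[OF s3 elim(2)]
      by (simp add: diff_divide_distrib[symmetric] sum_subtractf[symmetric] left_diff_distrib)
    also have "\<bar>\<dots>\<bar> \<le> 25 * B * A * \<rho>\<^sup>2"
      by (rule lattice_mean_bound[OF d(2,3) elim(1) d(1) g_bound])
    finally show ?case .
  qed
qed

lemma G_cont:
  assumes z: "z \<noteq> 0" and \<eta>: "norm \<eta> \<le> 1 / 2"
  shows "\<bar>G j z - G j (z * (1 + \<eta>))\<bar> \<le> cont_const * norm \<eta>"
proof -
  note T = testD[OF test]
  define z' where "z' = z * (1 + \<eta>)"
  have one: "norm (1 + \<eta>) \<ge> 1 / 2" "norm (1 + \<eta>) \<le> 1 + norm \<eta>"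
    using norm_triangle_ineq4[of "1 + \<eta>" \<eta>] norm_triangle_ineq[of 1 \<eta>] \<eta> by auto
  have lower: "norm (1 + \<eta>) \<ge> 1 - norm \<eta>" using norm_triangle_ineq4[of "1 + \<eta>" \<eta>] by simp
  have z': "z' \<noteq> 0" "norm z' = norm z * norm (1 + \<eta>)" using z one by (auto simp: z'_def norm_mult)
  have np: "norm z > 0" using z by simp
  note t1 = test_scale[OF test z] and t2 = test_scale[OF test z'(1)]
  let ?d = "\<lambda>w. \<phi> (z * w) - \<phi> (z' * w)"
  have supp: "supp ?d (2 * r / norm z)"
    unfolding supp_def
  proof (intro allI impI)
    fix w :: complex assume w: "norm w > 2 * r / norm z"
    have zw: "norm (z * w) > 2 * r" using w np by (simp add: norm_mult field_simps)
    have "norm (z' * w) = norm (z * w) * norm (1 + \<eta>)" by (simp add: z'_def norm_mult)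
    also have "\<dots> \<ge> norm (z * w) * (1 / 2)" using one by (intro mult_left_mono) auto
    finally have "norm (z' * w) > r" "norm (z * w) > r" using zw T(2) by linarith+
    thus "?d w = 0" using suppD[OF T(4)] by simp
  qed
  have bd: "\<bar>?d w\<bar> \<le> 2 * r * K * norm \<eta>" for w
  proof (cases "norm w > 2 * r / norm z")
    case True
    thus ?thesis using suppD[OF supp True] T(1,2) by simp
  next
    case False
    hence zw: "norm (z * w) \<le> 2 * r" using np by (simp add: norm_mult field_simps)
    have "\<bar>?d w\<bar> \<le> K * norm (z * w - z' * w)" by (rule T(3))
    also have "z * w - z' * w = - (\<eta> * (z * w))" by (simp add: z'_def algebra_simps)
    also have "K * norm (- (\<eta> * (z * w))) = K * (norm \<eta> * norm (z * w))" by (simp add: norm_mult)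
    also have "\<dots> \<le> K * (norm \<eta> * (2 * r))" using zw T(1) by (intro mult_left_mono) auto
    finally show ?thesis by (simp add: mult_ac)
  qed
  have "\<bar>L j (\<lambda>w. \<phi> (z * w)) - L j (\<lambda>w. \<phi> (z' * w))\<bar> \<le> 25 * (2 * r * K * norm \<eta>) * A * (2 * r / norm z)\<^sup>2"
    using L_diff_bound[OF t1 t2 bd supp] T(2) np by simp
  hence "(norm z)\<^sup>2 * \<bar>L j (\<lambda>w. \<phi> (z * w)) - L j (\<lambda>w. \<phi> (z' * w))\<bar> \<le> (norm z)\<^sup>2 * (25 * (2 * r * K * norm \<eta>) * A * (2 * r / norm z)\<^sup>2)"
    by (rule mult_left_mono) simp
  also have "\<dots> = (200 * K * r ^ 3 * A) * norm \<eta>"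
    using np by (simp add: power_divide power2_eq_square power3_eq_cube field_simps)
  finally have 1: "(norm z)\<^sup>2 * \<bar>L j (\<lambda>w. \<phi> (z * w)) - L j (\<lambda>w. \<phi> (z' * w))\<bar> \<le> (200 * K * r ^ 3 * A) * norm \<eta>" .
  have L2: "\<bar>L j (\<lambda>w. \<phi> (z' * w))\<bar> \<le> 25 * (3 * K * r) * A * (r / norm z')\<^sup>2"
    using L_bound[OF t2] T(5) by blast
  have sq: "\<bar>1 - (norm (1 + \<eta>))\<^sup>2\<bar> \<le> 3 * norm \<eta>"
  proof -
    have "(norm (1 + \<eta>))\<^sup>2 \<le> (1 + norm \<eta>)\<^sup>2" using one by (intro power_mono) auto
    moreover have "(1 - norm \<eta>)\<^sup>2 \<le> (norm (1 + \<eta>))\<^sup>2" using lower \<eta> by (intro power_mono) auto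
    moreover have "norm \<eta> * norm \<eta> \<le> 1 * norm \<eta>" using \<eta> by (intro mult_right_mono) auto
    moreover have "(1 + norm \<eta>)\<^sup>2 = 1 + 2 * norm \<eta> + norm \<eta> * norm \<eta>" "(1 - norm \<eta>)\<^sup>2 = 1 - 2 * norm \<eta> + norm \<eta> * norm \<eta>"
      by (simp_all add: power2_eq_square algebra_simps)
    moreover have "0 \<le> norm \<eta> * norm \<eta>" by simp
    ultimately show ?thesis unfolding abs_le_iff by linarith
  qed
  have "\<bar>((norm z)\<^sup>2 - (norm z')\<^sup>2) * L j (\<lambda>w. \<phi> (z' * w))\<bar> = (norm z)\<^sup>2 * \<bar>1 - (norm (1 + \<eta>))\<^sup>2\<bar> * \<bar>L j (\<lambda>w. \<phi> (z' * w))\<bar>"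
  proof -
    have "(norm z)\<^sup>2 - (norm z')\<^sup>2 = (norm z)\<^sup>2 * (1 - (norm (1 + \<eta>))\<^sup>2)"
      by (simp add: z'(2) power_mult_distrib algebra_simps)
    thus ?thesis by (simp add: abs_mult)
  qed
  also have "\<dots> \<le> (norm z)\<^sup>2 * (3 * norm \<eta>) * (25 * (3 * K * r) * A * (r / norm z')\<^sup>2)"
    using T(1,2) A_nonneg by (intro mult_mono sq L2) auto
  also have "(r / norm z')\<^sup>2 \<le> (2 * r / norm z)\<^sup>2"
  proof (rule power_mono)
    have "norm z / 2 \<le> norm z'" using z'(2) one(1) mult_left_mono[OF one(1), of "norm z"] by simp
    hence "r / norm z' \<le> r / (norm z / 2)" using T(2) np z'(1) by (intro divide_left_mono mult_pos_pos) auto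
    thus "r / norm z' \<le> 2 * r / norm z" by (simp add: mult_ac)
  qed (use T(2) in auto)
  also have "(norm z)\<^sup>2 * (3 * norm \<eta>) * (25 * (3 * K * r) * A * (2 * r / norm z)\<^sup>2) = (900 * K * r ^ 3 * A) * norm \<eta>"
    using np by (simp add: power_divide power2_eq_square power3_eq_cube field_simps)
  finally have 2: "\<bar>((norm z)\<^sup>2 - (norm z')\<^sup>2) * L j (\<lambda>w. \<phi> (z' * w))\<bar> \<le> (900 * K * r ^ 3 * A) * norm \<eta>"
    using T(1,2) A_nonneg by (simp add: mult_left_mono mult_right_mono)
  have "G j z - G j z' = (norm z)\<^sup>2 * (L j (\<lambda>w. \<phi> (z * w)) - L j (\<lambda>w. \<phi> (z' * w))) + ((norm z)\<^sup>2 - (norm z')\<^sup>2) * L j (\<lambda>w. \<phi> (z' * w))"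
    by (simp add: G_def algebra_simps)
  also have "\<bar>\<dots>\<bar> \<le> (norm z)\<^sup>2 * \<bar>L j (\<lambda>w. \<phi> (z * w)) - L j (\<lambda>w. \<phi> (z' * w))\<bar> + \<bar>((norm z)\<^sup>2 - (norm z')\<^sup>2) * L j (\<lambda>w. \<phi> (z' * w))\<bar>"
    by (rule order_trans[OF abs_triangle_ineq]) (simp add: abs_mult)
  also have "\<dots> \<le> (200 * K * r ^ 3 * A) * norm \<eta> + (900 * K * r ^ 3 * A) * norm \<eta>"
    using 1 2 by (rule add_mono)
  also have "\<dots> = cont_const * norm \<eta>" by (simp add: cont_const_def ring_distribs)
  finally show ?thesis by (simp add: z'_def)
qed

definition bad :: "nat \<Rightarrow> complex \<Rightarrow> real \<Rightarrow> complex set" where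
  "bad j z \<epsilon> = {\<pi>\<in>deg1_primes. \<epsilon> \<le> \<bar>G j z - G (Suc j) (z * \<pi>)\<bar>}"

text \<open>
Chebyshev's inequality for the sum in \<open>turan_kubilius_dual\<close>.
\<close>

lemma small_bad:
  assumes z: "z \<noteq> 0" and \<epsilon>: "\<epsilon> > 0"
  shows "small (bad j z \<epsilon>)"
proof -
  note t = test_scale[OF test z]
  define B where "B = A\<^sup>2 * (M (\<lambda>w. \<bar>\<phi> (z * w)\<bar>) + 1)\<^sup>2"
  have "(\<Sum>\<pi>\<in>Q. 1 / nrm \<pi>) \<le> (norm z)^4 * B / \<epsilon>\<^sup>2" if Q: "finite Q" "Q \<subseteq> bad j z \<epsilon>" for Q
  proof -
    have QP: "Q \<subseteq> deg1_primes" using Q by (auto simp: bad_def)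
    define D where "D \<pi> = L j (\<lambda>w. \<phi> (z * w)) - nrm \<pi> * L (Suc j) (\<lambda>w. \<phi> (z * (\<pi> * w)))" for \<pi>
    have "\<epsilon>\<^sup>2 * (\<Sum>\<pi>\<in>Q. 1 / nrm \<pi>) = (\<Sum>\<pi>\<in>Q. \<epsilon>\<^sup>2 / nrm \<pi>)" by (simp add: sum_distrib_left)
    also have "\<dots> \<le> (\<Sum>\<pi>\<in>Q. (norm z)^4 * ((D \<pi>)\<^sup>2 / nrm \<pi>))"
    proof (rule sum_mono)
      fix \<pi> assume \<pi>: "\<pi> \<in> Q"
      have "G j z - G (Suc j) (z * \<pi>) = (norm z)\<^sup>2 * D \<pi>"
        using real_nrm[of \<pi>] deg1_primesD(1)[of \<pi>] \<pi> QP
        by (auto simp: G_def D_def norm_mult power_mult_distrib right_diff_distrib mult.assoc)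
      hence "\<epsilon> \<le> \<bar>(norm z)\<^sup>2 * D \<pi>\<bar>" using \<pi> Q by (auto simp: bad_def)
      hence "\<epsilon>\<^sup>2 \<le> \<bar>(norm z)\<^sup>2 * D \<pi>\<bar>\<^sup>2" using \<epsilon> by (intro power_mono) auto
      also have "\<dots> = (norm z)^4 * (D \<pi>)\<^sup>2" by (simp add: power_mult_distrib power_mult[symmetric])
      finally show "\<epsilon>\<^sup>2 / nrm \<pi> \<le> (norm z)^4 * ((D \<pi>)\<^sup>2 / nrm \<pi>)" by (simp add: divide_right_mono)
    qed
    also have "\<dots> = (norm z)^4 * (\<Sum>\<pi>\<in>Q. (D \<pi>)\<^sup>2 / nrm \<pi>)" by (simp add: sum_distrib_left)
    also have "\<dots> \<le> (norm z)^4 * B"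
      using turan_kubilius_dual[OF t Q(1) QP, of j] by (intro mult_left_mono) (auto simp: D_def B_def)
    finally show ?thesis using \<epsilon> by (simp add: field_simps)
  qed
  thus ?thesis by (intro smallI) (auto simp: bad_def)
qed

definition stab :: "complex set" where
  "stab = {s. s \<noteq> 0 \<and> (\<forall>j z. z \<noteq> 0 \<longrightarrow> G j (z * s) = G j z)}"

lemma stab_1: "1 \<in> stab" by (simp add: stab_def)

lemma stab_mult: "s \<in> stab \<Longrightarrow> u \<in> stab \<Longrightarrow> s * u \<in> stab"
  by (auto simp: stab_def mult.assoc[symmetric])

lemma stab_inverse: "s \<in> stab \<Longrightarrow> inverse s \<in> stab"
  unfolding stab_def
proof (safe)
  fix j z assume s: "s \<noteq> 0" "\<forall>j z. z \<noteq> 0 \<longrightarrow> G j (z * s) = G j z" and z: "z \<noteq> (0::complex)"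
  have eq: "z * inverse s * s = z" using s(1) by simp
  have "z * inverse s \<noteq> 0" using s(1) z by simp
  hence "G j (z * inverse s * s) = G j (z * inverse s)" using s(2) by blast
  thus "G j (z * inverse s) = G j z" unfolding eq by (rule sym)
qed auto

lemma stab_power: "s \<in> stab \<Longrightarrow> s ^ n \<in> stab"
  by (induction n) (simp_all add: stab_1 stab_mult)

lemma eq_if_arbitrarily_close: 
  fixes x y c :: real
  assumes "\<And>e. e > 0 \<Longrightarrow> \<bar>x - y\<bar> \<le> c * e"
  shows "x = y"
proof (rule ccontr)
  assume "x \<noteq> y"
  define c' where "c' = \<bar>c\<bar> + 1"
  define e where "e = \<bar>x - y\<bar> / (2 * c')"
  have c': "c' > 0" by (simp add: c'_def)
  have e: "e > 0" using \<open>x \<noteq> y\<close> c' by (simp add: e_def)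
  have "\<bar>x - y\<bar> \<le> c * e" by (rule assms[OF e])
  also have "\<dots> \<le> c' * e" using e by (intro mult_right_mono) (auto simp: c'_def)
  also have "\<dots> = \<bar>x - y\<bar> / 2" using c' by (simp add: e_def)
  finally show False using \<open>x \<noteq> y\<close> by simp
qed

lemma stab_closed:
  assumes s: "s \<noteq> 0" and lim: "\<And>\<delta>. \<delta> > 0 \<Longrightarrow> \<exists>s'\<in>stab. norm (s' / s - 1) \<le> \<delta>"
  shows "s \<in> stab"
  unfolding stab_def
proof (intro CollectI conjI allI impI s)
  fix j z assume z: "z \<noteq> (0::complex)"
  show "G j (z * s) = G j z"
  proof (rule eq_if_arbitrarily_close)
    fix e :: real assume e: "e > 0"
    obtain s' where s': "s' \<in> stab" "norm (s' / s - 1) \<le> min e (1/2)" using lim[of "min e (1/2)"] e by auto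
    have "\<bar>G j (z * s) - G j (z * s * (1 + (s' / s - 1)))\<bar> \<le> cont_const * norm (s' / s - 1)"
      using s' z s by (intro G_cont) auto
    also have "z * s * (1 + (s' / s - 1)) = z * s'" using s by (simp add: field_simps)
    also have "G j (z * s') = G j z" using s'(1) z by (simp add: stab_def)
    also have "cont_const * norm (s' / s - 1) \<le> cont_const * e"
      using s'(2) cont_const_nonneg by (intro mult_left_mono) auto
    finally show "\<bar>G j (z * s) - G j z\<bar> \<le> cont_const * e" .
  qed
qed

text \<open>
For primes outside two exceptional sets, \<open>G j z\<close> is close to \<open>G (j+1) (z \<pi>)\<close> and \<open>G j (z s)\<close> is close to
\<open>G (j+1) (z s \<rho>)\<close>. If \<open>\<pi>\<close> is nearly \<open>s \<rho>\<close>, the right-hand sides nearly agree.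
\<close>

lemma stab_if_recurrent:
  assumes s: "s \<noteq> 0"
    and rec: "\<And>E \<delta>. small E \<Longrightarrow> \<delta> > 0 \<Longrightarrow> \<exists>\<pi>\<in>deg1_primes - E. \<exists>\<rho>\<in>deg1_primes - E. norm (\<pi> / (\<rho> * s) - 1) < \<delta>"
  shows "s \<in> stab"
  unfolding stab_def
proof (intro CollectI conjI allI impI s)
  fix j z assume z: "z \<noteq> (0::complex)"
  have zs: "z * s \<noteq> 0" using z s by simp
  show "G j (z * s) = G j z"
  proof (rule eq_if_arbitrarily_close)
    fix e :: real assume e: "e > 0"
    have sm: "small (bad j z e \<union> bad j (z * s) e)" using z zs e by (intro small_Un small_bad)
    obtain \<pi> \<rho> where \<pi>: "\<pi> \<in> deg1_primes" "\<rho> \<in> deg1_primes" "\<pi> \<notin> bad j z e" "\<rho> \<notin> bad j (z * s) e"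
      "norm (\<pi> / (\<rho> * s) - 1) < min e (1/2)"
      using rec[OF sm, of "min e (1/2)"] e by auto
    have \<rho>0: "\<rho> \<noteq> 0" using \<pi>(2) prime_reps_nonzero by (auto simp: prime_reps_def)
    have "\<bar>G (Suc j) (z * s * \<rho>) - G (Suc j) (z * s * \<rho> * (1 + (\<pi> / (\<rho> * s) - 1)))\<bar> \<le> cont_const * norm (\<pi> / (\<rho> * s) - 1)"
      using \<pi>(5) zs \<rho>0 by (intro G_cont) auto
    also have "z * s * \<rho> * (1 + (\<pi> / (\<rho> * s) - 1)) = z * \<pi>" using s \<rho>0 by (simp add: field_simps)
    also have "cont_const * norm (\<pi> / (\<rho> * s) - 1) \<le> cont_const * e"
      using \<pi>(5) cont_const_nonneg by (intro mult_left_mono) auto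
    finally have "\<bar>G (Suc j) (z * s * \<rho>) - G (Suc j) (z * \<pi>)\<bar> \<le> cont_const * e" .
    moreover have "\<bar>G j z - G (Suc j) (z * \<pi>)\<bar> < e" "\<bar>G j (z * s) - G (Suc j) (z * s * \<rho>)\<bar> < e"
      using \<pi> by (auto simp: bad_def)
    ultimately have "\<bar>G j (z * s) - G j z\<bar> \<le> cont_const * e + 2 * e" by linarith
    thus "\<bar>G j (z * s) - G j z\<bar> \<le> (cont_const + 2) * e" by (simp add: algebra_simps)
  qed
qed

text \<open>
The contrapositive of \<open>stab_if_recurrent\<close> gives each \<open>s\<close> in \<open>C\<close> a neighbourhood that contains no
quotient of primes outside some small set; finitely many of these neighbourhoods cover \<open>C\<close>.
\<close>

lemma compact_avoids_quotients:
  assumes C: "compact C" "0 \<notin> C" "C \<inter> stab = {}"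
  obtains E where "small E" "\<And>\<pi> \<rho>. \<pi> \<in> deg1_primes - E \<Longrightarrow> \<rho> \<in> deg1_primes - E \<Longrightarrow> \<pi> / \<rho> \<notin> C"
proof -
  have "\<forall>s\<in>C. \<exists>E \<delta>. small E \<and> \<delta> > 0 \<and> (\<forall>\<pi>\<in>deg1_primes - E. \<forall>\<rho>\<in>deg1_primes - E. norm (\<pi> / (\<rho> * s) - 1) \<ge> \<delta>)"
  proof
    fix s assume "s \<in> C"
    hence "s \<noteq> 0" "s \<notin> stab" using C by auto
    thus "\<exists>E \<delta>. small E \<and> \<delta> > 0 \<and> (\<forall>\<pi>\<in>deg1_primes - E. \<forall>\<rho>\<in>deg1_primes - E. norm (\<pi> / (\<rho> * s) - 1) \<ge> \<delta>)"
      using stab_if_recurrent[of s] by (meson not_le)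
  qed
  then obtain E \<delta> where E: "\<And>s. s \<in> C \<Longrightarrow> small (E s)" "\<And>s. s \<in> C \<Longrightarrow> \<delta> s > 0"
    "\<And>s \<pi> \<rho>. s \<in> C \<Longrightarrow> \<pi> \<in> deg1_primes - E s \<Longrightarrow> \<rho> \<in> deg1_primes - E s \<Longrightarrow> norm (\<pi> / (\<rho> * s) - 1) \<ge> \<delta> s"
    by metis
  define U where "U s = {w. norm (w / s - 1) < \<delta> s}" for s
  have op: "open (U s)" if "s \<in> C" for s
  proof -
    have "s \<noteq> 0" using that C by auto
    thus ?thesis unfolding U_def by (intro open_Collect_less continuous_intros) auto
  qed
  have sub: "C \<subseteq> (\<Union>s\<in>C. U s)"
  proof
    fix s assume s: "s \<in> C"
    hence "s \<noteq> 0" using C by auto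
    thus "s \<in> (\<Union>s\<in>C. U s)" using E(2)[OF s] s by (intro UN_I[of s]) (auto simp: U_def)
  qed
  obtain D where D: "D \<subseteq> C" "finite D" "C \<subseteq> (\<Union>s\<in>D. U s)"
    by (rule compactE_image[OF C(1) op sub])
  show ?thesis
  proof (rule that[of "\<Union>s\<in>D. E s"])
    show "small (\<Union>s\<in>D. E s)" using D E(1) by (intro small_Union) auto
    fix \<pi> \<rho> assume pr: "\<pi> \<in> deg1_primes - (\<Union>s\<in>D. E s)" "\<rho> \<in> deg1_primes - (\<Union>s\<in>D. E s)"
    show "\<pi> / \<rho> \<notin> C"
    proof
      assume "\<pi> / \<rho> \<in> C"
      then obtain s where s: "s \<in> D" "norm (\<pi> / \<rho> / s - 1) < \<delta> s" using D(3) by (auto simp: U_def)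
      have "norm (\<pi> / (\<rho> * s) - 1) \<ge> \<delta> s" using s(1) pr D(1) by (intro E(3)) auto
      thus False using s(2) by simp
    qed
  qed
qed

lemma cis_sub_1_le: "norm (cis x - 1) \<le> \<bar>x\<bar>"
proof -
  have "(norm (cis x - 1))\<^sup>2 = (2 * sin (x / 2))\<^sup>2"
    using cos_double_sin[of "x / 2"]
    by (simp add: cmod_power2 power2_diff algebra_simps power_mult_distrib)
  hence "sqrt ((norm (cis x - 1))\<^sup>2) = sqrt ((2 * sin (x / 2))\<^sup>2)" by simp
  hence "norm (cis x - 1) = \<bar>2 * sin (x / 2)\<bar>" unfolding real_sqrt_abs by simp
  also have "\<dots> \<le> \<bar>x\<bar>" using abs_sin_x_le_abs_x[of "x / 2"] by simp
  finally show ?thesis .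
qed

text \<open>
If small rotations other than the identity were missing from \<open>stab\<close>, then by Dirichlet's approximation
theorem every rotation in \<open>stab\<close> would be torsion of a bounded order dividing \<open>m'\<close>, and \<open>stab\<close> would miss
the compact set \<open>C\<close> of all \<open>s\<close> on the circle with \<open>Re (s^m') \<le> 1/2\<close>. But \<open>C\<close> contains quotients of a
prime by its conjugate, up to a unit.
\<close>

lemma circle_in_stab: "cis x \<in> stab"
proof -
  define T where "T = {x. cis x \<in> stab}"
  have diff: "x - y \<in> T" if "x \<in> T" "y \<in> T" for x y
  proof -
    have eq: "cis (x - y) = cis x * inverse (cis y)"
      unfolding divide_inverse[symmetric] by (rule cis_divide[symmetric])
    show ?thesis unfolding T_def mem_Collect_eq eq
      by (rule stab_mult[OF _ stab_inverse]) (use that in \<open>simp_all add: T_def\<close>)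
  qed
  have closed: "x \<in> T" if lim: "\<And>\<delta>. \<delta> > 0 \<Longrightarrow> \<exists>y\<in>T. \<bar>y - x\<bar> \<le> \<delta>" for x
    unfolding T_def mem_Collect_eq
  proof (rule stab_closed)
    fix \<delta> :: real assume "\<delta> > 0"
    then obtain y where y: "y \<in> T" "\<bar>y - x\<bar> \<le> \<delta>" using lim by blast
    have "norm (cis y / cis x - 1) \<le> \<delta>" using cis_sub_1_le[of "y - x"] y(2) by (simp add: cis_divide)
    thus "\<exists>s'\<in>stab. norm (s' / cis x - 1) \<le> \<delta>" using y(1) by (auto simp: T_def)
  qed simp
  have small_el: "\<exists>x\<in>T. 0 < x \<and> x < \<eta>" if \<eta>: "\<eta> > 0" for \<eta>
  proof (rule ccontr)
    assume H: "\<not> (\<exists>x\<in>T. 0 < x \<and> x < \<eta>)"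
    define N where "N = nat \<lceil>2 * pi / \<eta>\<rceil> + 1"
    have N: "N > 0" "2 * pi / real N \<le> \<eta>"
    proof -
      show N0: "N > 0" by (simp add: N_def)
      have "2 * pi / \<eta> \<le> real N" unfolding N_def by linarith
      thus "2 * pi / real N \<le> \<eta>" using \<eta> N0 by (simp add: field_simps)
    qed
    have zeroT: "0 \<in> T" by (simp add: T_def stab_1)
    have H': "y = 0" if "y \<in> T" "\<bar>y\<bar> < \<eta>" for y
    proof (rule ccontr)
      assume "y \<noteq> 0"
      moreover have "\<bar>y\<bar> \<in> T" using that(1) diff[OF zeroT that(1)] by (cases "y \<ge> 0") auto
      ultimately show False using H that(2) by auto
    qed
    have torsion: "cis y ^ (12 * fact N) = 1" if y: "y \<in> T" for y
    proof -
      obtain h k where hk: "0 < k" "k \<le> int N" "\<bar>of_int k * (y / (2 * pi)) - of_int h\<bar> < 1 / real N"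
        using Dirichlet_approx[OF N(1)] by blast
      define u where "u = of_int k * y - 2 * pi * of_int h"
      have "u = 2 * pi * (of_int k * (y / (2 * pi)) - of_int h)" by (simp add: u_def field_simps)
      hence "\<bar>u\<bar> = 2 * pi * \<bar>of_int k * (y / (2 * pi)) - of_int h\<bar>" by (simp add: abs_mult)
      also have "\<dots> < 2 * pi * (1 / real N)" using hk(3) by (intro mult_strict_left_mono) auto
      also have "\<dots> \<le> \<eta>" using N(2) by simp
      finally have ub: "\<bar>u\<bar> < \<eta>" .
      have cu: "cis u = cis y ^ nat k"
      proof -
        have "cis u = cis (of_int k * y) / cis (2 * pi * of_int h)" unfolding u_def by (rule cis_divide[symmetric])
        also have "cis (2 * pi * of_int h) = 1" by (rule cis_multiple_2pi) simp
        also have "cis (of_int k * y) = cis y ^ nat k" 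
          using hk(1) Complex.DeMoivre[of y "nat k"] by simp
        finally show ?thesis by simp
      qed
      have "u \<in> T" using y stab_power[of "cis y"] cu by (simp add: T_def)
      hence "u = 0" using ub H' by blast
      hence c1: "cis y ^ nat k = 1" using cu by simp
      have "nat k dvd fact N" using hk by (intro dvd_fact) auto
      hence "nat k dvd 12 * fact N" by simp
      then obtain l where "12 * fact N = nat k * l" by blast
      thus ?thesis using c1 by (simp add: power_mult)
    qed
    (* The factor 12 makes the angle independent of the choice of representatives. *)
    define m' where "m' = 12 * (fact N :: nat)"
    have m': "m' > 0" "12 dvd m'" by (simp_all add: m'_def)
    define C where "C = {s. norm s = 1 \<and> Re (s ^ m') \<le> 1 / 2}"
    have "C = sphere 0 1 \<inter> {s. Re (s ^ m') \<le> 1 / 2}" by (auto simp: C_def)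
    moreover have "closed {s. Re (s ^ m') \<le> 1 / 2}" by (intro closed_Collect_le continuous_intros)
    ultimately have cC: "compact C" by (simp add: compact_Int_closed)
    have c0: "0 \<notin> C" by (simp add: C_def)
    have cS: "C \<inter> stab = {}"
    proof -
      have "False" if s: "s \<in> C" "s \<in> stab" for s
      proof -
        have n: "norm s = 1" using s(1) by (simp add: C_def)
        hence "s \<noteq> 0" by auto
        hence eq: "cis (Arg s) = s" using cis_Arg[of s] n by (simp add: sgn_eq)
        hence "Arg s \<in> T" using s(2) by (simp add: T_def)
        hence "s ^ m' = 1" using torsion[of "Arg s"] eq by (simp add: m'_def)
        thus False using s(1) by (simp add: C_def)
      qed
      thus ?thesis by blast
    qed
    obtain E where E: "small E" "\<And>\<pi> \<rho>. \<pi> \<in> deg1_primes - E \<Longrightarrow> \<rho> \<in> deg1_primes - E \<Longrightarrow> \<pi> / \<rho> \<notin> C"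
      by (rule compact_avoids_quotients[OF cC c0 cS], rule that)
    obtain \<pi> where \<pi>: "\<pi> \<in> deg1_primes - (E \<union> {\<pi>\<in>deg1_primes. canon (cnj \<pi>) \<in> E})" "Re ((\<pi> / cnj \<pi>) ^ m') \<le> 1 / 2"
      using split_angles_spread[OF small_Un[OF E(1) small_conj[OF E(1)]] m'] by blast
    have p: "\<pi> \<in> deg1_primes" "canon (cnj \<pi>) \<in> deg1_primes - E" using \<pi> canon_cnj_deg1_primes by auto
    have "norm (\<pi> / canon (cnj \<pi>)) = 1"
    proof -
      have "(norm \<pi>)\<^sup>2 = (norm (canon (cnj \<pi>)))\<^sup>2"
        using real_nrm[of \<pi>] real_nrm[of "canon (cnj \<pi>)"] canon_cnj_deg1_primes[OF p(1)] deg1_primesD(1) p by simp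
      hence "norm \<pi> = norm (canon (cnj \<pi>))" by simp
      moreover have "norm \<pi> \<noteq> 0" using p prime_reps_nonzero by (auto simp: prime_reps_def)
      ultimately show ?thesis by (simp add: norm_divide)
    qed
    moreover have "Re ((\<pi> / canon (cnj \<pi>)) ^ m') \<le> 1 / 2"
      unfolding canon_cnj_quotient_power[OF p(1) m'(2)] by (rule \<pi>(2))
    ultimately have "\<pi> / canon (cnj \<pi>) \<in> C" by (simp add: C_def)
    thus False using E(2)[of \<pi> "canon (cnj \<pi>)"] \<pi> p by auto
  qed
  have "x \<in> T" by (rule closed_subgroup_real_UNIV[of T, OF diff closed small_el])
  thus ?thesis by (simp add: T_def)
qed

lemma norm_in_stab: 
  assumes "s \<in> stab"
  shows "of_real (norm s) \<in> stab"
proof -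
  have s: "s \<noteq> 0" using assms by (simp add: stab_def)
  have "of_real (norm s) * cis (Arg s) = s" using rcis_cmod_Arg[of s] by (simp add: rcis_def)
  from arg_cong[OF this, of "\<lambda>w. w * cis (- Arg s)"]
  have "of_real (norm s) = s * cis (- Arg s)" by (simp add: mult.assoc cis_mult)
  thus ?thesis using stab_mult[OF assms circle_in_stab, of "- Arg s"] by simp
qed

text \<open>
Since the circle is already in \<open>stab\<close>, membership depends only on the absolute value. If small dilations
were missing, \<open>stab\<close> would miss a whole annulus, which contains quotients of primes by
\<open>split_norms_spread\<close>.
\<close>

lemma positive_reals_in_stab: "of_real (exp x) \<in> stab"
proof -
  define T where "T = {x. of_real (exp x) \<in> stab}"
  have diff: "x - y \<in> T" if "x \<in> T" "y \<in> T" for x y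
  proof -
    have eq: "complex_of_real (exp (x - y)) = of_real (exp x) * inverse (of_real (exp y))"
      by (simp add: exp_diff divide_inverse)
    show ?thesis unfolding T_def mem_Collect_eq eq
      by (rule stab_mult[OF _ stab_inverse]) (use that in \<open>simp_all add: T_def\<close>)
  qed
  have closed: "x \<in> T" if lim: "\<And>\<delta>. \<delta> > 0 \<Longrightarrow> \<exists>y\<in>T. \<bar>y - x\<bar> \<le> \<delta>" for x
    unfolding T_def mem_Collect_eq
  proof (rule stab_closed)
    fix \<delta> :: real assume d: "\<delta> > 0"
    have "((\<lambda>u. exp u - 1) \<longlongrightarrow> exp 0 - (1::real)) (at 0)" by (intro tendsto_intros)
    hence "\<forall>\<^sub>F u in at (0::real). dist (exp u - 1) 0 < \<delta>" using d by (intro tendstoD) auto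
    then obtain \<eta> where \<eta>: "\<eta> > 0" "\<And>u::real. u \<noteq> 0 \<Longrightarrow> \<bar>u\<bar> < \<eta> \<Longrightarrow> \<bar>exp u - 1\<bar> < \<delta>"
      unfolding eventually_at by (auto simp: dist_real_def)
    obtain y where y: "y \<in> T" "\<bar>y - x\<bar> \<le> \<eta> / 2" using lim[of "\<eta> / 2"] \<eta>(1) by auto
    have "\<bar>exp (y - x) - 1\<bar> \<le> \<delta>" using \<eta>(2)[of "y - x"] y(2) \<eta>(1) d by (cases "y = x") auto
    moreover have "complex_of_real (exp y) / of_real (exp x) - 1 = of_real (exp (y - x) - 1)"
      by (simp add: exp_diff)
    ultimately have "norm (complex_of_real (exp y) / of_real (exp x) - 1) \<le> \<delta>" by (simp only: norm_of_real)
    thus "\<exists>s'\<in>stab. norm (s' / of_real (exp x) - 1) \<le> \<delta>" using y(1) by (auto simp: T_def)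
  qed simp
  have small_el: "\<exists>x\<in>T. 0 < x \<and> x < \<eta>" if \<eta>: "\<eta> > 0" for \<eta>
  proof (rule ccontr)
    assume H: "\<not> (\<exists>x\<in>T. 0 < x \<and> x < \<eta>)"
    have R: "\<eta> / 2 > 0" using \<eta> by simp
    obtain \<delta> where d: "0 < \<delta>" "\<delta> < \<eta> / 2"
      "\<And>E. small E \<Longrightarrow> \<exists>\<pi>\<in>deg1_primes - E. \<exists>\<rho>\<in>deg1_primes - E. exp \<delta> \<le> cmod \<pi> / cmod \<rho> \<and> cmod \<pi> / cmod \<rho> \<le> exp (\<eta> / 2)"
      using split_norms_spread[OF R] by blast
    define C where "C = {s :: complex. exp \<delta> \<le> norm s \<and> norm s \<le> exp (\<eta> / 2)}"
    have cC: "compact C"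
    proof -
      have "C = cball 0 (exp (\<eta> / 2)) \<inter> {s. exp \<delta> \<le> norm s}" by (auto simp: C_def)
      moreover have "closed {s :: complex. exp \<delta> \<le> norm s}" by (intro closed_Collect_le continuous_intros)
      ultimately show ?thesis by (simp add: compact_Int_closed)
    qed
    have c0: "0 \<notin> C" by (simp add: C_def)
    have cS: "C \<inter> stab = {}"
    proof -
      have False if s: "s \<in> C" "s \<in> stab" for s
      proof -
        have pos: "norm s > 0" using s(1) less_le_trans[OF exp_gt_zero[of \<delta>]] by (auto simp: C_def)
        have "ln (norm s) \<in> T" using norm_in_stab[OF s(2)] pos by (simp add: T_def)
        moreover have "\<delta> \<le> ln (norm s)" "ln (norm s) \<le> \<eta> / 2"
          using s(1) pos by (simp_all add: C_def ln_ge_iff ln_le_cancel_iff[of "norm s" "exp (\<eta> / 2)", simplified, symmetric])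
        ultimately show False using H d \<eta> by force
      qed
      thus ?thesis by blast
    qed
    obtain E where E: "small E" "\<And>\<pi> \<rho>. \<pi> \<in> deg1_primes - E \<Longrightarrow> \<rho> \<in> deg1_primes - E \<Longrightarrow> \<pi> / \<rho> \<notin> C"
      by (rule compact_avoids_quotients[OF cC c0 cS], rule that)
    obtain \<pi> \<rho> where "\<pi> \<in> deg1_primes - E" "\<rho> \<in> deg1_primes - E" "exp \<delta> \<le> cmod \<pi> / cmod \<rho>" "cmod \<pi> / cmod \<rho> \<le> exp (\<eta> / 2)"
      using d(3)[OF E(1)] by blast
    thus False using E(2)[of \<pi> \<rho>] by (simp add: C_def norm_divide)
  qed
  have "x \<in> T" by (rule closed_subgroup_real_UNIV[of T, OF diff closed small_el])
  thus ?thesis by (simp add: T_def)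
qed

text \<open>
By the two symmetry lemmas each \<open>G j\<close> is constant, and \<open>G 0 1\<close> is close to \<open>G 1 \<pi> = G 1 1\<close> for
most primes \<open>\<pi>\<close>.
\<close>

theorem L_shift_invariant: "L 0 \<phi> = L 1 \<phi>"
proof -
  have G1: "G j 1 = L j \<phi>" for j by (simp add: G_def)
  have const: "G j s = G j 1" if "s \<noteq> 0" for s j
  proof -
    have "s = of_real (exp (ln (norm s))) * cis (Arg s)"
      using that rcis_cmod_Arg[of s] by (simp add: rcis_def)
    hence "s \<in> stab" using stab_mult[OF positive_reals_in_stab circle_in_stab] by metis
    thus ?thesis unfolding stab_def by (metis (mono_tags, lifting) mem_Collect_eq mult_1 zero_neq_one)
  qed
  have "G 0 1 = G 1 1"
  proof (rule eq_if_arbitrarily_close)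
    fix e :: real assume e: "e > 0"
    obtain \<pi> where \<pi>: "\<pi> \<in> deg1_primes - bad 0 1 e"
      using small_infinite_complement[OF small_bad[of 1 e 0]] e by auto
    have "\<pi> \<noteq> 0" using \<pi> prime_reps_nonzero by (auto simp: prime_reps_def)
    hence "G 1 \<pi> = G 1 1" by (rule const)
    thus "\<bar>G 0 1 - G 1 1\<bar> \<le> 1 * e" using \<pi> by (auto simp: bad_def)
  qed
  thus ?thesis by (simp add: G1)
qed

end

section \<open>From bumps to the sector, and the theorem\<close>

lemma min_lipschitz: "\<bar>a - c\<bar> \<le> k \<Longrightarrow> \<bar>b - d\<bar> \<le> k \<Longrightarrow> \<bar>min a b - min c d\<bar> \<le> k" for a b c d k :: real
  by (auto simp: min_def abs_le_iff)

lemma max_lipschitz: "\<bar>a - c\<bar> \<le> k \<Longrightarrow> \<bar>b - d\<bar> \<le> k \<Longrightarrow> \<bar>max a b - max c d\<bar> \<le> k" for a b c d k :: real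
  by (auto simp: max_def abs_le_iff)

lemma card_le_spread:
  fixes Y :: "nat set"
  assumes "\<And>y y'. y \<in> Y \<Longrightarrow> y' \<in> Y \<Longrightarrow> y \<le> y' \<Longrightarrow> real (y' - y) \<le> D" "D \<ge> 0" "finite Y"
  shows "real (card Y) \<le> D + 1"
proof (cases "Y = {}")
  case False
  define y0 where "y0 = Min Y"
  have y0: "y0 \<in> Y" "\<And>y. y \<in> Y \<Longrightarrow> y0 \<le> y" using False assms(3) by (auto simp: y0_def)
  have "Y \<subseteq> {y0..y0 + nat \<lfloor>D\<rfloor>}"
  proof
    fix y assume y: "y \<in> Y"
    have "real (y - y0) \<le> D" using assms(1)[OF y0(1) y y0(2)[OF y]] .
    hence "y - y0 \<le> nat \<lfloor>D\<rfloor>" by (simp add: le_nat_floor)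
    thus "y \<in> {y0..y0 + nat \<lfloor>D\<rfloor>}" using y0(2)[OF y] by auto
  qed
  hence "card Y \<le> nat \<lfloor>D\<rfloor> + 1" using card_mono[of "{y0..y0 + nat \<lfloor>D\<rfloor>}" Y] by simp
  thus ?thesis using assms(2) by linarith
qed (use assms in auto)

context heegner_order begin

definition jump :: "(nat \<Rightarrow> real) \<Rightarrow> complex \<Rightarrow> real" where
  "jump a \<alpha> = (if \<alpha> = 0 then 0 else a (big_Omega (nrm \<alpha>) + 1) - a (big_Omega (nrm \<alpha>)))"

text \<open>
Convergence may be tested along ultrafilters: a filter on which the mean stays away from 0 would have
a refinement that contradicts \<open>L_shift_invariant\<close>.
\<close>

lemma lattice_mean_jump_tendsto_0:
  assumes t: "test \<phi> K r" and a: "\<And>n. \<bar>a n\<bar> \<le> A"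
  shows "(lattice_mean \<phi> (jump a) \<longlongrightarrow> 0) at_top"
proof (rule tendstoI, rule ccontr)
  fix e :: real assume e: "e > 0" and H: "\<not> (\<forall>\<^sub>F X in at_top. dist (lattice_mean \<phi> (jump a) X) 0 < e)"
  define F0 where "F0 = inf at_top (principal {X. \<not> dist (lattice_mean \<phi> (jump a) X) 0 < e})"
  have "F0 \<noteq> bot"
    using H unfolding F0_def trivial_limit_def eventually_inf_principal by simp
  then obtain F where F: "F \<le> F0" "F \<noteq> bot"
    "\<And>h :: real \<Rightarrow> real. (\<exists>B. \<forall>\<^sub>F x in F0. \<bar>h x\<bar> \<le> B) \<Longrightarrow> \<exists>l. (h \<longlongrightarrow> l) F"
    by (rule ultrafilter_refinement[of F0]) blast
  have F0: "F0 \<le> at_top" by (simp add: F0_def)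
  interpret omega_limit_test t m F a A \<phi> K r
  proof
    show "F \<le> at_top" using F(1) F0 by (rule order_trans)
    show "\<exists>l. (h \<longlongrightarrow> l) F" if hb: "\<exists>B. \<forall>\<^sub>F x in at_top. \<bar>h x\<bar> \<le> B" for h :: "real \<Rightarrow> real"
    proof (rule F(3))
      obtain B where "\<forall>\<^sub>F x in at_top. \<bar>h x\<bar> \<le> B" using hb by blast
      hence "\<forall>\<^sub>F x in F0. \<bar>h x\<bar> \<le> B" using F0 by (rule filter_leD[rotated])
      thus "\<exists>B. \<forall>\<^sub>F x in F0. \<bar>h x\<bar> \<le> B" by blast
    qed
  qed (use F a t in auto)
  have eq: "\<forall>\<^sub>F X in F. lattice_mean \<phi> (g 1) X - lattice_mean \<phi> (g 0) X = lattice_mean \<phi> (jump a) X"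
    using eventually_F[OF eventually_gt_at_top[of 0]]
  proof eventually_elim
    case (elim X)
    have "lattice_mean \<phi> (jump a) X = lattice_mean \<phi> (\<lambda>\<alpha>. 1 * g 1 \<alpha> + (-1) * g 0 \<alpha>) X"
      by (rule arg_cong[of _ _ "\<lambda>h. lattice_mean \<phi> h X"]) (auto simp: jump_def g_def)
    also have "\<dots> = 1 * lattice_mean \<phi> (g 1) X + (-1) * lattice_mean \<phi> (g 0) X" by (rule lattice_mean_lin[OF testD(4)[OF t] elim])
    finally show ?case by simp
  qed
  have "((\<lambda>X. lattice_mean \<phi> (g 1) X - lattice_mean \<phi> (g 0) X) \<longlongrightarrow> L 1 \<phi> - L 0 \<phi>) F"
    by (intro tendsto_diff L_tendsto[OF t])
  hence "(lattice_mean \<phi> (jump a) \<longlongrightarrow> 0) F" using L_shift_invariant tendsto_cong[OF eq] by simp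
  hence "\<forall>\<^sub>F X in F. dist (lattice_mean \<phi> (jump a) X) 0 < e" using e by (rule tendstoD)
  moreover have "\<forall>\<^sub>F X in F. \<not> dist (lattice_mean \<phi> (jump a) X) 0 < e"
    by (rule filter_leD[OF F(1)]) (simp add: F0_def eventually_inf_principal)
  ultimately have "\<forall>\<^sub>F X in F. False" by eventually_elim blast
  thus False using F(2) by (simp add: trivial_limit_def)
qed

definition pairs :: "nat \<Rightarrow> (nat \<times> nat) set" where
  "pairs N = {(x, y). 0 < x \<and> 0 < y \<and> q (int x) (int y) \<le> int N}"

definition pel :: "nat \<times> nat \<Rightarrow> complex" where
  "pel = (\<lambda>(x, y). el (int x) (int y))"

lemma q_ge_squares: "x\<^sup>2 \<le> q x y" "y\<^sup>2 \<le> q x y" if "0 \<le> x" "0 \<le> y" for x y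
proof -
  have "0 \<le> t * x * y" using t_cases that by auto
  moreover have "1 * y\<^sup>2 \<le> m * y\<^sup>2" using m_pos by (intro mult_right_mono) auto
  moreover have "0 \<le> x\<^sup>2" "0 \<le> y\<^sup>2" by simp_all
  ultimately show "x\<^sup>2 \<le> q x y" "y\<^sup>2 \<le> q x y" unfolding q_def by linarith+
qed

lemma cmod_pel: "(cmod (pel (x, y)))\<^sup>2 = real_of_int (q (int x) (int y))"
  by (simp add: pel_def cmod_el)

lemma pairs_iff: 
  assumes "X = sqrt (real N)"
  shows "(x, y) \<in> pairs N \<longleftrightarrow> 0 < x \<and> 0 < y \<and> cmod (pel (x, y)) \<le> X"
proof -
  have "cmod (pel (x, y)) \<le> X \<longleftrightarrow> (cmod (pel (x, y)))\<^sup>2 \<le> real N"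
    unfolding assms
  proof -
    have "(sqrt (real N))\<^sup>2 = real N" by simp
    thus "cmod (pel (x, y)) \<le> sqrt (real N) \<longleftrightarrow> (cmod (pel (x, y)))\<^sup>2 \<le> real N"
      using power_mono[of "cmod (pel (x, y))" "sqrt (real N)" 2] real_le_rsqrt[of "cmod (pel (x, y))" "real N"] by auto
  qed
  also have "\<dots> \<longleftrightarrow> real_of_int (q (int x) (int y)) \<le> real_of_int (int N)" unfolding cmod_pel by simp
  also have "\<dots> \<longleftrightarrow> q (int x) (int y) \<le> int N" by (rule of_int_le_iff)
  finally show ?thesis by (simp add: pairs_def)
qed

lemma pairs_le:
  assumes "X = sqrt (real N)" "(x, y) \<in> pairs N"
  shows "real x \<le> X" "real y \<le> X"
proof -
  have le: "q (int x) (int y) \<le> int N" using assms(2) by (simp add: pairs_def)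
  have "(int x)\<^sup>2 \<le> int N" by (rule order_trans[OF q_ge_squares(1) le]) simp_all
  moreover have "(int y)\<^sup>2 \<le> int N" by (rule order_trans[OF q_ge_squares(2) le]) simp_all
  ultimately have "real_of_int ((int x)\<^sup>2) \<le> real_of_int (int N)" "real_of_int ((int y)\<^sup>2) \<le> real_of_int (int N)"
    unfolding of_int_le_iff .
  hence "(real x)\<^sup>2 \<le> real N" "(real y)\<^sup>2 \<le> real N" by simp_all
  thus "real x \<le> X" "real y \<le> X" unfolding assms(1) by (auto intro: real_le_rsqrt)
qed

lemma finite_pairs: "finite (pairs N)"
proof (rule finite_subset)
  show "pairs N \<subseteq> {..nat \<lfloor>sqrt (real N)\<rfloor>} \<times> {..nat \<lfloor>sqrt (real N)\<rfloor>}"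
  proof
    fix z assume z: "z \<in> pairs N"
    obtain x y where xy: "z = (x, y)" by (cases z)
    have "real x \<le> sqrt (real N)" "real y \<le> sqrt (real N)" using pairs_le[OF refl, of x y N] z xy by auto
    thus "z \<in> {..nat \<lfloor>sqrt (real N)\<rfloor>} \<times> {..nat \<lfloor>sqrt (real N)\<rfloor>}" by (simp add: xy le_nat_floor)
  qed
qed simp

lemma card_pairs_lower:
  assumes X: "X = sqrt (real N)" "X \<ge> 16"
  shows "X\<^sup>2 / 256 \<le> real (card (pairs N))"
proof -
  define n where "n = nat \<lfloor>X / 8\<rfloor>"
  have n: "real n \<le> X / 8" "X / 16 \<le> real n"
  proof -
    have "real n = of_int \<lfloor>X / 8\<rfloor>" using X by (simp add: n_def)
    thus "real n \<le> X / 8" "X / 16 \<le> real n" using X by linarith+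
  qed
  (* On this square the norm is at most 50 (X/8)^2 < X^2. *)
  have "{1..n} \<times> {1..n} \<subseteq> pairs N"
  proof
    fix z assume "z \<in> {1..n} \<times> {1..n}"
    then obtain x y where xy: "z = (x, y)" "1 \<le> x" "x \<le> n" "1 \<le> y" "y \<le> n" by auto
    have "q (int x) (int y) \<le> 50 * (int n)\<^sup>2" using xy by (intro q_le) auto
    hence "real_of_int (q (int x) (int y)) \<le> real_of_int (50 * (int n)\<^sup>2)" unfolding of_int_le_iff .
    also have "\<dots> = 50 * (real n)\<^sup>2" by simp
    also have "\<dots> \<le> 50 * (X / 8)\<^sup>2" using n(1) by (intro mult_left_mono power_mono) auto
    also have "\<dots> \<le> X\<^sup>2" by (simp add: power_divide)
    also have "X\<^sup>2 = real_of_int (int N)" using X(1) by simp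
    finally have "q (int x) (int y) \<le> int N" unfolding of_int_le_iff .
    thus "z \<in> pairs N" using xy by (simp add: pairs_def)
  qed
  hence "card ({1..n} \<times> {1..n}) \<le> card (pairs N)" by (rule card_mono[OF finite_pairs])
  hence "real (n * n) \<le> real (card (pairs N))" by (simp only: card_cartesian_product card_atLeastAtMost of_nat_le_iff diff_add_inverse2 Suc_eq_plus1)
  moreover have "(X / 16) * (X / 16) \<le> real n * real n" using n(2) X(2) by (intro mult_mono) auto
  ultimately show ?thesis by (simp add: power2_eq_square)
qed

text \<open>
The coordinates of \<open>z\<close> with respect to the real basis 1, \<open>\<lambda>\<close>. The sector is where both are positive.
\<close>

definition coord_y :: "complex \<Rightarrow> real" where
  "coord_y z = Im z / (sqrt (of_int (4 * m - t\<^sup>2)) / 2)"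

definition coord_x :: "complex \<Rightarrow> real" where
  "coord_x z = Re z - coord_y z * (of_int t / 2)"

definition coord_bound :: real where
  "coord_bound = 1 + 1 / (sqrt (of_int (4 * m - t\<^sup>2)) / 2)"

lemma coord_bound_pos: "coord_bound \<ge> 1" using sqrt_disc by (simp add: coord_bound_def)

lemma coord_y_lipschitz: "\<bar>coord_y z - coord_y w\<bar> \<le> coord_bound * norm (z - w)"
  and coord_x_lipschitz: "\<bar>coord_x z - coord_x w\<bar> \<le> coord_bound * norm (z - w)"
proof -
  define s where "s = 1 / (sqrt (of_int (4 * m - t\<^sup>2)) / 2)"
  have s: "s > 0" using sqrt_disc by (simp add: s_def)
  have "coord_y z = s * Im z" for z by (simp add: coord_y_def s_def)
  hence diff_y: "coord_y z - coord_y w = s * Im (z - w)" by (simp add: right_diff_distrib)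
  have 1: "\<bar>coord_y z - coord_y w\<bar> \<le> s * norm (z - w)"
    unfolding diff_y using s abs_Im_le_cmod[of "z - w"] by (simp add: abs_mult mult_left_mono)
  have bd: "coord_bound = 1 + s" by (simp add: coord_bound_def s_def)
  have n: "0 \<le> norm (z - w)" by simp
  show "\<bar>coord_y z - coord_y w\<bar> \<le> coord_bound * norm (z - w)" using 1 n unfolding bd distrib_right mult_1_left by linarith
  have "coord_x z - coord_x w = Re (z - w) - (coord_y z - coord_y w) * (of_int t / 2)" by (simp add: coord_x_def algebra_simps)
  also have "\<bar>\<dots>\<bar> \<le> \<bar>Re (z - w)\<bar> + \<bar>(coord_y z - coord_y w) * (of_int t / 2)\<bar>" by (rule abs_triangle_ineq4)
  also have "\<dots> \<le> norm (z - w) + \<bar>coord_y z - coord_y w\<bar> * 1"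
    using t_cases by (intro add_mono abs_Re_le_cmod) (auto simp: abs_mult)
  finally show "\<bar>coord_x z - coord_x w\<bar> \<le> coord_bound * norm (z - w)" using 1 unfolding bd distrib_right mult_1_left mult_1_right by linarith
qed

lemma coord_y_pel: "coord_y (pel (x, y) / of_real X) = real y / X"
  and coord_x_pel: "coord_x (pel (x, y) / of_real X) = real x / X"
proof -
  show 1: "coord_y (pel (x, y) / of_real X) = real y / X"
    using sqrt_disc by (simp add: coord_y_def pel_def Im_el Im_divide_of_real)
  show "coord_x (pel (x, y) / of_real X) = real x / X"
    unfolding coord_x_def 1 by (simp add: pel_def Re_el Re_divide_of_real add_divide_distrib)
qed

text \<open>
A Lipschitz approximation from below to the indicator of \<open>{z. coord_x z > 0, coord_y z > 0, \<bar>z\<bar> \<le> 1}\<close>;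
it equals 1 as soon as all three inequalities hold with a margin \<open>\<epsilon>\<close>.
\<close>

definition cone :: "real \<Rightarrow> complex \<Rightarrow> real" where
  "cone \<epsilon> z = max 0 (min (min 1 (coord_x z / \<epsilon>)) (min (coord_y z / \<epsilon>) ((1 - norm z) / \<epsilon>)))"

lemma cone_test:
  assumes "\<epsilon> > 0"
  shows "test (cone \<epsilon>) (coord_bound / \<epsilon>) 1"
  unfolding test_def
proof (intro conjI allI)
  show "0 \<le> coord_bound / \<epsilon>" using assms coord_bound_pos by simp
  show "supp (cone \<epsilon>) 1"
    unfolding supp_def
  proof (intro allI impI)
    fix z :: complex assume "norm z > 1"
    hence "(1 - norm z) / \<epsilon> \<le> 0" using assms by (simp add: divide_nonpos_pos)
    thus "cone \<epsilon> z = 0" unfolding cone_def by linarith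
  qed
  fix z w :: complex
  have k: "coord_bound / \<epsilon> * norm (z - w) = coord_bound * norm (z - w) / \<epsilon>" by simp
  have 1: "\<bar>coord_x z / \<epsilon> - coord_x w / \<epsilon>\<bar> \<le> coord_bound / \<epsilon> * norm (z - w)" "\<bar>coord_y z / \<epsilon> - coord_y w / \<epsilon>\<bar> \<le> coord_bound / \<epsilon> * norm (z - w)"
    using coord_x_lipschitz[of z w] coord_y_lipschitz[of z w] assms
    unfolding k diff_divide_distrib[symmetric] abs_divide by (auto simp: divide_right_mono)
  have "\<bar>(1 - norm z) - (1 - norm w)\<bar> \<le> norm (z - w)" 
    using norm_triangle_ineq3[of z w] by linarith
  also have "\<dots> \<le> coord_bound * norm (z - w)" using mult_right_mono[OF coord_bound_pos, of "norm (z - w)"] by simp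
  finally have 2: "\<bar>(1 - norm z) / \<epsilon> - (1 - norm w) / \<epsilon>\<bar> \<le> coord_bound / \<epsilon> * norm (z - w)"
    unfolding k diff_divide_distrib[symmetric] abs_divide using assms by (auto simp: divide_right_mono)
  have 0: "\<bar>c - c\<bar> \<le> coord_bound / \<epsilon> * norm (z - w)" for c :: real using assms coord_bound_pos by simp
  show "\<bar>cone \<epsilon> z - cone \<epsilon> w\<bar> \<le> coord_bound / \<epsilon> * norm (z - w)"
    unfolding cone_def by (intro max_lipschitz min_lipschitz 0 1 2)
qed simp

lemma cone_range: "0 \<le> cone \<epsilon> z" "cone \<epsilon> z \<le> 1"
  unfolding cone_def by linarith+

lemma lattice_mean_cone:
  assumes e: "\<epsilon> > 0" and X: "X = sqrt (real N)" "X > 0"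
  shows "lattice_mean (cone \<epsilon>) b X * X\<^sup>2 = (\<Sum>z\<in>pairs N. cone \<epsilon> (pel z / of_real X) * b (pel z))"
proof -
  have inj: "inj_on pel (pairs N)" by (auto simp: inj_on_def pel_def el_inj)
  have "(\<Sum>\<alpha>\<in>lattice_ball (1 * X). cone \<epsilon> (\<alpha> / of_real X) * b \<alpha>) = (\<Sum>\<alpha>\<in>pel ` pairs N. cone \<epsilon> (\<alpha> / of_real X) * b \<alpha>)"
  proof (rule sum.mono_neutral_right)
    show "pel ` pairs N \<subseteq> lattice_ball (1 * X)"
    proof
      fix \<alpha> assume "\<alpha> \<in> pel ` pairs N"
      then obtain x y where "(x, y) \<in> pairs N" "\<alpha> = pel (x, y)" by auto
      thus "\<alpha> \<in> lattice_ball (1 * X)" using pairs_iff[OF X(1), of x y] by (auto simp: lattice_ball_def pel_def)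
    qed
    show "\<forall>\<alpha>\<in>lattice_ball (1 * X) - pel ` pairs N. cone \<epsilon> (\<alpha> / of_real X) * b \<alpha> = 0"
    proof
      fix \<alpha> assume \<alpha>: "\<alpha> \<in> lattice_ball (1 * X) - pel ` pairs N"
      then obtain u v where uv: "\<alpha> = el u v" by (auto simp: lattice_ball_def elim: OK_cases)
      have "\<not> (u > 0 \<and> v > 0)"
      proof
        assume p: "u > 0 \<and> v > 0"
        have "\<alpha> = pel (nat u, nat v)" using p by (simp add: uv pel_def)
        moreover from this have "(nat u, nat v) \<in> pairs N"
          using \<alpha> p pairs_iff[OF X(1), of "nat u" "nat v"] by (simp add: lattice_ball_def)
        ultimately show False using \<alpha> by blast
      qed
      moreover have "coord_y (\<alpha> / of_real X) = of_int v / X"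
        using sqrt_disc by (simp add: coord_y_def uv Im_el Im_divide_of_real)
      moreover from this have "coord_x (\<alpha> / of_real X) = of_int u / X"
        unfolding coord_x_def by (simp add: uv Re_el Re_divide_of_real add_divide_distrib)
      ultimately have "coord_x (\<alpha> / of_real X) / \<epsilon> \<le> 0 \<or> coord_y (\<alpha> / of_real X) / \<epsilon> \<le> 0"
        using X(2) e by (auto simp: divide_le_0_iff not_less)
      hence "cone \<epsilon> (\<alpha> / of_real X) = 0" unfolding cone_def by (elim disjE) linarith+
      thus "cone \<epsilon> (\<alpha> / of_real X) * b \<alpha> = 0" by simp
    qed
  qed simp
  also have "\<dots> = (\<Sum>z\<in>pairs N. cone \<epsilon> (pel z / of_real X) * b (pel z))"
    by (subst sum.reindex[OF inj]) simp
  finally show ?thesis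
    unfolding lattice_mean_eq[OF testD(4)[OF cone_test[OF e]] X(2)] using X(2) by simp
qed

text \<open>
A pair in the boundary layer has a coordinate below \<open>\<epsilon> X\<close>, which leaves at most \<open>2 \<epsilon> X^2\<close> pairs, or its
norm is within a factor \<open>(1 - \<epsilon>)^2\<close> of \<open>X^2\<close>. In the latter case, for fixed \<open>x\<close>, any two admissible \<open>y\<close>
differ by at most \<open>sqrt (2 \<epsilon>) X\<close>, because the norm grows at least like \<open>(y' - y)^2\<close>.
\<close>

lemma boundary_count:
  assumes e: "0 < \<epsilon>" "\<epsilon> < 1" and X: "X = sqrt (real N)" "X \<ge> 1"
  shows "real (card {z\<in>pairs N. cone \<epsilon> (pel z / of_real X) \<noteq> 1}) \<le> X\<^sup>2 * (2 * \<epsilon> + sqrt (2 * \<epsilon>) + 1 / X)"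
proof -
  define n where "n = nat \<lfloor>X\<rfloor>"
  have n: "real n \<le> X" using X by (simp add: n_def)
  define k where "k = nat \<lfloor>\<epsilon> * X\<rfloor>"
  have k: "real k \<le> \<epsilon> * X" using X e by (simp add: k_def)
  define D where "D = sqrt (2 * \<epsilon>) * X"
  have D0: "D \<ge> 0" using e X by (simp add: D_def)
  define Y where "Y x = {y. (x, y) \<in> pairs N \<and> (1 - \<epsilon>) * X < cmod (pel (x, y))}" for x
  have nat_le: "u \<le> k" if "real u < \<epsilon> * X" for u using that by (simp add: k_def le_nat_floor)
  have nat_le': "u \<le> n" if "real u \<le> X" for u using that by (simp add: n_def le_nat_floor)
  have finY: "finite (Y x)" for x
    by (rule finite_subset[of _ "{..n}"]) (use pairs_le[OF X(1)] nat_le' in \<open>auto simp: Y_def\<close>)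
  have cardY: "real (card (Y x)) \<le> D + 1" for x
  proof (rule card_le_spread[OF _ D0 finY])
    fix y y' assume y: "y \<in> Y x" "y' \<in> Y x" "y \<le> y'"
    have sub: "real (y' - y) = real y' - real y" using y(3) by simp
    have "((1 - \<epsilon>) * X)\<^sup>2 \<le> (cmod (pel (x, y)))\<^sup>2" using y(1) e X by (intro power_mono) (auto simp: Y_def)
    moreover have "(cmod (pel (x, y')))\<^sup>2 \<le> X\<^sup>2" using y(2) pairs_iff[OF X(1)] by (intro power_mono) (auto simp: Y_def)
    moreover have "(cmod (pel (x, y)))\<^sup>2 + (real y' - real y)\<^sup>2 \<le> (cmod (pel (x, y')))\<^sup>2"
    proof -
      define a where "a = int y"
      define c where "c = int (y' - y)"
      have ac: "0 \<le> a" "0 \<le> c" "int y' = a + c" using y(3) by (auto simp: a_def c_def)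
      have 1: "0 \<le> t * int x * c" "0 \<le> m * (2 * a * c)" using t_cases ac m_pos by auto
      have 2: "1 * c\<^sup>2 \<le> m * c\<^sup>2" using m_pos by (intro mult_right_mono) auto
      have aux: "\<And>A u v w C :: int. 0 \<le> u \<Longrightarrow> 0 \<le> v \<Longrightarrow> 1 * C \<le> w \<Longrightarrow> A + C \<le> A + u + v + w" by simp
      have "q (int x) a + c\<^sup>2 \<le> q (int x) a + t * int x * c + m * (2 * a * c) + m * c\<^sup>2"
        by (rule aux[OF 1 2])
      also have "\<dots> = q (int x) (int y')"
        unfolding ac(3) by (simp add: q_def power2_eq_square algebra_simps)
      finally have "q (int x) a + c\<^sup>2 \<le> q (int x) (int y')" .
      hence "real_of_int (q (int x) a + c\<^sup>2) \<le> real_of_int (q (int x) (int y'))" unfolding of_int_le_iff .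
      thus ?thesis unfolding cmod_pel sub[symmetric] by (simp add: a_def c_def)
    qed
    moreover have "((1 - \<epsilon>) * X)\<^sup>2 = X\<^sup>2 - 2 * \<epsilon> * X\<^sup>2 + (\<epsilon> * X)\<^sup>2" by (simp add: power2_eq_square algebra_simps)
    moreover have "0 \<le> (\<epsilon> * X)\<^sup>2" by simp
    ultimately have "(real y' - real y)\<^sup>2 \<le> 2 * \<epsilon> * X\<^sup>2" by linarith
    also have "\<dots> = D\<^sup>2" using e by (simp add: D_def power_mult_distrib)
    finally have "real y' - real y \<le> D" using D0 by (rule power2_le_imp_le)
    thus "real (y' - y) \<le> D" using sub by simp
  qed
  have sub: "{z\<in>pairs N. cone \<epsilon> (pel z / of_real X) \<noteq> 1} \<subseteq> {1..k} \<times> {1..n} \<union> {1..n} \<times> {1..k} \<union> Sigma {1..n} Y"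
  proof
    fix z assume "z \<in> {z\<in>pairs N. cone \<epsilon> (pel z / of_real X) \<noteq> 1}"
    then obtain x y where z: "z = (x, y)" "(x, y) \<in> pairs N" "cone \<epsilon> (pel (x, y) / of_real X) \<noteq> 1" by (cases z) auto
    have xy: "1 \<le> x" "1 \<le> y" "x \<le> n" "y \<le> n"
      using z(2) pairs_iff[OF X(1), of x y] pairs_le[OF X(1) z(2)] nat_le' by auto
    show "z \<in> {1..k} \<times> {1..n} \<union> {1..n} \<times> {1..k} \<union> Sigma {1..n} Y"
    proof (cases "real x < \<epsilon> * X \<or> real y < \<epsilon> * X")
      case True
      thus ?thesis using xy nat_le z(1) by auto
    next
      case False
      hence 1: "coord_x (pel (x, y) / of_real X) / \<epsilon> \<ge> 1" "coord_y (pel (x, y) / of_real X) / \<epsilon> \<ge> 1"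
        unfolding coord_x_pel coord_y_pel using X e by (auto simp: field_simps)
      have "(1 - norm (pel (x, y) / of_real X)) / \<epsilon> < 1"
      proof (rule ccontr)
        assume "\<not> (1 - norm (pel (x, y) / of_real X)) / \<epsilon> < 1"
        hence "cone \<epsilon> (pel (x, y) / of_real X) = 1" using 1 unfolding cone_def by linarith
        thus False using z(3) by simp
      qed
      hence "(1 - \<epsilon>) * X < cmod (pel (x, y))" using e X by (simp add: norm_divide field_simps)
      thus ?thesis using z xy by (auto simp: Y_def)
    qed
  qed
  have "card {z\<in>pairs N. cone \<epsilon> (pel z / of_real X) \<noteq> 1} \<le> card ({1..k} \<times> {1..n} \<union> {1..n} \<times> {1..k} \<union> Sigma {1..n} Y)"
    by (rule card_mono[OF _ sub]) (use finY in auto)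
  moreover have "card ({1..k} \<times> {1..n} \<union> {1..n} \<times> {1..k} \<union> Sigma {1..n} Y)
      \<le> card ({1..k} \<times> {1..n} \<union> {1..n} \<times> {1..k}) + card (Sigma {1..n} Y)" by (rule card_Un_le)
  moreover have "card ({1..k} \<times> {1..n} \<union> {1..n} \<times> {1..k}) \<le> card ({1..k} \<times> {1..n}) + card ({1..n} \<times> {1..k})" by (rule card_Un_le)
  moreover have "card ({1..k} \<times> {1..n}) + card ({1..n} \<times> {1..k}) = 2 * (k * n)" by (simp add: card_cartesian_product)
  moreover have "card (Sigma {1..n} Y) = (\<Sum>x\<in>{1..n}. card (Y x))" using finY by (intro card_SigmaI) auto
  ultimately have "card {z\<in>pairs N. cone \<epsilon> (pel z / of_real X) \<noteq> 1} \<le> 2 * (k * n) + (\<Sum>x\<in>{1..n}. card (Y x))"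
    by linarith
  hence "real (card {z\<in>pairs N. cone \<epsilon> (pel z / of_real X) \<noteq> 1}) \<le> real (2 * (k * n) + (\<Sum>x\<in>{1..n}. card (Y x)))" 
    by (rule of_nat_mono)
  also have "\<dots> = 2 * (real k * real n) + (\<Sum>x\<in>{1..n}. real (card (Y x)))" by simp
  also have "\<dots> \<le> 2 * ((\<epsilon> * X) * X) + (\<Sum>x\<in>{1..n}. D + 1)"
    using k n X e by (intro add_mono mult_left_mono mult_mono sum_mono cardY) auto
  also have "\<dots> = 2 * ((\<epsilon> * X) * X) + real n * (D + 1)" by simp
  also have "\<dots> \<le> 2 * ((\<epsilon> * X) * X) + X * (D + 1)" using n D0 by (intro add_left_mono mult_right_mono) auto
  also have "2 * ((\<epsilon> * X) * X) + X * (D + 1) = X\<^sup>2 * (2 * \<epsilon> + sqrt (2 * \<epsilon>) + 1 / X)"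
    using X by (simp add: D_def power2_eq_square field_simps)
  finally show ?thesis by simp
qed

text \<open>
Choose \<open>\<epsilon>\<close> so that the boundary layer is negligible, and then \<open>N\<close> large for this \<open>\<epsilon>\<close>.
\<close>

theorem pairs_shift_average:
  assumes a: "\<And>n. \<bar>a n\<bar> \<le> A"
  shows "(\<lambda>N. (\<Sum>z\<in>pairs N. a (big_Omega (nrm (pel z)) + 1) - a (big_Omega (nrm (pel z)))) / card (pairs N)) \<longlonglongrightarrow> 0"
proof (rule tendstoI)
  fix e :: real assume e: "e > 0"
  have A0: "A \<ge> 0" using a[of 0] by linarith
  (* 512 = 2 * 256: the jump is at most 2 A, and there are at least X^2 / 256 pairs. *)
  define B where "B = 512 * A + 1"
  have B: "B > 0" using A0 by (simp add: B_def)
  have "((\<lambda>\<epsilon>::real. B * (2 * \<epsilon> + sqrt (2 * \<epsilon>))) \<longlongrightarrow> B * (2 * 0 + sqrt (2 * 0))) (at_right 0)" by (intro tendsto_intros)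
  hence "\<forall>\<^sub>F \<epsilon> in at_right (0::real). B * (2 * \<epsilon> + sqrt (2 * \<epsilon>)) < e / 3" using e by (intro order_tendstoD(2)) auto
  moreover have "\<forall>\<^sub>F \<epsilon>::real in at_right 0. 0 < \<epsilon> \<and> \<epsilon> < 1"
    using eventually_at_right_real[of 0 1] by (rule eventually_mono) auto
  ultimately have "\<forall>\<^sub>F \<epsilon>::real in at_right 0. B * (2 * \<epsilon> + sqrt (2 * \<epsilon>)) < e / 3 \<and> 0 < \<epsilon> \<and> \<epsilon> < 1"
    by eventually_elim auto
  then obtain \<epsilon> where \<epsilon>: "B * (2 * \<epsilon> + sqrt (2 * \<epsilon>)) < e / 3" "0 < \<epsilon>" "\<epsilon> < 1"
    using eventually_happens'[OF trivial_limit_at_right_real] by blast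
  have sq: "filterlim (\<lambda>N. sqrt (real N)) at_top sequentially" by real_asymp
  have "(\<lambda>N. lattice_mean (cone \<epsilon>) (jump a) (sqrt (real N))) \<longlonglongrightarrow> 0"
    by (rule filterlim_compose[OF lattice_mean_jump_tendsto_0[OF cone_test[OF \<epsilon>(2)] a] sq])
  hence "\<forall>\<^sub>F N in sequentially. dist (lattice_mean (cone \<epsilon>) (jump a) (sqrt (real N))) 0 < e / 3 / 256" using e by (intro tendstoD) auto
  hence ev1: "\<forall>\<^sub>F N in sequentially. \<bar>lattice_mean (cone \<epsilon>) (jump a) (sqrt (real N))\<bar> < e / 3 / 256" by (simp add: dist_real_def)
  have ev2: "\<forall>\<^sub>F N in sequentially. sqrt (real N) \<ge> max 16 (3 * B / e + 1)"
    using sq unfolding filterlim_at_top by blast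
  show "\<forall>\<^sub>F N in sequentially. dist ((\<Sum>z\<in>pairs N. a (big_Omega (nrm (pel z)) + 1) - a (big_Omega (nrm (pel z)))) / card (pairs N)) 0 < e"
    using ev1 ev2
  proof eventually_elim
    case (elim N)
    define X where "X = sqrt (real N)"
    have X: "X \<ge> 16" "X \<ge> 3 * B / e + 1" "X > 0"
    proof -
      show "X \<ge> 16" "X \<ge> 3 * B / e + 1" using elim(2) by (auto simp: X_def)
      thus "X > 0" by linarith
    qed
    define b where "b z = a (big_Omega (nrm (pel z)) + 1) - a (big_Omega (nrm (pel z)))" for z
    define c where "c z = cone \<epsilon> (pel z / of_real X)" for z
    have jb: "jump a (pel z) = b z" if "z \<in> pairs N" for z
    proof -
      have "pel z \<noteq> 0" using that by (auto simp: pairs_def pel_def el_eq_0_iff)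
      thus ?thesis by (simp add: jump_def b_def)
    qed
    have b2: "\<bar>b z\<bar> \<le> 2 * A" for z
      using a[of "big_Omega (nrm (pel z)) + 1"] a[of "big_Omega (nrm (pel z))"] unfolding b_def by linarith
    have "lattice_mean (cone \<epsilon>) (jump a) X * X\<^sup>2 = (\<Sum>z\<in>pairs N. c z * b z)"
      using lattice_mean_cone[OF \<epsilon>(2) X_def X(3), of "jump a"] jb by (simp add: c_def)
    hence "(\<Sum>z\<in>pairs N. b z) = lattice_mean (cone \<epsilon>) (jump a) X * X\<^sup>2 + (\<Sum>z\<in>pairs N. (1 - c z) * b z)"
      by (simp add: left_diff_distrib sum_subtractf)
    also have "\<bar>\<dots>\<bar> \<le> \<bar>lattice_mean (cone \<epsilon>) (jump a) X * X\<^sup>2\<bar> + \<bar>\<Sum>z\<in>pairs N. (1 - c z) * b z\<bar>" by (rule abs_triangle_ineq)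
    finally have whole: "\<bar>\<Sum>z\<in>pairs N. b z\<bar> \<le> \<bar>lattice_mean (cone \<epsilon>) (jump a) X * X\<^sup>2\<bar> + \<bar>\<Sum>z\<in>pairs N. (1 - c z) * b z\<bar>" .
    have "\<bar>\<Sum>z\<in>pairs N. (1 - c z) * b z\<bar> \<le> (\<Sum>z\<in>{z\<in>pairs N. c z \<noteq> 1}. 2 * A)"
    proof -
      have "(\<Sum>z\<in>pairs N. (1 - c z) * b z) = (\<Sum>z\<in>{z\<in>pairs N. c z \<noteq> 1}. (1 - c z) * b z)"
        by (rule sum.mono_neutral_right) (use finite_pairs in auto)
      also have "\<bar>\<dots>\<bar> \<le> (\<Sum>z\<in>{z\<in>pairs N. c z \<noteq> 1}. \<bar>(1 - c z) * b z\<bar>)" by (rule sum_abs)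
      also have "\<dots> \<le> (\<Sum>z\<in>{z\<in>pairs N. c z \<noteq> 1}. 2 * A)"
      proof (rule sum_mono)
        fix z
        have "\<bar>(1 - c z) * b z\<bar> \<le> 1 * (2 * A)"
          unfolding abs_mult using cone_range[of \<epsilon> "pel z / of_real X"] A0 by (intro mult_mono b2) (auto simp: c_def)
        thus "\<bar>(1 - c z) * b z\<bar> \<le> 2 * A" by simp
      qed
      finally show ?thesis .
    qed
    also have "\<dots> = real (card {z\<in>pairs N. c z \<noteq> 1}) * (2 * A)" by simp
    also have "\<dots> \<le> (X\<^sup>2 * (2 * \<epsilon> + sqrt (2 * \<epsilon>) + 1 / X)) * (2 * A)"
      unfolding c_def using A0 X(1) by (intro mult_right_mono boundary_count \<epsilon> X_def) auto
    finally have edge: "\<bar>\<Sum>z\<in>pairs N. (1 - c z) * b z\<bar> \<le> (X\<^sup>2 * (2 * \<epsilon> + sqrt (2 * \<epsilon>) + 1 / X)) * (2 * A)" .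
    have "\<bar>lattice_mean (cone \<epsilon>) (jump a) X * X\<^sup>2\<bar> \<le> (e / 3 / 256) * X\<^sup>2"
      unfolding abs_mult using elim(1) by (intro mult_mono) (auto simp: X_def)
    with whole edge have "\<bar>\<Sum>z\<in>pairs N. b z\<bar> \<le> (X\<^sup>2 / 256) * (e / 3 + 512 * A * (2 * \<epsilon> + sqrt (2 * \<epsilon>) + 1 / X))"
    proof -
      have "(e / 3 / 256) * X\<^sup>2 + (X\<^sup>2 * (2 * \<epsilon> + sqrt (2 * \<epsilon>) + 1 / X)) * (2 * A)
        = (X\<^sup>2 / 256) * (e / 3 + 512 * A * (2 * \<epsilon> + sqrt (2 * \<epsilon>) + 1 / X))" by (simp add: field_simps)
      thus ?thesis using whole edge \<open>\<bar>lattice_mean (cone \<epsilon>) (jump a) X * X\<^sup>2\<bar> \<le> (e / 3 / 256) * X\<^sup>2\<close> by linarith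
    qed
    also have "\<dots> < (X\<^sup>2 / 256) * e"
    proof (rule mult_strict_left_mono)
      have "512 * A * (2 * \<epsilon> + sqrt (2 * \<epsilon>) + 1 / X) \<le> B * (2 * \<epsilon> + sqrt (2 * \<epsilon>) + 1 / X)"
        using \<epsilon> X by (intro mult_right_mono) (auto simp: B_def)
      also have "\<dots> = B * (2 * \<epsilon> + sqrt (2 * \<epsilon>)) + B / X" by (simp add: algebra_simps)
      also have "B / X < e / 3"
      proof -
        have "3 * B / e < X" using X(2) by linarith
        thus ?thesis using e X(3) by (simp add: field_simps)
      qed
      finally show "e / 3 + 512 * A * (2 * \<epsilon> + sqrt (2 * \<epsilon>) + 1 / X) < e" using \<epsilon>(1) by linarith
    qed (use X in auto)
    also have "\<dots> \<le> real (card (pairs N)) * e" using card_pairs_lower[OF X_def X(1)] e by (intro mult_right_mono) auto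
    finally have main: "\<bar>\<Sum>z\<in>pairs N. b z\<bar> < real (card (pairs N)) * e" .
    have "real (card (pairs N)) > 0"
      by (rule less_le_trans[OF _ card_pairs_lower[OF X_def X(1)]]) (use X(3) in simp)
    thus ?case using main by (simp add: b_def dist_real_def abs_divide field_simps)
  qed
qed

end

text \<open>
Shifting the argument by any fixed \<open>k\<close> does not change the limiting average, so neither does averaging over
\<open>k < M\<close>; and after that the summands themselves are close to \<open>I\<close>.
\<close>

lemma (in heegner_order) pairs_average_tendsto:
  fixes a :: "nat \<Rightarrow> real"
  assumes a: "\<And>n. \<bar>a n\<bar> \<le> A"
    and unif: "\<And>e. e > 0 \<Longrightarrow> \<exists>M>0. \<forall>n. \<bar>(\<Sum>k<M. a (n + k)) / real M - I\<bar> \<le> e"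
  shows "(\<lambda>N. (\<Sum>z\<in>pairs N. a (big_Omega (nrm (pel z)))) / card (pairs N)) \<longlonglongrightarrow> I"
proof (rule tendstoI)
  fix e :: real assume e: "e > 0"
  define \<omega> where "\<omega> z = big_Omega (nrm (pel z))" for z
  define D where "D k N = (\<Sum>z\<in>pairs N. a (\<omega> z + k)) / real (card (pairs N))" for k N
  have step: "(\<lambda>N. D (Suc k) N - D k N) \<longlonglongrightarrow> 0" for k
  proof -
    have "(\<lambda>N. (\<Sum>z\<in>pairs N. a (\<omega> z + 1 + k) - a (\<omega> z + k)) / card (pairs N)) \<longlonglongrightarrow> 0"
      unfolding \<omega>_def by (rule pairs_shift_average[of "\<lambda>n. a (n + k)" A]) (rule a)
    thus ?thesis by (simp add: D_def sum_subtractf diff_divide_distrib)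
  qed
  have shift: "(\<lambda>N. D k N - D 0 N) \<longlonglongrightarrow> 0" for k
  proof (induction k)
    case (Suc k)
    have "(\<lambda>N. (D (Suc k) N - D k N) + (D k N - D 0 N)) \<longlonglongrightarrow> 0 + 0"
      by (intro tendsto_add step Suc)
    thus ?case by simp
  qed simp
  obtain M where M: "M > 0" "\<And>n. \<bar>(\<Sum>k<M. a (n + k)) / real M - I\<bar> \<le> e / 2" using unif[of "e / 2"] e by auto
  have "(\<lambda>N. (\<Sum>k<M. D k N - D 0 N) / real M) \<longlonglongrightarrow> (\<Sum>k<M. 0) / real M"
    by (intro tendsto_divide tendsto_sum shift tendsto_const) (use M in auto)
  hence "\<forall>\<^sub>F N in sequentially. dist ((\<Sum>k<M. D k N - D 0 N) / real M) 0 < e / 2" using e by (intro tendstoD) auto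
  moreover have "\<forall>\<^sub>F N in sequentially. sqrt (real N) \<ge> 16"
  proof -
    have "filterlim (\<lambda>N. sqrt (real N)) at_top sequentially" by real_asymp
    thus ?thesis unfolding filterlim_at_top by blast
  qed
  ultimately show "\<forall>\<^sub>F N in sequentially. dist ((\<Sum>z\<in>pairs N. a (big_Omega (nrm (pel z)))) / card (pairs N)) I < e"
  proof eventually_elim
    case (elim N)
    define c where "c = real (card (pairs N))"
    have "0 < sqrt (real N)" using elim(2) by linarith
    hence "0 < (sqrt (real N))\<^sup>2 / 256" by (intro divide_pos_pos zero_less_power) simp_all
    hence c: "c > 0" unfolding c_def using card_pairs_lower[OF refl elim(2)] by linarith
    have "(\<Sum>k<M. D k N) / real M = (\<Sum>z\<in>pairs N. (\<Sum>k<M. a (\<omega> z + k)) / real M) / c"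
      unfolding D_def c_def[symmetric] sum_divide_distrib[symmetric] by (subst sum.swap) simp
    hence "(\<Sum>k<M. D k N) / real M - I = (\<Sum>z\<in>pairs N. (\<Sum>k<M. a (\<omega> z + k)) / real M - I) / c"
      using c by (simp add: sum_subtractf diff_divide_distrib c_def)
    also have "\<bar>\<dots>\<bar> \<le> (\<Sum>z\<in>pairs N. e / 2) / c"
      unfolding abs_divide using c e by (intro frac_le order_trans[OF sum_abs] sum_mono M(2)) auto
    also have "\<dots> = e / 2" using c by (simp add: c_def)
    finally have "\<bar>(\<Sum>k<M. D k N) / real M - I\<bar> \<le> e / 2" .
    moreover have "(\<Sum>k<M. D k N - D 0 N) / real M = (\<Sum>k<M. D k N) / real M - D 0 N"
      using M(1) by (simp add: sum_subtractf diff_divide_distrib)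
    ultimately have "\<bar>D 0 N - I\<bar> < e" using elim(1) unfolding dist_real_def by linarith
    thus ?case by (simp add: D_def \<omega>_def dist_real_def)
  qed
qed

lemma heegner_norm_form:
  fixes d :: int
  assumes d: "d \<in> {-1, -2, -3, -7, -11, -19, -43, -67, -163}"
  defines "t \<equiv> (if d mod 4 = 1 then 1 else 0)" and "m \<equiv> (if d mod 4 = 1 then (1 - d) div 4 else - d)"
  shows "heegner_order t m" 
    and "norm_form_nat d x y = heegner_order.nrm (heegner_order.pel t m (x, y))"
    and "norm_form_pairs d N = heegner_order.pairs t m N"
proof -
  show H: "heegner_order t m"
    using d by unfold_locales (auto simp: t_def m_def)
  interpret heegner_order t m by (rule H)
  have neg: "d < 0" using d by auto
  have eq: "int (norm_form_nat d x y) = q (int x) (int y)" for x y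
  proof -
    have "complex_of_int (int (norm_form_nat d x y)) = norm_form d (of_nat x) (of_nat y)"
      using of_nat_norm_form_nat[OF neg, of x y] by simp
    also have "\<dots> = of_int (q (int x) (int y))"
      unfolding norm_form_of_nat[OF neg] q_def unfolding t_def m_def by simp
    finally show ?thesis unfolding of_int_eq_iff .
  qed
  have "int (nrm (pel (x, y))) = int (norm_form_nat d x y)" unfolding eq pel_def prod.case nrm_el ..
  thus "norm_form_nat d x y = nrm (pel (x, y))" by simp
  show "norm_form_pairs d N = pairs N"
    unfolding norm_form_pairs_def pairs_def by (simp add: eq[symmetric])
qed

lemma uniquely_ergodic_real_average:
  fixes f :: "'a::metric_space \<Rightarrow> real"
  assumes d: "d \<in> {-1, -2, -3, -7, -11, -19, -43, -67, -163}"
    and sys: "uniquely_ergodic_system X \<mu> T" and x: "x \<in> X" and f: "continuous_on X f"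
  shows "(\<lambda>N. (\<Sum>(n1, n2)\<in>norm_form_pairs d N. f ((T ^^ big_Omega (norm_form_nat d n1 n2)) x)) / norm_form_count d N)
    \<longlonglongrightarrow> (\<integral>y. f y \<partial>\<mu>)"
proof -
  define t :: int where "t = (if d mod 4 = 1 then 1 else 0)"
  define m where "m = (if d mod 4 = 1 then (1 - d) div 4 else - d)"
  note H = heegner_norm_form[OF d, folded t_def m_def]
  interpret heegner_order t m by (rule H(1))
  have X: "compact X" "T ` X \<subseteq> X" using sys unfolding uniquely_ergodic_system_def by auto
  have orbit: "(T ^^ n) x \<in> X" for n using X(2) x by (induction n) auto
  obtain A where A: "\<And>y. y \<in> X \<Longrightarrow> \<bar>f y\<bar> \<le> A"
    using compact_imp_bounded[OF compact_continuous_image[OF f X(1)]] unfolding bounded_iff by auto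
  define a where "a n = f ((T ^^ n) x)" for n
  have "(\<lambda>N. (\<Sum>z\<in>pairs N. a (big_Omega (nrm (pel z)))) / card (pairs N)) \<longlonglongrightarrow> (\<integral>y. f y \<partial>\<mu>)"
  proof (rule pairs_average_tendsto)
    show "\<bar>a n\<bar> \<le> A" for n unfolding a_def by (rule A[OF orbit])
    fix e :: real assume e: "e > 0"
    obtain M where M: "M > 0" "\<And>y. y \<in> X \<Longrightarrow> \<bar>(\<Sum>k<M. f ((T ^^ k) y)) / real M - (\<integral>y. f y \<partial>\<mu>)\<bar> \<le> e"
      using uniform_ergodic_averages[OF sys f e] by blast
    have "a (n + k) = f ((T ^^ k) ((T ^^ n) x))" for n k
      unfolding a_def by (simp add: funpow_add add.commute[of n k])
    thus "\<exists>M>0. \<forall>n. \<bar>(\<Sum>k<M. a (n + k)) / real M - (\<integral>y. f y \<partial>\<mu>)\<bar> \<le> e"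
      using M(1) M(2)[OF orbit] by auto
  qed
  thus ?thesis by (simp add: norm_form_count_def H(2,3) a_def case_prod_unfold)
qed

theorem theorem3:
  fixes d :: int
    and X :: "'a::metric_space set"
    and \<mu> :: "'a measure"
    and T :: "'a \<Rightarrow> 'a"
    and f :: "'a \<Rightarrow> complex"
    and x :: 'a
  assumes "d \<in> {-1, -2, -3, -7, -11, -19, -43, -67, -163}"
    and "uniquely_ergodic_system X \<mu> T"
    and "x \<in> X"
    and "continuous_on X f"
  shows "(\<lambda>N. 1 / of_nat (norm_form_count d N) *
            (\<Sum>(n1, n2)\<in>norm_form_pairs d N. f ((T ^^ big_Omega (norm_form_nat d n1 n2)) x)))
         \<longlonglongrightarrow> (\<integral>y. f y \<partial>\<mu>)"
proof -
  have f: "continuous_on X f" by fact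
  have inv: "invariant_prob_measure X T \<mu>" and X: "compact X"
    using assms(2) unfolding uniquely_ergodic_system_def by auto
  interpret prob_space \<mu> using inv by (simp add: invariant_prob_measure_def)
  have sets: "sets \<mu> = sets (restrict_space borel X)" using inv by (simp add: invariant_prob_measure_def)
  have space: "space \<mu> = X" using sets_eq_imp_space_eq[OF sets] by (simp add: space_restrict_space)
  have meas: "f \<in> borel_measurable \<mu>"
    using borel_measurable_continuous_on_restrict[OF f] unfolding measurable_cong_sets[OF sets refl] .
  obtain B where B: "\<And>y. y \<in> X \<Longrightarrow> norm (f y) \<le> B"
    using compact_imp_bounded[OF compact_continuous_image[OF f X]] unfolding bounded_iff by auto
  have int: "integrable \<mu> f"
    using meas B by (intro integrable_const_bound[of _ B]) (auto simp: space)
  define s where "s N = (\<Sum>(n1, n2)\<in>norm_form_pairs d N. f ((T ^^ big_Omega (norm_form_nat d n1 n2)) x))" for N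
  have Re: "(\<lambda>N. Re (1 / of_nat (norm_form_count d N) * s N)) \<longlonglongrightarrow> Re (\<integral>y. f y \<partial>\<mu>)"
  proof -
    have "(\<lambda>N. (\<Sum>(n1, n2)\<in>norm_form_pairs d N. Re (f ((T ^^ big_Omega (norm_form_nat d n1 n2)) x))) / norm_form_count d N)
        \<longlonglongrightarrow> (\<integral>y. Re (f y) \<partial>\<mu>)"
      by (rule uniquely_ergodic_real_average[OF assms(1-3) continuous_on_Re[OF f]])
    thus ?thesis using int by (simp add: s_def case_prod_unfold Re_divide_of_nat integral_Re)
  qed
  have Im: "(\<lambda>N. Im (1 / of_nat (norm_form_count d N) * s N)) \<longlonglongrightarrow> Im (\<integral>y. f y \<partial>\<mu>)"
  proof -
    have "(\<lambda>N. (\<Sum>(n1, n2)\<in>norm_form_pairs d N. Im (f ((T ^^ big_Omega (norm_form_nat d n1 n2)) x))) / norm_form_count d N)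
        \<longlonglongrightarrow> (\<integral>y. Im (f y) \<partial>\<mu>)"
      by (rule uniquely_ergodic_real_average[OF assms(1-3) continuous_on_Im[OF f]])
    thus ?thesis using int by (simp add: s_def case_prod_unfold Im_divide_of_nat integral_Im)
  qed
  show ?thesis using Re Im unfolding tendsto_complex_iff s_def by blast
qed

end
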